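(* Let $L=L_K(E)$ be the Leavitt path algebra of an arbitrary graph $E$ over an arbitrary field $K$. The following are equivalent. (1) Every proper ideal of $L$ is the product of finitely many completely irreducible ideals. (2) Every proper ideal of $L$ is the intersection of finitely many completely irreducible ideals. (3) The graph $E$ satisfies condition (K), and for every admissible pair $(H,S)$ with $H\ne E^0$, the set $(E\backslash(H,S))^0$ is the union of finitely many maximal tails (of the graph $E\backslash(H,S)$), each satisfying the strong CSP.
   Context: A graph $E=(E^0,E^1,r,s)$ is a directed graph: a nonempty set $E^0$ of vertices, a set $E^1$ of edges, and range and source maps $r,s:E^1\to E^0$ (no finiteness or countability assumptions). A vertex $v$ is regular if $s^{-1}(v)$ is finite and nonempty, and an infinite emitter if $s^{-1}(v)$ is infinite. For a field $K$, the Leavitt path algebra $L_K(E)$ is the (associative, not necessarily unital) $K$-algebra generated by $\{v\mid v\in E^0\}\cup\{e,e^*\mid e\in E^1\}$ subject to: $vw=\delta_{v,w}v$ for $v,w\in E^0$; $s(e)e=er(e)=e$ and $r(e)e^*=e^*s(e)=e^*$ for $e\in E^1$; $e^*f=\delta_{e,f}r(e)$ for $e,f\in E^1$; and $v=\sum_{e\in s^{-1}(v)}ee^*$ for every regular $v\in E^0$. A path is a finite sequence $\mu=e_1\cdots e_n$ of edges with $r(e_i)=s(e_{i+1})$, with source $s(e_1)$ and range $r(e_n)$; vertices are paths of length $0$. A closed path is a path $e_1\cdots e_n$ ($n\ge1$) with $r(e_n)=s(e_1)$. The graph satisfies condition (K) if any vertex on a closed path $\mu$ is also the source of a closed path different from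 $\mu$ (i.e. having a different set of edges). Write $u\ge v$ if there is a path (possibly of length $0$) from $u$ to $v$. A set $X$ of vertices is downward directed if it is nonempty and for all $u,v\in X$ there is $w\in X$ with $u\ge w$ and $v\ge w$; hereditary if $u\in X$ and $u\ge v$ imply $v\in X$; saturated if for every regular vertex $v$, $r(s^{-1}(v))\subseteq X$ implies $v\in X$. A maximal tail of a graph is a nonempty set $M$ of vertices such that: (MT1) $v\in M$ and $u\ge v$ imply $u\in M$; (MT2) for every regular $v\in M$ there is an edge $e$ with $s(e)=v$ and $r(e)\in M$; (MT3) $M$ is downward directed. For $H\subseteq E^0$ hereditary and saturated, the set $B_H$ of breaking vertices consists of the infinite emitters $v\in E^0\setminus H$ with $0<|s^{-1}(v)\cap r^{-1}(E^0\setminus H)|<\aleph_0$. An admissible pair is $(H,S)$ with $H$ hereditary saturated and $S\subseteq B_H$. The quotient graph $E\backslash(H,S)$ has vertex set $(E^0\setminus H)\cup\{v'\mid v\in B_H\setminus S\}$ and edge set $\{e\in E^1\mid r(e)\notin H\}\cup\{e'\mid e\in E^1,\ r(e)\in B_H\setminus S\}$ (the $v'$, $e'$ being new symbols), with $r,s$ as in $E$ on the old edges and $s(e')=s(e)$, $r(e')=r(e)'$. A nonempty set $X$ of vertices of a graph $F$ satisfies the countable separation property (CSP) with respect to a countable subset $T\subseteq X$ if for every $u\in X$ there is $v\in T$ with $u\ge v$. $X$ satisfies the strong CSP if it satisfies the CSP with respect to some countable $T\subseteq X$ that is contained in every nonempty hereditary saturated subset of $X$ (hereditary and saturated as subsets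 of $F^0$). Here $F=E\backslash(H,S)$. "Ideal" means two-sided ideal; products of ideals consist of finite sums of products. A proper ideal $I$ is completely irreducible if it is not the intersection of any set of ideals properly containing $I$. *)

theory Defs
  imports
    "HOL-Library.Poly_Mapping"
    "HOL-Library.Countable_Set"
    "HOL-Algebra.QuotRing"
    "HOL-Algebra.Ideal_Product"
    "Graph_Theory.Arc_Walk"
begin

section \<open>Directed graphs\<close>

text \<open>
  A graph is a \<^locale>\<open>wf_digraph\<close> with nonempty vertex set; the source map is \<^const>\<open>tail\<close>, the
  range map is \<^const>\<open>head\<close>, and \<^term>\<open>out_arcs G v\<close> is the fibre of the source map over
  \<^term>\<open>v\<close>. A path from \<^term>\<open>u\<close> to \<^term>\<open>v\<close> is an arc walk; the empty arc list stands for
  the path of length 0 at \<^term>\<open>u\<close>.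
\<close>

definition regular :: "('v, 'e) pre_digraph \<Rightarrow> 'v \<Rightarrow> bool" where
  "regular G v \<longleftrightarrow> v \<in> verts G \<and> finite (out_arcs G v) \<and> out_arcs G v \<noteq> {}"

definition infinite_emitter :: "('v, 'e) pre_digraph \<Rightarrow> 'v \<Rightarrow> bool" where
  "infinite_emitter G v \<longleftrightarrow> v \<in> verts G \<and> infinite (out_arcs G v)"

definition path_ge :: "('v, 'e) pre_digraph \<Rightarrow> 'v \<Rightarrow> 'v \<Rightarrow> bool" where
  "path_ge G u v \<longleftrightarrow> (\<exists>p. pre_digraph.awalk G u p v)"

definition closed_path :: "('v, 'e) pre_digraph \<Rightarrow> 'v \<Rightarrow> 'e list \<Rightarrow> bool" where
  "closed_path G u p \<longleftrightarrow> p \<noteq> [] \<and> pre_digraph.awalk G u p u"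

text \<open>Two closed paths are regarded as different when their sets of edges differ.\<close>

definition condition_K :: "('v, 'e) pre_digraph \<Rightarrow> bool" where
  "condition_K G \<longleftrightarrow>
     (\<forall>u p. closed_path G u p \<longrightarrow>
       (\<forall>v \<in> set (pre_digraph.awalk_verts G u p). \<exists>q. closed_path G v q \<and> set q \<noteq> set p))"

definition downward_directed :: "('v, 'e) pre_digraph \<Rightarrow> 'v set \<Rightarrow> bool" where
  "downward_directed G X \<longleftrightarrow>
     X \<noteq> {} \<and> (\<forall>u \<in> X. \<forall>v \<in> X. \<exists>w \<in> X. path_ge G u w \<and> path_ge G v w)"

definition hereditary :: "('v, 'e) pre_digraph \<Rightarrow> 'v set \<Rightarrow> bool" where
  "hereditary G X \<longleftrightarrow> X \<subseteq> verts G \<and> (\<forall>u v. u \<in> X \<longrightarrow> path_ge G u v \<longrightarrow> v \<in> X)"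

definition saturated :: "('v, 'e) pre_digraph \<Rightarrow> 'v set \<Rightarrow> bool" where
  "saturated G X \<longleftrightarrow>
     X \<subseteq> verts G \<and> (\<forall>v. regular G v \<longrightarrow> head G ` out_arcs G v \<subseteq> X \<longrightarrow> v \<in> X)"

definition maximal_tail :: "('v, 'e) pre_digraph \<Rightarrow> 'v set \<Rightarrow> bool" where
  "maximal_tail G M \<longleftrightarrow>
     M \<noteq> {} \<and> M \<subseteq> verts G \<and>
     (\<forall>u v. v \<in> M \<longrightarrow> path_ge G u v \<longrightarrow> u \<in> M) \<and>
     (\<forall>v \<in> M. regular G v \<longrightarrow> (\<exists>e \<in> out_arcs G v. head G e \<in> M)) \<and>
     downward_directed G M"

definition breaking_vertices :: "('v, 'e) pre_digraph \<Rightarrow> 'v set \<Rightarrow> 'v set" where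
  "breaking_vertices G H =
     {v \<in> verts G - H. infinite_emitter G v \<and>
        finite {e \<in> out_arcs G v. head G e \<notin> H} \<and> {e \<in> out_arcs G v. head G e \<notin> H} \<noteq> {}}"

definition admissible_pair :: "('v, 'e) pre_digraph \<Rightarrow> 'v set \<Rightarrow> 'v set \<Rightarrow> bool" where
  "admissible_pair G H S \<longleftrightarrow> hereditary G H \<and> saturated G H \<and> S \<subseteq> breaking_vertices G H"

text \<open>
  In a quotient graph, \<^term>\<open>Old x\<close> is the original vertex or edge \<^term>\<open>x\<close> and \<^term>\<open>Primed x\<close>
  is the new symbol written \<^emph>\<open>x'\<close> in the literature.
\<close>

datatype 'a copy = Old 'a | Primed 'a

definition quotient_graph ::
    "('v, 'e) pre_digraph \<Rightarrow> 'v set \<Rightarrow> 'v set \<Rightarrow> ('v copy, 'e copy) pre_digraph" where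
  "quotient_graph G H S =
     \<lparr> verts = Old ` (verts G - H) \<union> Primed ` (breaking_vertices G H - S),
       arcs = Old ` {e \<in> arcs G. head G e \<notin> H}
            \<union> Primed ` {e \<in> arcs G. head G e \<in> breaking_vertices G H - S},
       tail = (\<lambda>x. case x of Old e \<Rightarrow> Old (tail G e) | Primed e \<Rightarrow> Old (tail G e)),
       head = (\<lambda>x. case x of Old e \<Rightarrow> Old (head G e) | Primed e \<Rightarrow> Primed (head G e)) \<rparr>"

definition CSP_wrt :: "('v, 'e) pre_digraph \<Rightarrow> 'v set \<Rightarrow> 'v set \<Rightarrow> bool" where
  "CSP_wrt G X T \<longleftrightarrow> countable T \<and> T \<subseteq> X \<and> (\<forall>u \<in> X. \<exists>v \<in> T. path_ge G u v)"

definition strong_CSP :: "('v, 'e) pre_digraph \<Rightarrow> 'v set \<Rightarrow> bool" where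
  "strong_CSP G X \<longleftrightarrow>
     (\<exists>T. CSP_wrt G X T \<and>
        (\<forall>Y. Y \<noteq> {} \<longrightarrow> Y \<subseteq> X \<longrightarrow> hereditary G Y \<longrightarrow> saturated G Y \<longrightarrow> T \<subseteq> Y))"


section \<open>Leavitt path algebras\<close>

datatype ('v, 'e) gen = Vert 'v | Edge 'e | Ghost 'e

text \<open>
  Words form a monoid under concatenation, written additively because the convolution product of
  \<^type>\<open>poly_mapping\<close> is based on addition of exponents. Hence the finitely supported functions
  from words to the coefficients are the free unital associative algebra.
\<close>

datatype 'g gen_word = Word (letters: "'g list")

instantiation gen_word :: (type) monoid_add
begin

definition zero_gen_word :: "'a gen_word" where
  "0 = Word []"

definition plus_gen_word :: "'a gen_word \<Rightarrow> 'a gen_word \<Rightarrow> 'a gen_word" where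
  "v + w = Word (letters v @ letters w)"

instance
  by standard (simp_all add: zero_gen_word_def plus_gen_word_def)

end

type_synonym ('v, 'e, 'k) lpa_poly = "('v, 'e) gen gen_word \<Rightarrow>\<^sub>0 'k"

abbreviation var :: "('v, 'e) gen \<Rightarrow> ('v, 'e, 'k::field) lpa_poly" where
  "var x \<equiv> Poly_Mapping.single (Word [x]) 1"

definition generators :: "('v, 'e) pre_digraph \<Rightarrow> ('v, 'e) gen set" where
  "generators G = Vert ` verts G \<union> Edge ` arcs G \<union> Ghost ` arcs G"

text \<open>
  The free non-unital algebra: only nonempty words occur. The field \<^const>\<open>one\<close> of the
  record type has no meaning here (its value is not in the carrier) and is never used.
\<close>

definition free_algebra :: "('v, 'e) pre_digraph \<Rightarrow> ('v, 'e, 'k::field) lpa_poly ring" where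
  "free_algebra G =
     \<lparr> carrier = {p. \<forall>w \<in> Poly_Mapping.keys p. letters w \<noteq> [] \<and> set (letters w) \<subseteq> generators G},
       mult = (*), one = 1, zero = 0, add = (+) \<rparr>"

inductive_set lpa_relators :: "('v, 'e) pre_digraph \<Rightarrow> ('v, 'e, 'k::field) lpa_poly set"
  for G :: "('v, 'e) pre_digraph" where
  vertices: "v \<in> verts G \<Longrightarrow> w \<in> verts G \<Longrightarrow>
    var (Vert v) * var (Vert w) - (if v = w then var (Vert v) else 0) \<in> lpa_relators G"
| source_edge: "e \<in> arcs G \<Longrightarrow> var (Vert (tail G e)) * var (Edge e) - var (Edge e) \<in> lpa_relators G"
| edge_range: "e \<in> arcs G \<Longrightarrow> var (Edge e) * var (Vert (head G e)) - var (Edge e) \<in> lpa_relators G"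
| range_ghost: "e \<in> arcs G \<Longrightarrow> var (Vert (head G e)) * var (Ghost e) - var (Ghost e) \<in> lpa_relators G"
| ghost_source: "e \<in> arcs G \<Longrightarrow> var (Ghost e) * var (Vert (tail G e)) - var (Ghost e) \<in> lpa_relators G"
| CK1: "e \<in> arcs G \<Longrightarrow> f \<in> arcs G \<Longrightarrow>
    var (Ghost e) * var (Edge f) - (if e = f then var (Vert (head G e)) else 0) \<in> lpa_relators G"
| CK2: "regular G v \<Longrightarrow>
    var (Vert v) - (\<Sum>e \<in> out_arcs G v. var (Edge e) * var (Ghost e)) \<in> lpa_relators G"

text \<open>
  The algebra ideal generated by the relators. Closure under scalars is a separate rule since the
  free non-unital algebra does not contain the constants.
\<close>

inductive_set lpa_ideal :: "('v, 'e) pre_digraph \<Rightarrow> ('v, 'e, 'k::field) lpa_poly set"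
  for G :: "('v, 'e) pre_digraph" where
  relator: "p \<in> lpa_relators G \<Longrightarrow> p \<in> lpa_ideal G"
| zero: "0 \<in> lpa_ideal G"
| add: "p \<in> lpa_ideal G \<Longrightarrow> q \<in> lpa_ideal G \<Longrightarrow> p + q \<in> lpa_ideal G"
| scale: "p \<in> lpa_ideal G \<Longrightarrow> Poly_Mapping.single 0 c * p \<in> lpa_ideal G"
| mult_left: "p \<in> lpa_ideal G \<Longrightarrow> q \<in> carrier (free_algebra G) \<Longrightarrow> q * p \<in> lpa_ideal G"
| mult_right: "p \<in> lpa_ideal G \<Longrightarrow> q \<in> carrier (free_algebra G) \<Longrightarrow> p * q \<in> lpa_ideal G"

definition leavitt_path_algebra ::
    "'k::field itself \<Rightarrow> ('v, 'e) pre_digraph \<Rightarrow> ('v, 'e, 'k) lpa_poly set ring" where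
  "leavitt_path_algebra K G = free_algebra G Quot lpa_ideal G"


section \<open>Ideals of rings without unit\<close>

text \<open>The locale \<^locale>\<open>ideal\<close> presupposes a unital ring.\<close>

definition two_sided_ideal :: "('a, 'm) ring_scheme \<Rightarrow> 'a set \<Rightarrow> bool" where
  "two_sided_ideal R I \<longleftrightarrow>
     additive_subgroup I R \<and>
     (\<forall>a \<in> I. \<forall>x \<in> carrier R. x \<otimes>\<^bsub>R\<^esub> a \<in> I \<and> a \<otimes>\<^bsub>R\<^esub> x \<in> I)"

definition proper_ideal :: "('a, 'm) ring_scheme \<Rightarrow> 'a set \<Rightarrow> bool" where
  "proper_ideal R I \<longleftrightarrow> two_sided_ideal R I \<and> I \<noteq> carrier R"

text \<open>The empty family may be left out: its intersection is the whole ring.\<close>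

definition completely_irreducible :: "('a, 'm) ring_scheme \<Rightarrow> 'a set \<Rightarrow> bool" where
  "completely_irreducible R I \<longleftrightarrow>
     proper_ideal R I \<and>
     \<not> (\<exists>\<J>. \<J> \<noteq> {} \<and> (\<forall>J \<in> \<J>. two_sided_ideal R J \<and> I \<subset> J) \<and> I = \<Inter>\<J>)"

text \<open>
  Only products of at least one factor are meaningful; the value for the empty list is irrelevant.
\<close>

fun ideal_list_prod :: "('a, 'm) ring_scheme \<Rightarrow> 'a set list \<Rightarrow> 'a set" where
  "ideal_list_prod R [] = carrier R"
| "ideal_list_prod R [I] = I"
| "ideal_list_prod R (I # J # Js) = ideal_prod R I (ideal_list_prod R (J # Js))"

end

theory Submission
  imports Defs
    "HOL-Library.Function_Algebras"
    "HOL-Library.Sublist"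
    "HOL-Computational_Algebra.Polynomial_FPS"
begin

text \<open>
  Under (K) every ideal is the kernel of the homomorphism onto the algebra of a quotient graph: by the
  reduction theorem a nonzero ideal contains a vertex, since an element \<open>k v + \<Sum> k\<^sub>i \<beta>\<^sub>i\<close> with closed
  paths \<open>\<beta>\<^sub>i\<close> at \<open>v\<close> can be compressed to \<open>k v\<close> by a closed path \<open>\<gamma>\<close> that is not a prefix of any
  \<open>\<beta>\<^sub>i \<gamma>\<close>. Hence ideals are idempotent, products of ideals are intersections, and the zero ideal is
  completely irreducible iff some vertex lies in all nonempty hereditary saturated sets. The vertices
  that such a vertex reaches through regular vertices form the countable set of the strong CSP.
  If (K) fails, some vertex is the base of a cycle \<open>c\<close> whose powers are the only closed paths there.
  Letting \<open>c\<close> act by a nonconstant unit of the power series ring gives a module whose annihilator is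
  prime but is the intersection of the annihilators of its quotients modulo the powers of \<open>X\<close>; a prime
  ideal that is not completely irreducible is neither a finite product nor a finite intersection of
  completely irreducible ideals.
\<close>

section \<open>Linear actions of the free algebra\<close>

text \<open>No normal form for elements of the algebra is used. That an element is nonzero, or that
  a vertex lies outside an ideal, is shown by letting the algebra act on something, and the
  branching systems serve this purpose: one of them realises any hereditary saturated set as the
  vertex set of an ideal, another is the twisted module. The coefficients of the latter are power
  series because a twist by a scalar of the field would make \<open>c\<close> act as a constant, and
  there would be no filtration that produces larger ideals meeting in the annihilator. Equality in
  the algebra is congruence modulo an ideal of the free algebra, and the isomorphism with the
  algebra of a quotient graph is a pair of substitutions that are inverse up to congruence. Under
  (K) it turns every proper ideal into the null ideal over some quotient graph, so that (2) and (3)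
  have to be compared only there. The countable set arises although the graph is arbitrary because a
  vertex enters a saturation only as a regular vertex, that is, through finitely many edges.\<close>

lemma poly_mapping_sum_singles:
  "p = (\<Sum>w \<in> Poly_Mapping.keys p. Poly_Mapping.single w (Poly_Mapping.lookup p w))"
  by (rule poly_mapping_eqI)
    (simp add: lookup_sum lookup_single when_def in_keys_iff sum.delta)

lemma poly_mapping_add_induct [case_names zero single add]:
  assumes "P 0" and "\<And>w c. P (Poly_Mapping.single w c)"
    and "\<And>p q. P p \<Longrightarrow> P q \<Longrightarrow> P (p + q)"
  shows "P (p :: 'a \<Rightarrow>\<^sub>0 'b::comm_monoid_add)"
proof -
  have "P (\<Sum>w \<in> A. Poly_Mapping.single w (Poly_Mapping.lookup p w))" if "finite A" for A
    using that by (induction A) (auto intro: assms)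
  then show ?thesis by (subst poly_mapping_sum_singles) simp
qed

lemma letters_plus [simp]: "letters (v + w) = letters v @ letters w"
  by (simp add: plus_gen_word_def)

lemma letters_zero [simp]: "letters 0 = []"
  by (simp add: zero_gen_word_def)

lemma gen_word_plus_eq_0_iff [simp]:
  "v + w = (0 :: 'g gen_word) \<longleftrightarrow> v = 0 \<and> w = 0"
  by (cases v; cases w) (simp add: plus_gen_word_def zero_gen_word_def)

lemma Word_Nil: "Word [] = 0"
  by (simp add: zero_gen_word_def)

lemma Word_Cons: "Word (g # gs) = Word [g] + Word gs"
  by (simp add: plus_gen_word_def)

lemma single_Word_Cons:
  "Poly_Mapping.single (Word (g # gs)) (c :: 'k::field) =
    Poly_Mapping.single (Word [g]) 1 * Poly_Mapping.single (Word gs) c"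
  by (simp add: Word_Cons [of g gs] mult_single)

text \<open>Instantiated twice: with letters acting by left multiplication, which yields
  substitution homomorphisms, and with letters acting on the functions on a branching
  system.\<close>

locale word_action = vector_space scale
  for scale :: "'k::field \<Rightarrow> 'b::ab_group_add \<Rightarrow> 'b" +
  fixes gen_op :: "'g \<Rightarrow> 'b \<Rightarrow> 'b"
  assumes gen_op_add: "gen_op g (x + y) = gen_op g x + gen_op g y"
    and gen_op_scale: "gen_op g (scale c x) = scale c (gen_op g x)"
begin

definition act_word :: "'g gen_word \<Rightarrow> 'b \<Rightarrow> 'b" where
  "act_word w = foldr gen_op (letters w)"

definition act :: "('g gen_word \<Rightarrow>\<^sub>0 'k) \<Rightarrow> 'b \<Rightarrow> 'b" where
  "act p x = (\<Sum>w \<in> Poly_Mapping.keys p. scale (Poly_Mapping.lookup p w) (act_word w x))"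

lemma act_word_plus: "act_word (v + w) x = act_word v (act_word w x)"
  by (simp add: act_word_def)

lemma act_word_add: "act_word w (x + y) = act_word w x + act_word w y"
proof -
  have "foldr gen_op gs (x + y) = foldr gen_op gs x + foldr gen_op gs y" for gs
    by (induction gs) (simp_all add: gen_op_add)
  then show ?thesis by (simp add: act_word_def)
qed

lemma act_word_scale: "act_word w (scale c x) = scale c (act_word w x)"
proof -
  have "foldr gen_op gs (scale c x) = scale c (foldr gen_op gs x)" for gs
    by (induction gs) (simp_all add: gen_op_scale)
  then show ?thesis by (simp add: act_word_def)
qed

lemma act_superset:
  assumes "finite A" "Poly_Mapping.keys p \<subseteq> A"
  shows "act p x = (\<Sum>w \<in> A. scale (Poly_Mapping.lookup p w) (act_word w x))"
  unfolding act_def using assms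
  by (intro sum.mono_neutral_left) (auto simp: in_keys_iff)

lemma act_zero_left [simp]: "act 0 x = 0"
  by (simp add: act_def)

lemma act_single: "act (Poly_Mapping.single w c) x = scale c (act_word w x)"
  by (simp add: act_superset [of "{w}"])

lemma act_add_left: "act (p + q) x = act p x + act q x"
proof -
  let ?A = "Poly_Mapping.keys p \<union> Poly_Mapping.keys q"
  have "Poly_Mapping.keys (p + q) \<subseteq> ?A" by (rule keys_add)
  then show ?thesis
    by (simp add: act_superset [of ?A] lookup_add scale_left_distrib sum.distrib)
qed

lemma act_uminus_left: "act (- p) x = - act p x"
  using act_add_left [of p "- p" x] by (simp add: eq_neg_iff_add_eq_0 add.commute)

lemma act_diff_left: "act (p - q) x = act p x - act q x"
  using act_add_left [of p "- q" x] by (simp add: act_uminus_left)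

lemma act_sum_left: "act (\<Sum>i \<in> A. p i) x = (\<Sum>i \<in> A. act (p i) x)"
  by (induction A rule: infinite_finite_induct) (simp_all add: act_add_left)

lemma act_add_right: "act p (x + y) = act p x + act p y"
  by (simp add: act_def act_word_add scale_right_distrib sum.distrib)

lemma act_zero_right [simp]: "act p 0 = 0"
  using act_add_right [of p 0 0] by simp

lemma act_sum_right: "act p (\<Sum>i \<in> A. x i) = (\<Sum>i \<in> A. act p (x i))"
  by (induction A rule: infinite_finite_induct) (simp_all add: act_add_right)

lemma act_one [simp]: "act 1 x = x"
  using act_single [of 0 1 x] by (simp add: act_word_def)

lemma act_var [simp]: "act (Poly_Mapping.single (Word [g]) 1) x = gen_op g x"
  by (simp add: act_single act_word_def)

lemma act_const [simp]: "act (Poly_Mapping.single 0 c) x = scale c x"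
  by (simp add: act_single act_word_def)

lemma act_mult: "act (p * q) x = act p (act q x)"
proof (induction p rule: poly_mapping_add_induct)
  case (single w c)
  show ?case
  proof (induction q rule: poly_mapping_add_induct)
    case (single v d)
    then show ?case by (simp add: mult_single act_single act_word_plus act_word_scale)
  next
    case (add p q)
    then show ?case by (simp add: distrib_left act_add_left act_add_right)
  qed simp
next
  case (add p q)
  then show ?case by (simp add: distrib_right act_add_left)
qed simp

end

section \<open>Substitution homomorphisms\<close>

interpretation poly_scale: vector_space "\<lambda>c (p :: 'g gen_word \<Rightarrow>\<^sub>0 'k::field). Poly_Mapping.single 0 c * p"
  by unfold_locales (simp_all add: single_add algebra_simps mult_single flip: mult.assoc)

lemma const_mult_commute:
  fixes p :: "'g gen_word \<Rightarrow>\<^sub>0 'k::field"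
  shows "Poly_Mapping.single 0 c * p = p * Poly_Mapping.single 0 c"
  by (induction p rule: poly_mapping_add_induct) (simp_all add: mult_single algebra_simps)

interpretation subst_act: word_action "\<lambda>c p. Poly_Mapping.single 0 c * p" "\<lambda>g p. h g * p"
  for h :: "'g \<Rightarrow> 'h gen_word \<Rightarrow>\<^sub>0 'k::field"
  by unfold_locales
    (simp_all only: distrib_left const_mult_commute mult.assoc)

text \<open>The value at 1 of the action in which each letter \<open>g\<close> multiplies by
  \<open>h g\<close> from the left; multiplicativity is then inherited from
  \<open>act_mult\<close>.\<close>

definition subst :: "('g \<Rightarrow> 'h gen_word \<Rightarrow>\<^sub>0 'k::field) \<Rightarrow> ('g gen_word \<Rightarrow>\<^sub>0 'k) \<Rightarrow> 'h gen_word \<Rightarrow>\<^sub>0 'k" where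
  "subst h p = subst_act.act h p 1"

lemma subst_act_eq: "subst_act.act h p x = subst h p * x"
proof -
  have word: "foldr (\<lambda>g. (*) (h g)) gs x = foldr (\<lambda>g. (*) (h g)) gs 1 * x" for gs
    by (induction gs) (simp_all add: mult.assoc)
  show ?thesis
    unfolding subst_def subst_act.act_def subst_act.act_word_def sum_distrib_right mult.assoc
    by (rule sum.cong, rule refl, subst word, rule refl)
qed

lemma subst_zero [simp]: "subst h 0 = 0"
  and subst_one [simp]: "subst h 1 = 1"
  and subst_add [simp]: "subst h (p + q) = subst h p + subst h q"
  and subst_diff [simp]: "subst h (p - q) = subst h p - subst h q"
  and subst_uminus [simp]: "subst h (- p) = - subst h p"
  and subst_sum [simp]: "subst h (\<Sum>i \<in> A. f i) = (\<Sum>i \<in> A. subst h (f i))"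
  and subst_var [simp]: "subst h (Poly_Mapping.single (Word [g]) 1) = h g"
  and subst_const [simp]: "subst h (Poly_Mapping.single 0 c) = Poly_Mapping.single 0 c"
  by (simp_all add: subst_def subst_act.act_add_left subst_act.act_diff_left
      subst_act.act_uminus_left subst_act.act_sum_left)

lemma subst_mult [simp]: "subst h (p * q) = subst h p * subst h q"
  unfolding subst_def subst_act.act_mult by (simp add: subst_act_eq)

text \<open>Words grow by letters on the left, so a statement on a homomorphism or a congruence
  reduces to constants and single letters.\<close>

lemma gen_poly_induct [case_names const var_mult add]:
  assumes "\<And>c. P (Poly_Mapping.single 0 c)"
    and "\<And>g p. P p \<Longrightarrow> P (Poly_Mapping.single (Word [g]) 1 * p)"
    and "\<And>p q. P p \<Longrightarrow> P q \<Longrightarrow> P (p + q)"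
  shows "P (p :: 'g gen_word \<Rightarrow>\<^sub>0 'k::field)"
proof (induction p rule: poly_mapping_add_induct)
  case zero
  then show ?case using assms(1) [of 0] by simp
next
  case (single w c)
  have "P (Poly_Mapping.single (Word gs) c)" for gs
  proof (induction gs)
    case Nil
    then show ?case using assms(1) by (simp add: Word_Nil)
  next
    case (Cons g gs)
    then show ?case by (subst single_Word_Cons) (rule assms(2))
  qed
  then show ?case by (cases w) simp
qed (rule assms(3))

lemma lookup_zero_mult:
  fixes p q :: "'g gen_word \<Rightarrow>\<^sub>0 'k::field"
  shows "Poly_Mapping.lookup (p * q) 0 = Poly_Mapping.lookup p 0 * Poly_Mapping.lookup q 0"
proof (induction p rule: poly_mapping_add_induct)
  case (single w c)
  show ?case
  proof (induction q rule: poly_mapping_add_induct)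
    case (single v d)
    then show ?case by (simp add: mult_single lookup_single when_def)
  qed (simp_all add: lookup_add algebra_simps)
qed (simp_all add: lookup_add algebra_simps)

lemma lookup_zero_var [simp]: "Poly_Mapping.lookup (Poly_Mapping.single (Word [g]) c) 0 = 0"
  by (simp add: lookup_single when_def zero_gen_word_def)

text \<open>This keeps preimages of ideals under such substitutions inside
  \<open>augmentation\<close>.\<close>

lemma lookup_zero_subst:
  assumes "\<And>g. Poly_Mapping.lookup (h g) 0 = 0"
  shows "Poly_Mapping.lookup (subst h p) 0 = Poly_Mapping.lookup p 0"
  by (induction p rule: gen_poly_induct)
    (simp_all add: lookup_add lookup_zero_mult assms)

section \<open>Ideals of the free algebra\<close>

definition tideal :: "'a::ring_1 set \<Rightarrow> bool" where
  "tideal U \<longleftrightarrow> 0 \<in> U \<and> (\<forall>a \<in> U. \<forall>b \<in> U. a + b \<in> U) \<and> (\<forall>a \<in> U. \<forall>x. x * a \<in> U \<and> a * x \<in> U)"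

definition eqv :: "'a::ring_1 \<Rightarrow> 'a set \<Rightarrow> 'a \<Rightarrow> bool" ("_ \<simeq>\<^bsub>_\<^esub> _" [51, 0, 51] 50) where
  "a \<simeq>\<^bsub>U\<^esub> b \<longleftrightarrow> a - b \<in> U"

lemma tideal_zero: "tideal U \<Longrightarrow> 0 \<in> U"
  and tideal_add: "tideal U \<Longrightarrow> a \<in> U \<Longrightarrow> b \<in> U \<Longrightarrow> a + b \<in> U"
  and tideal_mult_left: "tideal U \<Longrightarrow> a \<in> U \<Longrightarrow> x * a \<in> U"
  and tideal_mult_right: "tideal U \<Longrightarrow> a \<in> U \<Longrightarrow> a * x \<in> U"
  by (auto simp: tideal_def)

lemma tideal_uminus: "tideal U \<Longrightarrow> a \<in> U \<Longrightarrow> - a \<in> U"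
  using tideal_mult_left [of U a "-1"] by simp

lemma tideal_diff: "tideal U \<Longrightarrow> a \<in> U \<Longrightarrow> b \<in> U \<Longrightarrow> a - b \<in> U"
  using tideal_add [of U a "- b"] by (simp add: tideal_uminus)

lemma tideal_sum: "tideal U \<Longrightarrow> (\<And>i. i \<in> A \<Longrightarrow> f i \<in> U) \<Longrightarrow> (\<Sum>i \<in> A. f i) \<in> U"
  by (induction A rule: infinite_finite_induct) (auto simp: tideal_zero tideal_add)

lemma tideal_Inter: "(\<And>U. U \<in> \<U> \<Longrightarrow> tideal U) \<Longrightarrow> tideal (\<Inter>\<U>)"
  unfolding tideal_def by blast

lemma eqv_refl: "tideal U \<Longrightarrow> a \<simeq>\<^bsub>U\<^esub> a"
  by (simp add: eqv_def tideal_zero)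

lemma eqv_sym: "tideal U \<Longrightarrow> a \<simeq>\<^bsub>U\<^esub> b \<Longrightarrow> b \<simeq>\<^bsub>U\<^esub> a"
  using tideal_uminus [of U "a - b"] by (simp add: eqv_def)

lemma eqv_trans: "tideal U \<Longrightarrow> a \<simeq>\<^bsub>U\<^esub> b \<Longrightarrow> b \<simeq>\<^bsub>U\<^esub> c \<Longrightarrow> a \<simeq>\<^bsub>U\<^esub> c"
  using tideal_add [of U "a - b" "b - c"] by (simp add: eqv_def)

lemma eqv_add: "tideal U \<Longrightarrow> a \<simeq>\<^bsub>U\<^esub> b \<Longrightarrow> c \<simeq>\<^bsub>U\<^esub> d \<Longrightarrow> a + c \<simeq>\<^bsub>U\<^esub> b + d"
  using tideal_add [of U "a - b" "c - d"] by (simp add: eqv_def algebra_simps)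

lemma eqv_diff: "tideal U \<Longrightarrow> a \<simeq>\<^bsub>U\<^esub> b \<Longrightarrow> c \<simeq>\<^bsub>U\<^esub> d \<Longrightarrow> a - c \<simeq>\<^bsub>U\<^esub> b - d"
  using tideal_diff [of U "a - b" "c - d"] by (simp add: eqv_def algebra_simps)

lemma eqv_mult: "tideal U \<Longrightarrow> a \<simeq>\<^bsub>U\<^esub> b \<Longrightarrow> c \<simeq>\<^bsub>U\<^esub> d \<Longrightarrow> a * c \<simeq>\<^bsub>U\<^esub> b * d"
  using tideal_add [of U "(a - b) * c" "b * (c - d)"] tideal_mult_left [of U "c - d" b]
    tideal_mult_right [of U "a - b" c]
  by (simp add: eqv_def algebra_simps)

lemma eqv_sum: "tideal U \<Longrightarrow> (\<And>i. i \<in> A \<Longrightarrow> f i \<simeq>\<^bsub>U\<^esub> g i) \<Longrightarrow> (\<Sum>i \<in> A. f i) \<simeq>\<^bsub>U\<^esub> (\<Sum>i \<in> A. g i)"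
  by (simp add: eqv_def tideal_sum flip: sum_subtractf)

lemma eqv_zero_iff: "a \<simeq>\<^bsub>U\<^esub> 0 \<longleftrightarrow> a \<in> U"
  by (simp add: eqv_def)

lemma eqv_mem_iff: "tideal U \<Longrightarrow> a \<simeq>\<^bsub>U\<^esub> b \<Longrightarrow> a \<in> U \<longleftrightarrow> b \<in> U"
  using tideal_add [of U "a - b" b] tideal_diff [of U a "a - b"] by (auto simp: eqv_def)

lemma eqv_mono: "U \<subseteq> V \<Longrightarrow> a \<simeq>\<^bsub>U\<^esub> b \<Longrightarrow> a \<simeq>\<^bsub>V\<^esub> b"
  by (auto simp: eqv_def)

text \<open>
  The constants make \<^typ>\<open>('v, 'e, 'k::field) lpa_poly\<close> a unital ring. The ideals of the Leavitt
  path algebra are in bijection with the two-sided ideals of this ring that contain the relators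
  and the letters that are not generators, and lie in the augmentation ideal. In this way all
  computations take place in a type-class ring.
\<close>

definition augmentation :: "('v, 'e, 'k::field) lpa_poly set" where
  "augmentation = {p. Poly_Mapping.lookup p 0 = 0}"

definition all_relators :: "('v, 'e) pre_digraph \<Rightarrow> ('v, 'e, 'k::field) lpa_poly set" where
  "all_relators G = lpa_relators G \<union> {var g | g. g \<notin> generators G}"

definition lid :: "('v, 'e) pre_digraph \<Rightarrow> ('v, 'e, 'k::field) lpa_poly set \<Rightarrow> bool" where
  "lid G U \<longleftrightarrow> tideal U \<and> all_relators G \<subseteq> U \<and> U \<subseteq> augmentation"

definition null_ideal :: "('v, 'e) pre_digraph \<Rightarrow> ('v, 'e, 'k::field) lpa_poly set" where
  "null_ideal G = \<Inter>{U. tideal U \<and> all_relators G \<subseteq> U}"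

lemma tideal_augmentation: "tideal augmentation"
  by (simp add: tideal_def augmentation_def lookup_add lookup_zero_mult)

lemma var_in_augmentation [simp]: "var g \<in> augmentation"
  by (simp add: augmentation_def)

lemma all_relators_subset_augmentation: "all_relators G \<subseteq> augmentation"
proof -
  have "p \<in> augmentation" if "p \<in> lpa_relators G" for p :: "('a, 'b, 'c) lpa_poly"
    using that
    by (induction rule: lpa_relators.induct)
      (auto intro!: tideal_diff [OF tideal_augmentation] tideal_mult_left [OF tideal_augmentation]
        tideal_sum [OF tideal_augmentation] simp: tideal_zero [OF tideal_augmentation])
  then show ?thesis by (auto simp: all_relators_def)
qed

lemma lid_augmentation: "lid G augmentation"
  by (simp add: lid_def tideal_augmentation all_relators_subset_augmentation)

lemma null_ideal_least: "tideal U \<Longrightarrow> all_relators G \<subseteq> U \<Longrightarrow> null_ideal G \<subseteq> U"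
  by (auto simp: null_ideal_def)

lemma lid_null_ideal: "lid G (null_ideal G)"
  unfolding lid_def
proof (intro conjI)
  show "tideal (null_ideal G)" unfolding null_ideal_def by (rule tideal_Inter) simp
  show "null_ideal G \<subseteq> augmentation"
    by (rule null_ideal_least [OF tideal_augmentation all_relators_subset_augmentation])
qed (auto simp: null_ideal_def)

lemma lid_tideal: "lid G U \<Longrightarrow> tideal U"
  by (simp add: lid_def)

lemma tideal_null_ideal: "tideal (null_ideal G)"
  by (rule lid_tideal [OF lid_null_ideal])

lemma null_ideal_relators: "all_relators G \<subseteq> null_ideal G"
  by (auto simp: null_ideal_def)

lemma null_ideal_subset: "lid G U \<Longrightarrow> null_ideal G \<subseteq> U"
  unfolding lid_def by (intro null_ideal_least) simp_all

lemma lid_Inter: "\<U> \<noteq> {} \<Longrightarrow> (\<And>U. U \<in> \<U> \<Longrightarrow> lid G U) \<Longrightarrow> lid G (\<Inter>\<U>)"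
  unfolding lid_def by (auto intro: tideal_Inter)

abbreviation vt :: "'v \<Rightarrow> ('v, 'e, 'k::field) lpa_poly" where "vt v \<equiv> var (Vert v)"
abbreviation ed :: "'e \<Rightarrow> ('v, 'e, 'k::field) lpa_poly" where "ed e \<equiv> var (Edge e)"
abbreviation gh :: "'e \<Rightarrow> ('v, 'e, 'k::field) lpa_poly" where "gh e \<equiv> var (Ghost e)"

lemma generators_iff [simp]:
  "Vert v \<in> generators G \<longleftrightarrow> v \<in> verts G"
  "Edge e \<in> generators G \<longleftrightarrow> e \<in> arcs G"
  "Ghost e \<in> generators G \<longleftrightarrow> e \<in> arcs G"
  by (auto simp: generators_def)

context
  fixes G :: "('v, 'e) pre_digraph" and U :: "('v, 'e, 'k::field) lpa_poly set"
  assumes U: "tideal U" "all_relators G \<subseteq> U"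
begin

lemma relator_mem: "p \<in> lpa_relators G \<Longrightarrow> p \<in> U"
  using U by (auto simp: all_relators_def)

lemma nongenerator_mem: "g \<notin> generators G \<Longrightarrow> var g \<in> U"
  using U by (auto simp: all_relators_def)

text \<open>Letters outside the graph lie in \<open>U\<close>, so both sides of a relation vanish
  for them. Most relations below therefore hold for all symbols, without membership
  conditions.\<close>

lemma nongenerator_mult:
  "g \<notin> generators G \<Longrightarrow> p * var g - var g \<in> U"
  "g \<notin> generators G \<Longrightarrow> var g * p - var g \<in> U"
  by (simp_all add: nongenerator_mem U tideal_diff tideal_mult_left tideal_mult_right)

lemma vt_vt_same: "vt v * vt v \<simeq>\<^bsub>U\<^esub> vt v"
  using relator_mem [OF lpa_relators.vertices [of v G v]] nongenerator_mult [of "Vert v" "vt v"]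
  by (cases "v \<in> verts G") (simp_all add: eqv_def)

lemma vt_vt_diff: "v \<noteq> w \<Longrightarrow> vt v * vt w \<in> U"
  using relator_mem [OF lpa_relators.vertices [of v G w]] nongenerator_mem [of "Vert v"]
    nongenerator_mem [of "Vert w"] U
  by (cases "v \<in> verts G \<and> w \<in> verts G") (auto simp: tideal_mult_left tideal_mult_right)

lemma tail_ed: "vt (tail G e) * ed e \<simeq>\<^bsub>U\<^esub> ed e"
  using relator_mem [OF lpa_relators.source_edge [of e G]] nongenerator_mult [of "Edge e"]
  by (cases "e \<in> arcs G") (simp_all add: eqv_def)

lemma ed_head: "ed e * vt (head G e) \<simeq>\<^bsub>U\<^esub> ed e"
  using relator_mem [OF lpa_relators.edge_range [of e G]] nongenerator_mult [of "Edge e"]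
  by (cases "e \<in> arcs G") (simp_all add: eqv_def)

lemma head_gh: "vt (head G e) * gh e \<simeq>\<^bsub>U\<^esub> gh e"
  using relator_mem [OF lpa_relators.range_ghost [of e G]] nongenerator_mult [of "Ghost e"]
  by (cases "e \<in> arcs G") (simp_all add: eqv_def)

lemma gh_tail: "gh e * vt (tail G e) \<simeq>\<^bsub>U\<^esub> gh e"
  using relator_mem [OF lpa_relators.ghost_source [of e G]] nongenerator_mult [of "Ghost e"]
  by (cases "e \<in> arcs G") (simp_all add: eqv_def)

text \<open>The condition on \<open>e\<close> is essential: for a symbol that is no edge the left
  side vanishes, while \<open>head G e\<close> may well be a vertex.\<close>

lemma gh_ed_same: "e \<in> arcs G \<Longrightarrow> gh e * ed e \<simeq>\<^bsub>U\<^esub> vt (head G e)"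
  using relator_mem [OF lpa_relators.CK1 [of e G e]] by (simp add: eqv_def)

lemma gh_ed_diff: "e \<noteq> f \<Longrightarrow> gh e * ed f \<in> U"
  using relator_mem [OF lpa_relators.CK1 [of e G f]] nongenerator_mem [of "Ghost e"]
    nongenerator_mem [of "Edge f"] U
  by (cases "e \<in> arcs G \<and> f \<in> arcs G") (auto simp: tideal_mult_left tideal_mult_right)

lemma vt_eqv_sum: "regular G v \<Longrightarrow> vt v \<simeq>\<^bsub>U\<^esub> (\<Sum>e \<in> out_arcs G v. ed e * gh e)"
  using relator_mem [OF lpa_relators.CK2 [of G v]] by (simp add: eqv_def)

end

fun gsource :: "('v, 'e) pre_digraph \<Rightarrow> ('v, 'e) gen \<Rightarrow> 'v" where
  "gsource G (Vert v) = v"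
| "gsource G (Edge e) = tail G e"
| "gsource G (Ghost e) = head G e"

lemma gsource_var:
  assumes "tideal U" "all_relators G \<subseteq> U"
  shows "vt (gsource G g) * var g \<simeq>\<^bsub>U\<^esub> var g"
  using assms by (cases g) (simp_all add: vt_vt_same tail_ed head_gh)

lemma vt_var_diff:
  assumes "tideal U" "all_relators G \<subseteq> U" "v \<noteq> gsource G g"
  shows "vt v * var g \<in> U"
proof -
  have "vt v * (vt (gsource G g) * var g) \<in> U"
    using vt_vt_diff [OF assms] assms(1) by (simp add: tideal_mult_right flip: mult.assoc)
  then show ?thesis
    using eqv_mem_iff [OF assms(1) eqv_mult [OF assms(1) eqv_refl [OF assms(1), of "vt v"]
      gsource_var [OF assms(1,2), of g]]] by simp
qed

text \<open>Modulo \<open>U\<close> each letter is its source vertex times itself, so all letters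
  lie in \<open>U\<close> once the vertices do, and \<open>augmentation\<close> consists of the
  combinations of nonempty words.\<close>

lemma lid_proper_vertex:
  assumes "lid G U" "\<And>v. v \<in> verts G \<Longrightarrow> vt v \<in> U"
  shows "U = augmentation"
proof
  show "U \<subseteq> augmentation" using assms(1) by (simp add: lid_def)
  have U: "tideal U" "all_relators G \<subseteq> U" using assms(1) by (simp_all add: lid_def)
  have v: "vt v \<in> U" for v
    using assms(2) nongenerator_mem [OF U, of "Vert v"] by (cases "v \<in> verts G") auto
  have g: "var g \<in> U" for g
    using eqv_mem_iff [OF U(1) gsource_var [OF U, of g]] v [of "gsource G g"] U(1)
    by (simp add: tideal_mult_right)
  show "augmentation \<subseteq> U"
  proof
    fix p :: "('a, 'b, 'c) lpa_poly" assume p: "p \<in> augmentation"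
    have "Poly_Mapping.single w (Poly_Mapping.lookup p w) \<in> U" for w
    proof (cases w)
      case (Word gs)
      show ?thesis
      proof (cases gs)
        case Nil
        then show ?thesis using p U(1) by (simp add: Word Word_Nil augmentation_def tideal_zero)
      next
        case (Cons h hs)
        then show ?thesis
          unfolding Word Cons by (subst single_Word_Cons) (rule tideal_mult_right [OF U(1) g])
      qed
    qed
    then show "p \<in> U" by (subst poly_mapping_sum_singles) (rule tideal_sum [OF U(1)])
  qed
qed

fun gtarget :: "('v, 'e) pre_digraph \<Rightarrow> ('v, 'e) gen \<Rightarrow> 'v" where
  "gtarget G (Vert v) = v"
| "gtarget G (Edge e) = head G e"
| "gtarget G (Ghost e) = tail G e"

lemma gtarget_var:
  assumes "tideal U" "all_relators G \<subseteq> U"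
  shows "var g * vt (gtarget G g) \<simeq>\<^bsub>U\<^esub> var g"
  using assms by (cases g) (simp_all add: vt_vt_same ed_head gh_tail)

lemma var_vt_diff:
  assumes "tideal U" "all_relators G \<subseteq> U" "v \<noteq> gtarget G g"
  shows "var g * vt v \<in> U"
proof -
  have "var g * vt (gtarget G g) * vt v \<in> U"
    using vt_vt_diff [OF assms(1,2) assms(3) [symmetric]] assms(1)
    by (simp add: tideal_mult_left mult.assoc)
  then show ?thesis
    using eqv_mem_iff [OF assms(1) eqv_mult [OF assms(1) gtarget_var [OF assms(1,2), of g]
      eqv_refl [OF assms(1), of "vt v"]]] by simp
qed

section \<open>Finite sums of vertices as local units\<close>

context
  fixes G :: "('v, 'e) pre_digraph" and U :: "('v, 'e, 'k::field) lpa_poly set"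
  assumes U: "tideal U" "all_relators G \<subseteq> U"
begin

lemma sum_vt_var:
  assumes "finite Y" "gsource G g \<in> Y"
  shows "(\<Sum>v \<in> Y. vt v) * var g \<simeq>\<^bsub>U\<^esub> var g"
proof -
  have "(\<Sum>v \<in> Y. vt v) * var g =
      vt (gsource G g) * var g + (\<Sum>v \<in> Y - {gsource G g}. vt v * var g)"
    using sum.remove [OF assms, of "\<lambda>v. vt v * var g"] by (simp add: sum_distrib_right)
  also have "\<dots> \<simeq>\<^bsub>U\<^esub> var g + 0"
    by (intro eqv_add U gsource_var)
      (simp add: eqv_zero_iff, rule tideal_sum [OF U(1)], rule vt_var_diff [OF U], auto)
  finally show ?thesis by simp
qed

lemma var_sum_vt:
  assumes "finite Y" "gtarget G g \<in> Y"
  shows "var g * (\<Sum>v \<in> Y. vt v) \<simeq>\<^bsub>U\<^esub> var g"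
proof -
  have "var g * (\<Sum>v \<in> Y. vt v) =
      var g * vt (gtarget G g) + (\<Sum>v \<in> Y - {gtarget G g}. var g * vt v)"
    using sum.remove [OF assms, of "\<lambda>v. var g * vt v"] by (simp add: sum_distrib_left)
  also have "\<dots> \<simeq>\<^bsub>U\<^esub> var g + 0"
    by (intro eqv_add U gtarget_var)
      (simp add: eqv_zero_iff, rule tideal_sum [OF U(1)], rule var_vt_diff [OF U], auto)
  finally show ?thesis by simp
qed

text \<open>The vertices at which the first letters of the words start add up to a left unit.
  Removing the constant term \<open>?c p\<close> lets the induction pass through arbitrary elements,
  and allowing every larger finite set \<open>Y\<close> lets two summands share one unit.\<close>

lemma local_unit_left:
  assumes "p \<in> augmentation"
  obtains Y where "finite Y" "(\<Sum>v \<in> Y. vt v) * p \<simeq>\<^bsub>U\<^esub> p"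
proof -
  let ?c = "\<lambda>p :: ('v, 'e, 'k) lpa_poly. Poly_Mapping.single 0 (Poly_Mapping.lookup p 0)"
  have "\<exists>X. finite X \<and> (\<forall>Y. finite Y \<longrightarrow> X \<subseteq> Y \<longrightarrow> (\<Sum>v \<in> Y. vt v) * (p - ?c p) \<simeq>\<^bsub>U\<^esub> p - ?c p)"
    for p :: "('v, 'e, 'k) lpa_poly"
  proof (induction p rule: gen_poly_induct)
    case (const c)
    show ?case using U by (intro exI [of _ "{}"]) (simp add: eqv_refl)
  next
    case (var_mult g p)
    show ?case
    proof (intro exI [of _ "{gsource G g}"] conjI allI impI)
      fix Y assume "finite Y" "{gsource G g} \<subseteq> Y"
      then have "(\<Sum>v \<in> Y. vt v) * var g * p \<simeq>\<^bsub>U\<^esub> var g * p"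
        using U by (intro eqv_mult sum_vt_var) (auto simp: eqv_refl)
      then show "(\<Sum>v \<in> Y. vt v) * (var g * p - ?c (var g * p)) \<simeq>\<^bsub>U\<^esub> var g * p - ?c (var g * p)"
        by (simp add: lookup_zero_mult mult.assoc)
    qed simp
  next
    case (add p q)
    then obtain X Y where X: "finite X"
        "\<And>Z. finite Z \<Longrightarrow> X \<subseteq> Z \<Longrightarrow> (\<Sum>v \<in> Z. vt v) * (p - ?c p) \<simeq>\<^bsub>U\<^esub> p - ?c p"
      and Y: "finite Y"
        "\<And>Z. finite Z \<Longrightarrow> Y \<subseteq> Z \<Longrightarrow> (\<Sum>v \<in> Z. vt v) * (q - ?c q) \<simeq>\<^bsub>U\<^esub> q - ?c q"
      by blast
    have "p + q - ?c (p + q) = (p - ?c p) + (q - ?c q)"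
      by (simp add: lookup_add single_add)
    then show ?case
      using X Y U by (intro exI [of _ "X \<union> Y"]) (simp only: distrib_left, simp add: eqv_add)
  qed
  then obtain X where "finite X" "(\<Sum>v \<in> X. vt v) * (p - ?c p) \<simeq>\<^bsub>U\<^esub> p - ?c p"
    by blast
  then show ?thesis using that assms by (simp add: augmentation_def)
qed

text \<open>Seen from the right, a new first letter \<open>g\<close> matters only for the word
  \<open>g\<close> itself, which comes from the constant term of \<open>p\<close>; all longer words
  keep their last letter.\<close>

lemma local_unit_right:
  assumes "p \<in> augmentation"
  obtains Y where "finite Y" "p * (\<Sum>v \<in> Y. vt v) \<simeq>\<^bsub>U\<^esub> p"
proof -
  let ?c = "\<lambda>p :: ('v, 'e, 'k) lpa_poly. Poly_Mapping.single 0 (Poly_Mapping.lookup p 0)"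
  have "\<exists>X. finite X \<and> (\<forall>Y. finite Y \<longrightarrow> X \<subseteq> Y \<longrightarrow> (p - ?c p) * (\<Sum>v \<in> Y. vt v) \<simeq>\<^bsub>U\<^esub> p - ?c p)"
    for p :: "('v, 'e, 'k) lpa_poly"
  proof (induction p rule: gen_poly_induct)
    case (const c)
    show ?case using U by (intro exI [of _ "{}"]) (simp add: eqv_refl)
  next
    case (var_mult g p)
    then obtain X where X: "finite X"
        "\<And>Z. finite Z \<Longrightarrow> X \<subseteq> Z \<Longrightarrow> (p - ?c p) * (\<Sum>v \<in> Z. vt v) \<simeq>\<^bsub>U\<^esub> p - ?c p"
      by blast
    show ?case
    proof (intro exI [of _ "insert (gtarget G g) X"] conjI allI impI)
      fix Y assume Y: "finite Y" "insert (gtarget G g) X \<subseteq> Y"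
      have "var g * ((p - ?c p) * (\<Sum>v \<in> Y. vt v)) + ?c p * (var g * (\<Sum>v \<in> Y. vt v))
          \<simeq>\<^bsub>U\<^esub> var g * (p - ?c p) + ?c p * var g"
        using U Y by (intro eqv_add eqv_mult X var_sum_vt) (auto simp: eqv_refl)
      then show "(var g * p - ?c (var g * p)) * (\<Sum>v \<in> Y. vt v) \<simeq>\<^bsub>U\<^esub> var g * p - ?c (var g * p)"
        using const_mult_commute [of "Poly_Mapping.lookup p 0" "var g"]
        by (simp add: lookup_zero_mult algebra_simps flip: mult.assoc)
    qed (use X in simp)
  next
    case (add p q)
    then obtain X Y where X: "finite X"
        "\<And>Z. finite Z \<Longrightarrow> X \<subseteq> Z \<Longrightarrow> (p - ?c p) * (\<Sum>v \<in> Z. vt v) \<simeq>\<^bsub>U\<^esub> p - ?c p"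
      and Y: "finite Y"
        "\<And>Z. finite Z \<Longrightarrow> Y \<subseteq> Z \<Longrightarrow> (q - ?c q) * (\<Sum>v \<in> Z. vt v) \<simeq>\<^bsub>U\<^esub> q - ?c q"
      by blast
    have "p + q - ?c (p + q) = (p - ?c p) + (q - ?c q)"
      by (simp add: lookup_add single_add)
    then show ?case
      using X Y U by (intro exI [of _ "X \<union> Y"]) (simp only: distrib_right, simp add: eqv_add)
  qed
  then obtain X where "finite X" "(p - ?c p) * (\<Sum>v \<in> X. vt v) \<simeq>\<^bsub>U\<^esub> p - ?c p"
    by blast
  then show ?thesis using that assms by (simp add: augmentation_def)
qed

lemma nonzero_corner:
  assumes "p \<in> augmentation" "p \<notin> U"
  obtains v where "v \<in> verts G" "p * vt v \<notin> U"
proof -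
  obtain Y where Y: "p * (\<Sum>v \<in> Y. vt v) \<simeq>\<^bsub>U\<^esub> p"
    using local_unit_right [OF assms(1)] .
  have "p * (\<Sum>v \<in> Y. vt v) \<notin> U" using eqv_mem_iff [OF U(1) Y] assms(2) by simp
  then obtain v where "p * vt v \<notin> U"
    using tideal_sum [OF U(1), of Y "\<lambda>v. p * vt v"] by (auto simp: sum_distrib_left)
  moreover from this have "v \<in> verts G"
    using nongenerator_mem [OF U, of "Vert v"] tideal_mult_left [OF U(1), of "vt v" p]
    by (cases "v \<in> verts G") simp_all
  ultimately show ?thesis using that by blast
qed

end

section \<open>Closed paths and condition (K)\<close>

text \<open>(K) with the second closed path requested at the base vertex only; in this form it is
  easily carried over to quotient graphs.\<close>

definition alternating :: "('v, 'e) pre_digraph \<Rightarrow> bool" where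
  "alternating G \<longleftrightarrow> (\<forall>v p. closed_path G v p \<longrightarrow> (\<exists>q. closed_path G v q \<and> set q \<noteq> set p))"

context wf_digraph
begin

lemma closed_path_iff: "closed_path G v p \<longleftrightarrow> p \<noteq> [] \<and> awalk v p v"
  by (simp add: closed_path_def)

lemma awalk_append: "awalk u (p @ q) v \<longleftrightarrow> (\<exists>w. awalk u p w \<and> awalk w q v)"
  by (metis awalk_append_iff awlast_if_cas awalk_def)

lemma shortest_closed_path:
  assumes "closed_path G v p"
  obtains g where "closed_path G v g" "\<And>q. closed_path G v q \<Longrightarrow> length g \<le> length q"
  using ex_has_least_nat [of "closed_path G v" p length] assms by blast

text \<open>Copies of \<open>g\<close> are split off from the front. What remains, if nonempty, is a
  closed path at \<open>v\<close>, hence at least as long as \<open>g\<close>, so it cannot be a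
  proper prefix of \<open>g\<close>.\<close>

lemma closed_path_power:
  assumes g: "closed_path G v g" and min: "\<And>q. closed_path G v q \<Longrightarrow> length g \<le> length q"
    and q: "awalk v q v"
  obtains j r where "q = concat (replicate j g) @ r" "r = [] \<or> closed_path G v r \<and> \<not> prefix g r \<and> \<not> prefix r g"
proof -
  have "\<exists>j r. q = concat (replicate j g) @ r \<and> (r = [] \<or> closed_path G v r \<and> \<not> prefix g r \<and> \<not> prefix r g)"
    using q
  proof (induction q rule: length_induct)
    case (1 q)
    show ?case
    proof (cases "q = [] \<or> \<not> prefix g q")
      case True
      have "\<not> prefix q g" if "q \<noteq> []" "\<not> prefix g q"
      proof
        assume "prefix q g"
        moreover have "q \<noteq> g" using that by auto
        ultimately have "length q < length g" by (simp add: prefix_length_less strict_prefix_def)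
        moreover have "length g \<le> length q" using 1 that by (intro min) (simp add: closed_path_iff)
        ultimately show False by simp
      qed
      then show ?thesis using True 1 by (intro exI [of _ 0] exI [of _ q]) (auto simp: closed_path_iff)
    next
      case False
      then obtain q' where q': "q = g @ q'" by (auto elim: prefixE)
      have "awalk v q' v" using 1 g by (auto simp: q' closed_path_iff awalk_append dest: awalk_ends)
      moreover have "length q' < length q" using g by (simp add: q' closed_path_iff)
      ultimately obtain j r where "q' = concat (replicate j g) @ r"
          "r = [] \<or> closed_path G v r \<and> \<not> prefix g r \<and> \<not> prefix r g"
        using 1 by blast
      then show ?thesis by (intro exI [of _ "Suc j"] exI [of _ r]) (simp add: q')
    qed
  qed
  then show ?thesis using that by blast
qed

lemma awalk_replicate: "awalk v g v \<Longrightarrow> awalk v (concat (replicate m g)) v"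
  by (induction m) (auto simp: awalk_Nil_iff awalk_append awalk_hd_in_verts)

lemma set_concat_replicate: "set (concat (replicate m g)) = (if m = 0 then {} else set g)"
  by (induction m) auto

lemma concat_replicate_append:
  "concat (replicate i g) @ concat (replicate j g) = concat (replicate (i + j) g)"
  by (simp add: replicate_add)

text \<open>
  With \<open>g\<close> a shortest closed path at \<open>v\<close> and \<open>h\<close> a closed path incomparable with \<open>g\<close>, take
  \<open>\<gamma> = g^m h\<close> for large \<open>m\<close>.
\<close>
lemma separating_closed_path:
  assumes K: "alternating G" and v: "v \<in> verts G"
    and D: "finite D" "\<And>\<delta>. \<delta> \<in> D \<Longrightarrow> closed_path G v \<delta>"
  obtains \<gamma> where "awalk v \<gamma> v" "\<And>\<delta>. \<delta> \<in> D \<Longrightarrow> \<not> prefix \<gamma> (\<delta> @ \<gamma>)"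
proof (cases "D = {}")
  case True
  then show ?thesis using that [of "[]"] v by (simp add: awalk_Nil_iff)
next
  case False
  then obtain \<delta>0 where "closed_path G v \<delta>0" using D by blast
  then obtain g where g: "closed_path G v g" and min: "\<And>q. closed_path G v q \<Longrightarrow> length g \<le> length q"
    using shortest_closed_path by blast
  obtain q where q: "closed_path G v q" "set q \<noteq> set g"
    using K g unfolding alternating_def by blast
  obtain i h where ih: "q = concat (replicate i g) @ h"
    "h = [] \<or> closed_path G v h \<and> \<not> prefix g h \<and> \<not> prefix h g"
    using closed_path_power [OF g min] q by (metis closed_path_iff)
  \<comment> \<open>A power of \<open>g\<close> would have the same set of edges as
    \<open>g\<close>.\<close>
  have "h \<noteq> []"
  proof
    assume "h = []"
    with ih q have "set q = (if i = 0 then {} else set g)" "q \<noteq> []"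
      by (simp_all add: set_concat_replicate closed_path_iff del: set_concat)
    with q show False by (auto split: if_splits)
  qed
  with ih have h: "awalk v h v" "\<not> prefix g h" "\<not> prefix h g" by (auto simp: closed_path_iff)
  \<comment> \<open>As \<open>g\<close> is nonempty, \<open>m\<close> copies of it are at least as
    long as any member of \<open>D\<close>.\<close>
  obtain m where m: "\<And>\<delta>. \<delta> \<in> D \<Longrightarrow> length \<delta> \<le> m"
    using D(1) by (metis finite_imageI finite_nat_set_iff_bounded_le imageI)
  let ?\<gamma> = "concat (replicate m g) @ h"
  have len: "length (concat (replicate n g)) \<ge> n" for n
    using g by (induction n) (auto simp: closed_path_iff Suc_le_eq add_strict_increasing)
  show ?thesis
  proof (rule that [of ?\<gamma>])
    show "awalk v ?\<gamma> v"
      using g h awalk_replicate [of v g m] by (auto simp: awalk_append closed_path_iff)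
    fix \<delta> assume \<delta>: "\<delta> \<in> D"
    show "\<not> prefix ?\<gamma> (\<delta> @ ?\<gamma>)"
    proof
      assume pre: "prefix ?\<gamma> (\<delta> @ ?\<gamma>)"
      have "length \<delta> \<le> length (concat (replicate m g))" using m [OF \<delta>] len [of m] by simp
      moreover have "prefix (concat (replicate m g)) (\<delta> @ ?\<gamma>)" using pre by (metis append_prefixD)
      ultimately have "prefix \<delta> (concat (replicate m g))"
        by (metis prefixI prefix_length_prefix)
      then obtain \<epsilon> where \<epsilon>: "concat (replicate m g) = \<delta> @ \<epsilon>" by (auto elim: prefixE)
      obtain j r where jr: "\<delta> = concat (replicate j g) @ r"
          "r = [] \<or> closed_path G v r \<and> \<not> prefix g r \<and> \<not> prefix r g"
        using closed_path_power [OF g min] D(2) [OF \<delta>] by (metis closed_path_iff)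
      \<comment> \<open>\<open>\<delta>\<close> begins a power of \<open>g\<close>, so a nonempty
        remainder after its leading copies of \<open>g\<close> would be comparable with
        \<open>g\<close>.\<close>
      have r: "r = []"
      proof (rule ccontr)
        assume r: "r \<noteq> []"
        have "\<exists>\<epsilon>. concat (replicate m' g) = concat (replicate j g) @ r @ \<epsilon> \<Longrightarrow> prefix r g \<or> prefix g r" for m'
        proof (induction j arbitrary: m')
          case 0
          then show ?case using r by (cases m') (auto simp: prefix_def append_eq_append_conv2)
        next
          case (Suc j)
          then show ?case using r by (cases m') auto
        qed
        then have "prefix r g \<or> prefix g r" using \<epsilon> jr by auto
        with jr r show False by auto
      qed
      obtain j' where j': "j = Suc j'" using jr r D(2) [OF \<delta>] by (cases j) (auto simp: closed_path_iff)
      \<comment> \<open>Now \<open>\<delta>\<close> is a positive power of \<open>g\<close> and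
        commutes with \<open>m\<close> copies of \<open>g\<close>; cancelling these leaves
        \<open>h\<close> as a prefix of a path that begins with \<open>g\<close>.\<close>
      have "\<delta> @ ?\<gamma> = concat (replicate m g) @ g @ concat (replicate j' g) @ h"
        using concat_replicate_append [of j g m] concat_replicate_append [of m g j]
        by (simp add: jr r j' add.commute)
      with pre have "prefix h (g @ concat (replicate j' g) @ h)" by simp
      then have "prefix h g \<or> prefix g h"
        by (metis prefix_same_cases prefixI)
      with h show False by simp
    qed
  qed
qed

end

lemma condition_K_alternating:
  assumes "wf_digraph G" "condition_K G"
  shows "alternating G"
proof -
  interpret wf_digraph G by fact
  show ?thesis
    unfolding alternating_def
  proof (intro allI impI)
    fix v p assume p: "closed_path G v p"
    then have "v \<in> set (awalk_verts v p)" by (auto simp: closed_path_iff intro: hd_in_awalk_verts)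
    with p show "\<exists>q. closed_path G v q \<and> set q \<noteq> set p"
      using assms(2) unfolding condition_K_def by blast
  qed
qed

section \<open>Monomials and the reduction of elements to real paths\<close>

text \<open>The empty path is sent to 1, not to a vertex; a path ending at \<open>v\<close> is
  therefore always written \<open>epath p * vt v\<close>.\<close>

primrec epath :: "'e list \<Rightarrow> ('v, 'e, 'k::field) lpa_poly" where
  "epath [] = 1"
| "epath (e # es) = ed e * epath es"

primrec gpath :: "'e list \<Rightarrow> ('v, 'e, 'k::field) lpa_poly" where
  "gpath [] = 1"
| "gpath (e # es) = gpath es * gh e"

abbreviation kc :: "'k::field \<Rightarrow> ('v, 'e, 'k) lpa_poly" where "kc c \<equiv> Poly_Mapping.single 0 c"

lemma epath_append: "epath (p @ q) = epath p * epath q"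
  by (induction p) (simp_all add: mult.assoc)

lemma kc_mult_left: "p * (kc c * q) = kc c * (p * q)"
  by (metis const_mult_commute mult.assoc)

lemma kc_mult_kc: "kc c * (kc d * p) = kc (c * d) * p"
  by (simp add: mult_single flip: mult.assoc)

locale lpa_ideal_congruence = wf_digraph G
  for G :: "('v, 'e) pre_digraph" +
  fixes U :: "('v, 'e, 'k::field) lpa_poly set"
  assumes U: "tideal U" "all_relators G \<subseteq> U"
begin

abbreviation cong (infix "\<approx>" 50) where "a \<approx> b \<equiv> a \<simeq>\<^bsub>U\<^esub> b"

lemmas rf = eqv_refl [OF U(1)] and sy = eqv_sym [OF U(1)] and tr [trans] = eqv_trans [OF U(1)]
  and cadd = eqv_add [OF U(1)] and cmul = eqv_mult [OF U(1)] and csum = eqv_sum [OF U(1)]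
  and mem_iff = eqv_mem_iff [OF U(1)]
  and mem_left = tideal_mult_left [OF U(1)] and mem_right = tideal_mult_right [OF U(1)]

lemma cmul_left: "a \<approx> b \<Longrightarrow> x * a \<approx> x * b" by (rule cmul [OF rf])
lemma cmul_right: "a \<approx> b \<Longrightarrow> a * x \<approx> b * x" by (rule cmul [OF _ rf])

lemma vt_epath: "awalk u p v \<Longrightarrow> vt u * (epath p * vt v) \<approx> epath p * vt v"
proof (cases p)
  case Nil
  then show "awalk u p v \<Longrightarrow> ?thesis" using vt_vt_same [OF U, of v] by (simp add: awalk_Nil_iff)
next
  case (Cons e es)
  then show "awalk u p v \<Longrightarrow> ?thesis"
    using cmul_right [OF tail_ed [OF U, of e], of "epath es * vt v"]
    by (simp add: awalk_Cons_iff mult.assoc)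
qed

lemma vt_epath_diff: "awalk u p v \<Longrightarrow> w \<noteq> u \<Longrightarrow> vt w * (epath p * vt v) \<in> U"
proof -
  assume p: "awalk u p v" and "w \<noteq> u"
  then have "vt w * vt u * (epath p * vt v) \<in> U" by (intro mem_right vt_vt_diff [OF U])
  then show ?thesis
    using mem_iff [OF cmul_left [OF vt_epath [OF p], of "vt w"]] by (simp add: mult.assoc)
qed

lemma ed_epath_diff: "awalk u p v \<Longrightarrow> head G e \<noteq> u \<Longrightarrow> ed e * (epath p * vt v) \<in> U"
  using mem_left [OF vt_epath_diff, of u p v "head G e" "ed e"]
    mem_iff [OF cmul_right [OF ed_head [OF U, of e], of "epath p * vt v"]]
  by (simp add: mult.assoc)

lemma gh_epath_same: "awalk u (e # p) v \<Longrightarrow> gh e * (epath (e # p) * vt v) \<approx> epath p * vt v"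
proof -
  assume p: "awalk u (e # p) v"
  have "gh e * ed e * (epath p * vt v) \<approx> vt (head G e) * (epath p * vt v)"
    using p by (intro cmul_right gh_ed_same [OF U]) (simp add: awalk_Cons_iff)
  also have "\<dots> \<approx> epath p * vt v"
    using p by (intro vt_epath) (simp add: awalk_Cons_iff)
  finally show ?thesis by (simp add: mult.assoc)
qed

lemma gh_epath_diff: "e \<noteq> f \<Longrightarrow> gh e * (epath (f # p) * x) \<in> U"
  using mem_right [OF gh_ed_diff [OF U], of e f "epath p * x"] by (simp add: mult.assoc)

lemma gh_vt_diff: "tail G e \<noteq> v \<Longrightarrow> gh e * vt v \<in> U"
  using mem_left [OF vt_vt_diff [OF U], of "tail G e" v "gh e"]
    mem_iff [OF cmul_right [OF gh_tail [OF U, of e], of "vt v"]]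
  by (simp add: mult.assoc)

lemma gpath_epath_same:
  "awalk u (p @ q) v \<Longrightarrow> gpath p * (epath (p @ q) * vt v) \<approx> epath q * vt v"
proof (induction p arbitrary: u)
  case Nil
  then show ?case by (simp add: rf)
next
  case (Cons e p)
  have "gpath p * (gh e * (epath (e # p @ q) * vt v)) \<approx> gpath p * (epath (p @ q) * vt v)"
    using Cons.prems by (intro cmul_left gh_epath_same) simp
  also have "\<dots> \<approx> epath q * vt v" using Cons by (auto simp: awalk_Cons_iff)
  finally show ?case by (simp add: mult.assoc)
qed

text \<open>The paths part at some edge within the length of \<open>p\<close>, where distinct edges
  annihilate. The length bound excludes a \<open>q\<close> that is a proper prefix of
  \<open>p\<close>, for which a ghost path would remain.\<close>

lemma gpath_epath_diff:
  "awalk u q v \<Longrightarrow> length p \<le> length q \<Longrightarrow> \<not> prefix p q \<Longrightarrow> gpath p * (epath q * vt v) \<in> U"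
proof (induction p arbitrary: u q)
  case Nil
  then show ?case by simp
next
  case (Cons e p)
  then obtain f q' where q: "q = f # q'" by (cases q) auto
  show ?case
  proof (cases "e = f")
    case True
    have "gpath p * (epath q' * vt v) \<in> U"
      using Cons True by (auto simp: q awalk_Cons_iff)
    moreover have "awalk u (e # q') v" using Cons.prems True by (simp add: q)
    from cmul_left [OF gh_epath_same [OF this]]
    have "gpath p * (gh e * (epath q * vt v)) \<approx> gpath p * (epath q' * vt v)"
      unfolding q True .
    ultimately show ?thesis using mem_iff by (auto simp: mult.assoc)
  next
    case False
    then show ?thesis unfolding q gpath.simps mult.assoc by (intro mem_left gh_epath_diff)
  qed
qed

text \<open>Combinations, up to congruence, of products of a real path with a ghost path of at most
  \<open>n\<close> edges ending at \<open>v\<close>. The bound \<open>n\<close> is the induction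
  parameter of the reduction to real paths.\<close>

inductive ghost_deg :: "nat \<Rightarrow> 'v \<Rightarrow> ('v, 'e, 'k) lpa_poly \<Rightarrow> bool" where
  path: "awalk u p v \<Longrightarrow> ghost_deg n v (epath p * vt v)"
| zero: "ghost_deg n v 0"
| add: "ghost_deg n v a \<Longrightarrow> ghost_deg n v b \<Longrightarrow> ghost_deg n v (a + b)"
| scale: "ghost_deg n v a \<Longrightarrow> ghost_deg n v (kc c * a)"
| ghost: "e \<in> arcs G \<Longrightarrow> ghost_deg n (head G e) a \<Longrightarrow> ghost_deg (Suc n) (tail G e) (a * gh e)"
| equiv: "ghost_deg n v a \<Longrightarrow> a \<approx> b \<Longrightarrow> ghost_deg n v b"

lemma ghost_deg_mono: "ghost_deg n v a \<Longrightarrow> n \<le> m \<Longrightarrow> ghost_deg m v a"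
proof (induction arbitrary: m rule: ghost_deg.induct)
  case (ghost e n a)
  then show ?case by (cases m) (auto intro: ghost_deg.ghost)
qed (auto intro: ghost_deg.intros)

lemma ghost_deg_mem: "a \<in> U \<Longrightarrow> ghost_deg n v a"
  by (rule ghost_deg.equiv [OF ghost_deg.zero]) (rule sy, simp add: eqv_zero_iff)

lemma ghost_deg_vt: "ghost_deg n v a \<Longrightarrow> a * vt v \<approx> a"
proof (induction rule: ghost_deg.induct)
  case (path u p v n)
  then show ?case using cmul_left [OF vt_vt_same [OF U, of v]] by (simp add: mult.assoc)
next
  case (ghost e n a)
  then show ?case using cmul_left [OF gh_tail [OF U, of e]] by (simp add: mult.assoc)
next
  case (add n v a b)
  then show ?case by (simp add: distrib_right cadd)
next
  case (scale n v a c)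
  then show ?case by (simp add: mult.assoc cmul_left)
next
  case (equiv n v a b)
  have "b * vt v \<approx> a * vt v" by (rule cmul_right [OF sy [OF equiv.hyps(2)]])
  also have "\<dots> \<approx> a" by (rule equiv.IH)
  also have "\<dots> \<approx> b" by (rule equiv.hyps)
  finally show ?case .
qed (simp add: rf)

text \<open>A ghost edge cancels against the first edge of the path or kills the path; it survives
  only next to a path of length 0, hence the bound 1.\<close>

lemma ghost_deg_var_path:
  assumes p: "awalk u p v"
  shows "ghost_deg 1 v (var g * (epath p * vt v))"
proof (cases g)
  case (Vert w)
  show ?thesis
  proof (cases "w = u")
    case True
    show ?thesis unfolding Vert True
      by (rule ghost_deg.equiv [OF ghost_deg.path [OF p] sy [OF vt_epath [OF p]]])
  next
    case False
    then show ?thesis using vt_epath_diff [OF p] by (auto simp: Vert intro: ghost_deg_mem)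
  qed
next
  case (Edge e)
  show ?thesis
  proof (cases "e \<in> arcs G \<and> head G e = u")
    case True
    then have "awalk (tail G e) (e # p) v" using p by (simp add: awalk_Cons_iff)
    from ghost_deg.path [OF this] show ?thesis by (simp add: Edge mult.assoc)
  next
    case False
    then have "ed e * (epath p * vt v) \<in> U"
      using ed_epath_diff [OF p] nongenerator_mem [OF U, of "Edge e"] mem_right
      by (cases "e \<in> arcs G") simp_all
    then show ?thesis by (simp add: Edge ghost_deg_mem)
  qed
next
  case (Ghost e)
  show ?thesis
  proof (cases "e \<in> arcs G")
    case False
    then show ?thesis using nongenerator_mem [OF U, of "Ghost e"]
      by (auto simp: Ghost intro!: ghost_deg_mem mem_right)
  next
    case e: True
    show ?thesis
    proof (cases p)
      case Nil
      then have uv: "u = v" using p by (simp add: awalk_Nil_iff)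
      show ?thesis
      proof (cases "tail G e = v")
        case True
        have "awalk (head G e) [] (head G e)" using e by (simp add: awalk_Nil_iff)
        then have "ghost_deg (Suc 0) (tail G e) (epath [] * vt (head G e) * gh e)"
          by (intro ghost_deg.ghost ghost_deg.path e)
        moreover have "epath [] * vt (head G e) * gh e \<approx> gh e * (epath [] * vt v)"
          using tr [OF head_gh [OF U, of e] sy [OF gh_tail [OF U, of e]]] True by simp
        ultimately show ?thesis unfolding Ghost Nil True One_nat_def by (rule ghost_deg.equiv)
      next
        case False
        then show ?thesis using gh_vt_diff by (auto simp: Ghost Nil intro: ghost_deg_mem)
      qed
    next
      case (Cons f q)
      show ?thesis
      proof (cases "e = f")
        case True
        then have "awalk u (e # q) v" using p Cons by simp
        moreover from this have "awalk (head G e) q v" by (simp add: awalk_Cons_iff)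
        ultimately show ?thesis unfolding Ghost Cons True [symmetric]
          by (intro ghost_deg.equiv [OF ghost_deg.path sy [OF gh_epath_same]])
      next
        case False
        then show ?thesis unfolding Ghost Cons by (intro ghost_deg_mem gh_epath_diff)
      qed
    qed
  qed
qed

lemma ghost_deg_var: "ghost_deg n v a \<Longrightarrow> \<exists>m. ghost_deg m v (var g * a)"
proof (induction rule: ghost_deg.induct)
  case (path u p v n)
  then show ?case using ghost_deg_var_path by blast
next
  case (add n v a b)
  then obtain m m' where "ghost_deg m v (var g * a)" "ghost_deg m' v (var g * b)" by blast
  then have "ghost_deg (max m m') v (var g * a + var g * b)"
    by (intro ghost_deg.add) (auto elim: ghost_deg_mono)
  then show ?case by (auto simp: distrib_left)
next
  case (scale n v a c)
  then show ?case by (auto simp: kc_mult_left intro: ghost_deg.scale)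
next
  case (ghost e n a)
  then obtain m where "ghost_deg m (head G e) (var g * a)" by blast
  from ghost_deg.ghost [OF ghost.hyps(1) this] show ?case by (auto simp: mult.assoc)
next
  case (equiv n v a b)
  then show ?case using ghost_deg.equiv cmul_left by blast
qed (auto intro: ghost_deg.zero)

lemma ghost_deg_mult: "ghost_deg n v a \<Longrightarrow> \<exists>m. ghost_deg m v (p * a)"
proof (induction p rule: gen_poly_induct)
  case (const c)
  then show ?case by (auto intro: ghost_deg.scale)
next
  case (var_mult g p)
  then show ?case using ghost_deg_var by (metis mult.assoc)
next
  case (add p q)
  then obtain m m' where "ghost_deg m v (p * a)" "ghost_deg m' v (q * a)" by blast
  then have "ghost_deg (max m m') v (p * a + q * a)"
    by (intro ghost_deg.add) (auto elim: ghost_deg_mono)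
  then show ?case by (auto simp: distrib_right)
qed

lemma ghost_deg_exists:
  assumes "v \<in> verts G"
  shows "\<exists>n. ghost_deg n v (p * vt v)"
proof -
  have "ghost_deg 0 v (epath [] * vt v)" using assms by (intro ghost_deg.path) (simp add: awalk_Nil_iff)
  from ghost_deg_mult [OF this] show ?thesis by simp
qed

section \<open>Linear combinations of real paths with a common range\<close>

definition path_sum :: "'e list set \<Rightarrow> ('e list \<Rightarrow> 'k) \<Rightarrow> 'v \<Rightarrow> ('v, 'e, 'k) lpa_poly" where
  "path_sum X k v = (\<Sum>p \<in> X. kc (k p) * (epath p * vt v))"

definition path_set :: "'v \<Rightarrow> 'e list set \<Rightarrow> bool" where
  "path_set v X \<longleftrightarrow> finite X \<and> (\<forall>p \<in> X. \<exists>u. awalk u p v)"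

lemma path_sum_superset:
  assumes "finite Y" "X \<subseteq> Y"
  shows "path_sum X k v = path_sum Y (\<lambda>p. if p \<in> X then k p else 0) v"
  unfolding path_sum_def using assms by (intro sum.mono_neutral_cong_left) auto

lemma path_sum_nonzero_terms: "finite X \<Longrightarrow> path_sum X k v = path_sum {p \<in> X. k p \<noteq> 0} k v"
  unfolding path_sum_def by (intro sum.mono_neutral_right) auto

lemma path_sum_add:
  assumes "path_set v X" "path_set v Y"
  shows "\<exists>Z k'. path_set v Z \<and> path_sum X k v + path_sum Y l v = path_sum Z k' v"
proof (intro exI conjI)
  show "path_set v (X \<union> Y)" using assms by (auto simp: path_set_def)
  show "path_sum X k v + path_sum Y l v =
      path_sum (X \<union> Y) (\<lambda>p. (if p \<in> X then k p else 0) + (if p \<in> Y then l p else 0)) v"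
    using assms
    by (simp add: path_set_def path_sum_superset [of "X \<union> Y" X] path_sum_superset [of "X \<union> Y" Y])
      (simp add: path_sum_def single_add distrib_right sum.distrib)
qed

lemma path_sum_scale: "kc c * path_sum X k v = path_sum X (\<lambda>p. c * k p) v"
  by (simp add: path_sum_def sum_distrib_left mult_single flip: mult.assoc)

lemma path_sum_vt: "path_sum X k v * vt v \<approx> path_sum X k v"
  unfolding path_sum_def sum_distrib_right mult.assoc
  by (intro csum cmul_left vt_vt_same [OF U])

text \<open>Distinct paths stay distinct when \<open>e\<close> is appended, so no coefficients merge
  and nonzero ones stay nonzero; \<open>butlast\<close> recovers the original path.\<close>

lemma path_sum_ed:
  assumes "path_set v X" "e \<in> out_arcs G v"
  shows "path_set (head G e) ((\<lambda>p. p @ [e]) ` X)"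
    and "path_sum X k v * ed e \<approx> path_sum ((\<lambda>p. p @ [e]) ` X) (\<lambda>p. k (butlast p)) (head G e)"
proof -
  have "awalk v [e] (head G e)" using assms(2) by (auto simp: awalk_Cons_iff awalk_Nil_iff out_arcs_def)
  then show "path_set (head G e) ((\<lambda>p. p @ [e]) ` X)"
    using assms(1) awalk_append unfolding path_set_def by blast
  have v: "tail G e = v" using assms(2) by (simp add: out_arcs_def)
  have "path_sum X k v * ed e = (\<Sum>p \<in> X. kc (k p) * (epath p * (vt v * ed e)))"
    by (simp add: path_sum_def sum_distrib_right mult.assoc)
  also have "\<dots> \<approx> (\<Sum>p \<in> X. kc (k p) * (epath p * (ed e * vt (head G e))))"
    using tr [OF tail_ed [OF U, of e] sy [OF ed_head [OF U, of e]]] unfolding v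
    by (intro csum cmul_left)
  also have "\<dots> = path_sum ((\<lambda>p. p @ [e]) ` X) (\<lambda>p. k (butlast p)) (head G e)"
    by (simp add: path_sum_def sum.reindex inj_on_def epath_append mult.assoc)
  finally show "path_sum X k v * ed e \<approx> \<dots>" .
qed

lemma ghost_deg_path_sum: "path_set v X \<Longrightarrow> ghost_deg n v (path_sum X k v)"
proof -
  assume "path_set v X"
  then have "finite X" "\<forall>p \<in> X. \<exists>u. awalk u p v" by (auto simp: path_set_def)
  then show ?thesis
    unfolding path_sum_def
    by (induction X rule: finite_induct)
      (auto intro!: ghost_deg.zero ghost_deg.add ghost_deg.scale intro: ghost_deg.path)
qed

text \<open>Terms are grouped by their last ghost letter: \<open>A e\<close> collects what stands in
  front of \<open>gh e\<close> and has smaller ghost degree. For \<open>n = 0\<close> the condition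
  on \<open>X\<close> forces it to be empty.\<close>

lemma ghost_deg_decompose:
  assumes "ghost_deg n v a"
  shows "\<exists>X A Y k. finite X \<and> X \<subseteq> out_arcs G v \<and> (\<forall>e \<in> X. \<exists>m. n = Suc m \<and> ghost_deg m (head G e) (A e)) \<and>
    path_set v Y \<and> a \<approx> path_sum Y k v + (\<Sum>e \<in> X. A e * gh e)"
  using assms
proof (induction rule: ghost_deg.induct)
  case (path u p v n)
  have "path_set v {p}" "epath p * vt v = path_sum {p} (\<lambda>_. 1) v"
    using path by (auto simp: path_set_def path_sum_def)
  then show ?case
    by (intro exI [of _ "{}"] exI [of _ "{p}"] exI [of _ "\<lambda>_. 1"]) (simp add: rf)
next
  case (zero n v)
  show ?case
    by (intro exI [of _ "{}"] exI [of _ "\<lambda>_. 0"]) (simp add: rf path_set_def path_sum_def)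
next
  case (add n v a b)
  from add.IH(1) obtain X A Y k where 1: "finite X" "X \<subseteq> out_arcs G v"
      "\<forall>e \<in> X. \<exists>m. n = Suc m \<and> ghost_deg m (head G e) (A e)"
      "path_set v Y" "a \<approx> path_sum Y k v + (\<Sum>e \<in> X. A e * gh e)" by blast
  from add.IH(2) obtain X' A' Y' k' where 2: "finite X'" "X' \<subseteq> out_arcs G v"
      "\<forall>e \<in> X'. \<exists>m. n = Suc m \<and> ghost_deg m (head G e) (A' e)"
      "path_set v Y'" "b \<approx> path_sum Y' k' v + (\<Sum>e \<in> X'. A' e * gh e)" by blast
  obtain Z l where Z: "path_set v Z" "path_sum Y k v + path_sum Y' k' v = path_sum Z l v"
    using path_sum_add [OF 1(4) 2(4)] by blast
  let ?A = "\<lambda>e. (if e \<in> X then A e else 0) + (if e \<in> X' then A' e else 0)"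
  have "(\<Sum>e \<in> X. A e * gh e) = (\<Sum>e \<in> X \<union> X'. (if e \<in> X then A e else 0) * gh e)"
    using 1 2 by (intro sum.mono_neutral_cong_left) auto
  moreover have "(\<Sum>e \<in> X'. A' e * gh e) = (\<Sum>e \<in> X \<union> X'. (if e \<in> X' then A' e else 0) * gh e)"
    using 1 2 by (intro sum.mono_neutral_cong_left) auto
  ultimately have "(\<Sum>e \<in> X. A e * gh e) + (\<Sum>e \<in> X'. A' e * gh e) = (\<Sum>e \<in> X \<union> X'. ?A e * gh e)"
    by (simp add: distrib_right sum.distrib)
  then have "path_sum Y k v + (\<Sum>e \<in> X. A e * gh e) + (path_sum Y' k' v + (\<Sum>e \<in> X'. A' e * gh e))
      = path_sum Z l v + (\<Sum>e \<in> X \<union> X'. ?A e * gh e)"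
    by (simp add: Z(2) [symmetric] algebra_simps)
  then have "a + b \<approx> path_sum Z l v + (\<Sum>e \<in> X \<union> X'. ?A e * gh e)"
    using cadd [OF 1(5) 2(5)] by simp
  moreover have "\<forall>e \<in> X \<union> X'. \<exists>m. n = Suc m \<and> ghost_deg m (head G e) (?A e)"
    using 1(3) 2(3) by (fastforce intro: ghost_deg.add ghost_deg.zero)
  ultimately show ?case
    using 1 2 Z by (intro exI [of _ "X \<union> X'"] exI [of _ ?A] exI [of _ Z] exI [of _ l]) auto
next
  case (scale n v a c)
  then obtain X A Y k where 1: "finite X" "X \<subseteq> out_arcs G v"
      "\<forall>e \<in> X. \<exists>m. n = Suc m \<and> ghost_deg m (head G e) (A e)"
      "path_set v Y" "a \<approx> path_sum Y k v + (\<Sum>e \<in> X. A e * gh e)" by blast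
  have "kc c * a \<approx> kc c * path_sum Y k v + kc c * (\<Sum>e \<in> X. A e * gh e)"
    using cmul_left [OF 1(5)] by (simp add: distrib_left)
  then have "kc c * a \<approx> path_sum Y (\<lambda>p. c * k p) v + (\<Sum>e \<in> X. kc c * A e * gh e)"
    by (simp add: path_sum_scale sum_distrib_left mult.assoc)
  moreover have "\<forall>e \<in> X. \<exists>m. n = Suc m \<and> ghost_deg m (head G e) (kc c * A e)"
    using 1(3) by (blast intro: ghost_deg.scale)
  ultimately show ?case
    using 1 by (intro exI [of _ X] exI [of _ "\<lambda>e. kc c * A e"] exI [of _ Y] exI [of _ "\<lambda>p. c * k p"]) auto
next
  case (ghost e n a)
  then show ?case
    by (intro exI [of _ "{e}"] exI [of _ "\<lambda>_. a"] exI [of _ "{}"] exI [of _ "\<lambda>_. 0"])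
      (simp add: rf path_set_def path_sum_def)
next
  case (equiv n v a b)
  then obtain X A Y k where 1: "finite X" "X \<subseteq> out_arcs G v"
      "\<forall>e \<in> X. \<exists>m. n = Suc m \<and> ghost_deg m (head G e) (A e)"
      "path_set v Y" "a \<approx> path_sum Y k v + (\<Sum>e \<in> X. A e * gh e)" by blast
  show ?case
    using 1(1-4) tr [OF sy [OF equiv.hyps(2)] 1(5)]
    by (intro exI [of _ X] exI [of _ A] exI [of _ Y] exI [of _ k]) auto
qed

text \<open>Multiplying by an edge on the right strips a last ghost letter. If this kills
  \<open>a\<close> for all edges in \<open>X\<close>, then \<open>a\<close> is the real part
  \<open>r\<close> times the difference of \<open>vt v\<close> and the sum of
  \<open>ed e * gh e\<close> over \<open>X\<close>, and an edge outside \<open>X\<close> removes the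
  correction. Only formal nonvanishing of the coefficients is claimed; this suffices for the later
  compression to a vertex.\<close>

lemma reduce_to_real:
  assumes "ghost_deg n v a" "a \<notin> U"
  shows "\<exists>q w X k. awalk v q w \<and> path_set w X \<and> X \<noteq> {} \<and> (\<forall>p \<in> X. k p \<noteq> 0) \<and>
    a * (epath q * vt w) \<approx> path_sum X k w"
  using assms
proof (induction n arbitrary: v a rule: less_induct)
  case (less n)
  obtain X A Y k where X: "finite X" "X \<subseteq> out_arcs G v"
      "\<forall>e \<in> X. \<exists>m. n = Suc m \<and> ghost_deg m (head G e) (A e)"
      and Y: "path_set v Y" and a: "a \<approx> path_sum Y k v + (\<Sum>e \<in> X. A e * gh e)"
    using ghost_deg_decompose [OF less.prems(1)] by blast
  define r where "r = path_sum Y k v"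
  \<comment> \<open>Of the ghost letters only \<open>gh e\<close> survives the multiplication by
    \<open>ed e\<close>, and it is consumed.\<close>
  have a_ed: "a * ed e \<approx> r * ed e + (if e \<in> X then A e else 0)" if e: "e \<in> arcs G" for e
  proof -
    have "a * ed e \<approx> (r + (\<Sum>f \<in> X. A f * gh f)) * ed e"
      using a unfolding r_def by (rule cmul_right)
    also have "\<dots> = r * ed e + (\<Sum>f \<in> X. A f * (gh f * ed e))"
      by (simp add: distrib_right sum_distrib_right mult.assoc)
    also have "\<dots> \<approx> r * ed e + (\<Sum>f \<in> X. if f = e then A e else 0)"
    proof (intro cadd rf csum)
      fix f assume f: "f \<in> X"
      show "A f * (gh f * ed e) \<approx> (if f = e then A e else 0)"
      proof (cases "f = e")
        case True
        then obtain m where "ghost_deg m (head G e) (A e)" using X(3) f by auto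
        then have "A e * (gh e * ed e) \<approx> A e"
          using tr [OF cmul_left [OF gh_ed_same [OF U e]] ghost_deg_vt] by blast
        then show ?thesis using True by simp
      next
        case False
        then show ?thesis using gh_ed_diff [OF U] by (simp add: eqv_zero_iff mem_left)
      qed
    qed
    finally show ?thesis using X(1) by (simp add: sum.delta)
  qed
  show ?case
  proof (cases "\<exists>e \<in> X. a * ed e \<notin> U")
    case True
    then obtain e where e: "e \<in> X" "a * ed e \<notin> U" by blast
    then have ev: "e \<in> out_arcs G v" "e \<in> arcs G" "tail G e = v" using X(2) by auto
    obtain m where m: "n = Suc m" "ghost_deg m (head G e) (A e)" using X(3) e by blast
    have "ghost_deg m (head G e) (r * ed e)"
      unfolding r_def
      by (rule ghost_deg.equiv [OF ghost_deg_path_sum [OF path_sum_ed(1) [OF Y ev(1)]]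
            sy [OF path_sum_ed(2) [OF Y ev(1)]]])
    then have "ghost_deg m (head G e) (a * ed e)"
      using ghost_deg.equiv [OF ghost_deg.add [OF _ m(2)] sy [OF a_ed [OF ev(2), unfolded if_P [OF e(1)]]]]
      by blast
    then obtain q w Z l where "awalk (head G e) q w" "path_set w Z" "Z \<noteq> {}" "\<forall>p \<in> Z. l p \<noteq> 0"
        "a * ed e * (epath q * vt w) \<approx> path_sum Z l w"
      using less.IH [of m "head G e" "a * ed e"] m(1) e(2) by blast
    then show ?thesis using ev
      by (intro exI [of _ "e # q"] exI [of _ w] exI [of _ Z] exI [of _ l])
        (simp add: awalk_Cons_iff mult.assoc)
  next
    case False
    \<comment> \<open>As no edge of \<open>X\<close> can be used, each \<open>A e\<close> is
      expressed through the real part.\<close>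
    have A: "A e \<approx> - (r * ed e)" if "e \<in> X" for e
    proof -
      have "r * ed e + A e \<in> U"
        using False that mem_iff [OF a_ed [of e]] X(2) by auto
      then show ?thesis by (simp add: eqv_def add.commute)
    qed
    have a2: "a \<approx> r - (\<Sum>e \<in> X. r * ed e * gh e)"
    proof -
      have "a \<approx> r + (\<Sum>e \<in> X. A e * gh e)" using a r_def by simp
      also have "\<dots> \<approx> r + (\<Sum>e \<in> X. - (r * ed e) * gh e)"
        by (intro cadd rf csum cmul_right A)
      finally show ?thesis by (simp add: sum_negf)
    qed
    let ?Z = "{p \<in> Y. k p \<noteq> 0}"
    have r: "r = path_sum ?Z k v" unfolding r_def using Y by (intro path_sum_nonzero_terms) (simp add: path_set_def)
    have Z: "path_set v ?Z" using Y by (auto simp: path_set_def)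
    have "r \<notin> U"
    proof
      assume "r \<in> U"
      then have "r - (\<Sum>e \<in> X. r * ed e * gh e) \<in> U"
        by (intro tideal_diff tideal_sum U) (simp_all add: mem_right)
      then show False using mem_iff [OF a2] less.prems by simp
    qed
    moreover have "path_sum {} k v \<in> U" by (simp add: path_sum_def tideal_zero [OF U(1)])
    ultimately have ne: "?Z \<noteq> {}" unfolding r by metis
    then have v: "v \<in> verts G" using Z by (auto simp: path_set_def dest: awalk_last_in_verts)
    \<comment> \<open>If \<open>X\<close> is all of \<open>out_arcs G v\<close>, either
      \<open>v\<close> is a sink and \<open>a\<close> is already real, or the second Cuntz-Krieger
      relation makes \<open>a\<close> vanish; otherwise an edge outside \<open>X\<close> annihilates
      the correction.\<close>
    show ?thesis
    proof (cases "X = out_arcs G v")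
      case True
      show ?thesis
      proof (cases "X = {}")
        case True
        have "a * (epath [] * vt v) \<approx> r * vt v" using a2 True by (simp add: cmul_right)
        also have "\<dots> \<approx> path_sum ?Z k v" unfolding r by (rule path_sum_vt)
        finally show ?thesis using v Z ne
          by (intro exI [of _ "[]"] exI [of _ v] exI [of _ ?Z] exI [of _ k]) (auto simp: awalk_Nil_iff)
      next
        case False
        then have "regular G v" using True X(1) v by (simp add: regular_def)
        have "r \<approx> r * vt v" unfolding r by (rule sy [OF path_sum_vt])
        also have "\<dots> \<approx> r * (\<Sum>e \<in> out_arcs G v. ed e * gh e)"
          by (intro cmul_left vt_eqv_sum U \<open>regular G v\<close>)
        also have "\<dots> = (\<Sum>e \<in> X. r * ed e * gh e)"
          by (simp add: True sum_distrib_left mult.assoc)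
        finally have "r - (\<Sum>e \<in> X. r * ed e * gh e) \<in> U" by (simp add: eqv_def)
        then show ?thesis using mem_iff [OF a2] less.prems by simp
      qed
    next
      case False
      then obtain f where f: "f \<in> out_arcs G v" "f \<notin> X" using X(2) by blast
      let ?W = "(\<lambda>p. p @ [f]) ` ?Z" and ?l = "\<lambda>p. k (butlast p)"
      have "a * (epath [f] * vt (head G f)) \<approx> a * ed f"
        using cmul_left [OF ed_head [OF U, of f]] by (simp add: mult.assoc)
      also have "\<dots> \<approx> r * ed f" using a_ed [of f] f by simp
      also have "\<dots> \<approx> path_sum ?W ?l (head G f)" unfolding r by (rule path_sum_ed(2) [OF Z f(1)])
      finally show ?thesis using path_sum_ed(1) [OF Z f(1)] f(1) ne
        by (intro exI [of _ "[f]"] exI [of _ "head G f"] exI [of _ ?W] exI [of _ ?l])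
          (auto simp: awalk_Cons_iff awalk_Nil_iff)
    qed
  qed
qed

end

text \<open>A nonzero element first becomes a combination of paths to one vertex \<open>w\<close>; a
  shortest path \<open>p0\<close> and the separating closed path \<open>\<gamma>\<close> then reduce
  it to a nonzero multiple of \<open>vt w\<close>. All multiplications stay inside
  \<open>I\<close>.\<close>

theorem (in wf_digraph) vertex_in_nonzero_ideal:
  fixes I :: "('a, 'b, 'k::field) lpa_poly set"
  assumes K: "alternating G" and I: "lid G I" "I \<noteq> null_ideal G"
  obtains v where "v \<in> verts G" "vt v \<in> I"
proof -
  let ?N = "null_ideal G :: ('a, 'b, 'k) lpa_poly set"
  have "lid G ?N" by (rule lid_null_ideal)
  with wf_digraph_axioms interpret lpa_ideal_congruence G ?N
    by (simp add: lpa_ideal_congruence_def lpa_ideal_congruence_axioms_def lid_def)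
  have tI: "tideal I" using I(1) by (rule lid_tideal)
  have NI: "?N \<subseteq> I" using I(1) by (rule null_ideal_subset)
  then obtain a where a: "a \<in> I" "a \<notin> ?N" using I(2) by blast
  then have "a \<in> augmentation" using I(1) by (auto simp: lid_def)
  then obtain v where v: "v \<in> verts G" "a * vt v \<notin> ?N"
    using nonzero_corner [OF U] a(2) by blast
  obtain n where "ghost_deg n v (a * vt v)" using ghost_deg_exists [OF v(1)] by blast
  from reduce_to_real [OF this v(2)] obtain q w X k where w: "awalk v q w" and X: "path_set w X" "X \<noteq> {}"
    "\<forall>p \<in> X. k p \<noteq> 0" and b: "a * vt v * (epath q * vt w) \<simeq>\<^bsub>?N\<^esub> path_sum X k w"
    by blast
  let ?b = "path_sum X k w"
  have "a * vt v * (epath q * vt w) \<in> I" using a(1) tI by (simp add: tideal_mult_right)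
  then have bI: "?b \<in> I" using eqv_mem_iff [OF tI eqv_mono [OF NI b]] by simp
  have wv: "w \<in> verts G" using w by (auto dest: awalk_last_in_verts)
  \<comment> \<open>By minimality no other path of \<open>X\<close> is a proper prefix of
    \<open>p0\<close>, so \<open>gpath p0\<close> kills every path that does not begin with
    \<open>p0\<close>.\<close>
  obtain p0 where p0: "p0 \<in> X" and min: "\<And>p. p \<in> X \<Longrightarrow> length p0 \<le> length p"
    using ex_has_least_nat [of "\<lambda>p. p \<in> X" _ length] X(2) by blast
  let ?D = "{\<delta>. \<delta> \<noteq> [] \<and> p0 @ \<delta> \<in> X \<and> awalk w \<delta> w}"
  have "finite ((@) p0 -` X)" using X(1) by (intro finite_vimageI) (auto simp: path_set_def inj_def)
  then have "finite ?D" by (rule rev_finite_subset) auto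
  then obtain \<gamma> where \<gamma>: "awalk w \<gamma> w" "\<And>\<delta>. \<delta> \<in> ?D \<Longrightarrow> \<not> prefix \<gamma> (\<delta> @ \<gamma>)"
    using separating_closed_path [OF K wv, of ?D] by (auto simp: closed_path_iff)
  \<comment> \<open>The factor \<open>vt w\<close> in the middle discards the remainders after
    \<open>p0\<close> that do not start at \<open>w\<close>; the nonempty others are closed paths,
    which are killed between \<open>gpath \<gamma>\<close> and
    \<open>epath \<gamma>\<close>.\<close>
  define t :: "'b list \<Rightarrow> ('a, 'b, 'k) lpa_poly" where "t p = gpath \<gamma> * (vt w * (gpath p0 * (epath p * vt w)) * (epath \<gamma> * vt w))" for p
  have t0: "t p0 \<simeq>\<^bsub>?N\<^esub> vt w"
  proof -
    obtain u where "awalk u (p0 @ []) w" using X(1) p0 by (auto simp: path_set_def)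
    from gpath_epath_same [OF this] have "gpath p0 * (epath p0 * vt w) \<simeq>\<^bsub>?N\<^esub> vt w" by simp
    then have "t p0 \<simeq>\<^bsub>?N\<^esub> gpath \<gamma> * (vt w * vt w * (epath \<gamma> * vt w))"
      unfolding t_def by (intro cmul_left cmul_right)
    also have "\<dots> \<simeq>\<^bsub>?N\<^esub> gpath \<gamma> * (vt w * (epath \<gamma> * vt w))"
      by (intro cmul_left cmul_right vt_vt_same [OF U])
    also have "\<dots> \<simeq>\<^bsub>?N\<^esub> gpath \<gamma> * (epath \<gamma> * vt w)" by (intro cmul_left vt_epath \<gamma>)
    also have "\<dots> \<simeq>\<^bsub>?N\<^esub> vt w" using gpath_epath_same [of w \<gamma> "[]" w] \<gamma>(1) by simp
    finally show ?thesis .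
  qed
  have t1: "t p \<in> ?N" if p: "p \<in> X" "p \<noteq> p0" for p
  proof -
    obtain u where u: "awalk u p w" using X(1) p by (auto simp: path_set_def)
    show ?thesis
    proof (cases "prefix p0 p")
      case False
      then have "gpath p0 * (epath p * vt w) \<in> ?N" using u min p by (intro gpath_epath_diff)
      then show ?thesis by (simp add: t_def mem_left mem_right)
    next
      case True
      then obtain \<delta> where \<delta>: "p = p0 @ \<delta>" "\<delta> \<noteq> []" using p by (auto elim: prefixE)
      then obtain w' where w': "awalk w' \<delta> w" using u awalk_append by blast
      have p\<delta>: "gpath p0 * (epath p * vt w) \<simeq>\<^bsub>?N\<^esub> epath \<delta> * vt w"
        using u unfolding \<delta>(1) by (rule gpath_epath_same)
      show ?thesis
      proof (cases "w' = w")
        case False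
        then have "vt w * (epath \<delta> * vt w) \<in> ?N" using vt_epath_diff [OF w'] by simp
        then have "vt w * (gpath p0 * (epath p * vt w)) \<in> ?N"
          using mem_iff [OF cmul_left [OF p\<delta>]] by simp
        then show ?thesis unfolding t_def by (rule mem_left [OF mem_right])
      next
        case True
        have "t p \<simeq>\<^bsub>?N\<^esub> gpath \<gamma> * (vt w * (epath \<delta> * vt w) * (epath \<gamma> * vt w))"
          unfolding t_def by (intro cmul_left cmul_right p\<delta>)
        also have "\<dots> \<simeq>\<^bsub>?N\<^esub> gpath \<gamma> * (epath \<delta> * vt w * (epath \<gamma> * vt w))"
          using w' True by (intro cmul_left cmul_right vt_epath) simp
        also have "\<dots> \<simeq>\<^bsub>?N\<^esub> gpath \<gamma> * (epath (\<delta> @ \<gamma>) * vt w)"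
          using vt_epath [OF \<gamma>(1)] unfolding epath_append mult.assoc by (intro cmul_left)
        finally have "t p \<simeq>\<^bsub>?N\<^esub> gpath \<gamma> * (epath (\<delta> @ \<gamma>) * vt w)" .
        moreover have "gpath \<gamma> * (epath (\<delta> @ \<gamma>) * vt w) \<in> ?N"
        proof (rule gpath_epath_diff)
          show "awalk w (\<delta> @ \<gamma>) w" using w' True \<gamma>(1) awalk_append by blast
          show "\<not> prefix \<gamma> (\<delta> @ \<gamma>)" using \<gamma>(2) \<delta> p w' True by blast
        qed simp
        ultimately show ?thesis using mem_iff by blast
      qed
    qed
  qed
  let ?d = "gpath \<gamma> * (vt w * (gpath p0 * ?b) * (epath \<gamma> * vt w))"
  have "?d = (\<Sum>p \<in> X. kc (k p) * t p)"
    by (simp add: path_sum_def t_def sum_distrib_left sum_distrib_right kc_mult_left mult.assoc)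
  also have "\<dots> \<simeq>\<^bsub>?N\<^esub> (\<Sum>p \<in> X. if p = p0 then kc (k p0) * vt w else 0)"
    using t0 t1 by (intro csum) (auto simp: cmul_left mem_left eqv_zero_iff)
  also have "\<dots> = kc (k p0) * vt w" using X(1) p0 by (simp add: path_set_def sum.delta)
  finally have "?d \<simeq>\<^bsub>?N\<^esub> kc (k p0) * vt w" .
  moreover have "?d \<in> I" using bI tI by (intro tideal_mult_left tideal_mult_right)
  ultimately have "kc (k p0) * vt w \<in> I" using eqv_mem_iff [OF tI eqv_mono [OF NI]] by blast
  then have "kc (1 / k p0) * (kc (k p0) * vt w) \<in> I" using tI by (rule tideal_mult_left [rotated])
  then have "vt w \<in> I" using X(3) p0 by (simp add: kc_mult_kc)
  with wv show ?thesis by (rule that)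
qed

section \<open>Representations from branching systems\<close>

lemma sum_fun_apply: "(\<Sum>i \<in> A. f i) x = (\<Sum>i \<in> A. f i x)"
  for f :: "'i \<Rightarrow> 'a \<Rightarrow> 'b::comm_monoid_add"
  by (induction A rule: infinite_finite_induct) simp_all

definition fun_scale :: "'k::field \<Rightarrow> ('q \<Rightarrow> 'k fps) \<Rightarrow> 'q \<Rightarrow> 'k fps" where
  "fun_scale c f = (\<lambda>q. fps_const c * f q)"

interpretation fun_vs: vector_space "fun_scale :: 'k::field \<Rightarrow> ('q \<Rightarrow> 'k fps) \<Rightarrow> 'q \<Rightarrow> 'k fps"
  by unfold_locales
    (simp_all add: fun_scale_def fun_eq_iff algebra_simps
      flip: fps_const_add fps_const_mult)

definition dirac :: "'q \<Rightarrow> 'q \<Rightarrow> 'k::zero_neq_one" where "dirac r = (\<lambda>q. if q = r then 1 else 0)"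

text \<open>
  The fibre of \<^term>\<open>src\<close> over a vertex \<^term>\<open>v\<close> plays the role of the set of boundary paths
  starting at \<^term>\<open>v\<close>. Edges act with a weight, an invertible power series; the trivial weight
  suffices for separating vertices, while a nonconstant one yields twisted modules.
\<close>
locale branching_system = wf_digraph G
  for G :: "('v, 'e) pre_digraph" +
  fixes X :: "'q set" and src :: "'q \<Rightarrow> 'v" and cons :: "'e \<Rightarrow> 'q \<Rightarrow> 'q"
    and wt wt' :: "'k::field fps"
  assumes weights: "wt * wt' = 1"
    and src_verts: "q \<in> X \<Longrightarrow> src q \<in> verts G"
    and cons_mem: "e \<in> arcs G \<Longrightarrow> q \<in> X \<Longrightarrow> src q = head G e \<Longrightarrow> cons e q \<in> X"
    and src_cons: "e \<in> arcs G \<Longrightarrow> q \<in> X \<Longrightarrow> src q = head G e \<Longrightarrow> src (cons e q) = tail G e"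
    and cons_eqD: "e \<in> arcs G \<Longrightarrow> q \<in> X \<Longrightarrow> src q = head G e \<Longrightarrow>
      f \<in> arcs G \<Longrightarrow> r \<in> X \<Longrightarrow> src r = head G f \<Longrightarrow> cons e q = cons f r \<Longrightarrow> e = f \<and> q = r"
    and cons_cover: "q \<in> X \<Longrightarrow> regular G (src q) \<Longrightarrow>
      \<exists>e \<in> arcs G. \<exists>r \<in> X. src r = head G e \<and> q = cons e r"
begin

definition fibre :: "'e \<Rightarrow> 'q set" where
  "fibre e = {q \<in> X. e \<in> arcs G \<and> src q = head G e}"

lemma cons_fibre: "q \<in> fibre e \<Longrightarrow> cons e q \<in> X" "q \<in> fibre e \<Longrightarrow> src (cons e q) = tail G e"
  using cons_mem src_cons by (auto simp: fibre_def)

lemma inj_on_cons: "inj_on (cons e) (fibre e)"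
  using cons_eqD by (auto simp: fibre_def inj_on_def)

lemma cons_fibre_disjoint: "q \<in> fibre e \<Longrightarrow> r \<in> fibre f \<Longrightarrow> cons e q = cons f r \<Longrightarrow> e = f"
  using cons_eqD by (auto simp: fibre_def)

fun gen_op :: "('v, 'e) gen \<Rightarrow> ('q \<Rightarrow> 'k fps) \<Rightarrow> 'q \<Rightarrow> 'k fps" where
  "gen_op (Vert v) f = (\<lambda>q. if q \<in> X \<and> src q = v then f q else 0)"
| "gen_op (Edge e) f =
    (\<lambda>q. if q \<in> cons e ` fibre e then wt * f (inv_into (fibre e) (cons e) q) else 0)"
| "gen_op (Ghost e) f = (\<lambda>q. if q \<in> fibre e then wt' * f (cons e q) else 0)"

sublocale word_action fun_scale gen_op
proof (unfold_locales)
  fix g x y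
  show "gen_op g (x + y) = gen_op g x + gen_op g y"
    by (cases g) (auto simp: fun_eq_iff algebra_simps)
next
  fix g and c :: 'k and x
  show "gen_op g (fun_scale c x) = fun_scale c (gen_op g x)"
    by (cases g) (auto simp: fun_eq_iff fun_scale_def algebra_simps)
qed

lemma edge_cons: "q \<in> fibre e \<Longrightarrow> gen_op (Edge e) f (cons e q) = wt * f q"
  by (simp add: inv_into_f_f inj_on_cons)

lemma edge_other: "q \<notin> cons e ` fibre e \<Longrightarrow> gen_op (Edge e) f q = 0"
  by simp

declare gen_op.simps(2) [simp del]

lemma act_relator: "p \<in> all_relators G \<Longrightarrow> act p f = 0"
proof -
  have "act p f = 0" if "p \<in> lpa_relators G" for p :: "('v, 'e, 'k) lpa_poly"
    using that
  proof (induction rule: lpa_relators.induct)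
    case (vertices v w)
    then show ?case by (auto simp: act_diff_left act_mult fun_eq_iff)
  next
    case (source_edge e)
    have "gen_op (Vert (tail G e)) (gen_op (Edge e) f) q = gen_op (Edge e) f q" for q
      by (cases "q \<in> cons e ` fibre e") (auto simp: edge_other cons_fibre)
    then show ?case by (auto simp: act_diff_left act_mult fun_eq_iff)
  next
    case (edge_range e)
    have "gen_op (Edge e) (gen_op (Vert (head G e)) f) q = gen_op (Edge e) f q" for q
      by (cases "q \<in> cons e ` fibre e") (auto simp: edge_other edge_cons fibre_def)
    then show ?case by (auto simp: act_diff_left act_mult fun_eq_iff)
  next
    case (range_ghost e)
    then show ?case by (auto simp: act_diff_left act_mult fun_eq_iff fibre_def)
  next
    case (ghost_source e)
    then show ?case by (auto simp: act_diff_left act_mult fun_eq_iff cons_fibre)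
  next
    case (CK1 e e')
    have "gen_op (Ghost e) (gen_op (Edge e') f) q = (if e = e' then gen_op (Vert (head G e)) f q else 0)" for q
    proof (cases "q \<in> fibre e")
      case True
      show ?thesis
      proof (cases "e = e'")
        case True
        have "wt' * (wt * f q) = f q" using weights by (simp add: mult.commute flip: mult.assoc)
        then show ?thesis using \<open>q \<in> fibre e\<close> True by (auto simp: edge_cons fibre_def)
      next
        case False
        then have "cons e q \<notin> cons e' ` fibre e'" using True cons_fibre_disjoint by blast
        then show ?thesis using True False by (simp add: edge_other)
      qed
    next
      case False
      then show ?thesis using CK1 by (auto simp: fibre_def)
    qed
    then show ?case by (auto simp: act_diff_left act_mult fun_eq_iff)
  next
    case (CK2 v)
    have "gen_op (Vert v) f q = (\<Sum>e \<in> out_arcs G v. gen_op (Edge e) (gen_op (Ghost e) f) q)" for q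
    proof (cases "q \<in> X \<and> src q = v")
      case True
      \<comment> \<open>A point over a regular vertex lies in the image of exactly one edge, so the
        sum has a single nonzero term.\<close>
      then obtain e r where e: "e \<in> arcs G" "r \<in> fibre e" "q = cons e r"
        using cons_cover [of q] CK2 by (auto simp: fibre_def)
      then have ev: "e \<in> out_arcs G v" using True cons_fibre by auto
      have "wt * (wt' * f q) = f q" using weights by (simp flip: mult.assoc)
      then have "gen_op (Edge e) (gen_op (Ghost e) f) q = f q" using e by (simp add: edge_cons)
      moreover have "gen_op (Edge e') (gen_op (Ghost e') f) q = 0" if "e' \<noteq> e" for e'
        using that e cons_fibre_disjoint by (intro edge_other) blast
      ultimately have "(\<Sum>e \<in> out_arcs G v. gen_op (Edge e) (gen_op (Ghost e) f) q) =
          (\<Sum>e' \<in> out_arcs G v. if e' = e then f q else 0)"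
        by (intro sum.cong) auto
      then show ?thesis using ev True CK2 by (simp add: regular_def sum.delta)
    next
      case False
      then have "gen_op (Edge e) (gen_op (Ghost e) f) q = 0" if "e \<in> out_arcs G v" for e
        using that cons_fibre by (intro edge_other) auto
      then have "(\<Sum>e \<in> out_arcs G v. gen_op (Edge e) (gen_op (Ghost e) f) q) = 0"
        by (intro sum.neutral) blast
      moreover have "gen_op (Vert v) f q = 0" using False by auto
      ultimately show ?thesis by simp
    qed
    then show ?case by (auto simp: act_diff_left act_sum_left act_mult fun_eq_iff sum_fun_apply)
  qed
  moreover have "act (var g) f = 0" if "g \<notin> generators G" for g
  proof (cases g)
    case (Edge e)
    with that have "fibre e = {}" by (auto simp: fibre_def)
    then show ?thesis by (simp add: Edge fun_eq_iff edge_other)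
  qed (use that src_verts in \<open>auto simp: fun_eq_iff fibre_def\<close>)
  ultimately show "p \<in> all_relators G \<Longrightarrow> act p f = 0" by (auto simp: all_relators_def)
qed

definition annihilator where
  "annihilator = {p \<in> augmentation. \<forall>f. act p f = 0}"

lemma lid_annihilator: "lid G annihilator"
  using all_relators_subset_augmentation [of G] tideal_augmentation
  unfolding lid_def tideal_def
  by (auto simp: annihilator_def act_add_left act_mult act_relator)

lemma vt_in_annihilator_iff: "vt v \<in> annihilator \<longleftrightarrow> (\<forall>q \<in> X. src q \<noteq> v)"
proof
  assume v: "vt v \<in> annihilator"
  show "\<forall>q \<in> X. src q \<noteq> v"
  proof (intro ballI notI)
    fix q assume q: "q \<in> X" "src q = v"
    have "act (vt v) 1 = 0" using v by (simp add: annihilator_def)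
    then have "gen_op (Vert v) 1 q = 0" by simp
    then show False using q by simp
  qed
qed (auto simp: annihilator_def fun_eq_iff)

text \<open>The weights commute with all power series, so the action is linear over power series and
  not only over the field; powers of \<open>fps_X\<close> can be pulled through it.\<close>

lemma act_fps_linear: "act p (\<lambda>q. c * f q) = (\<lambda>q. c * act p f q)"
proof -
  have g: "gen_op g (\<lambda>q. c * f q) = (\<lambda>q. c * gen_op g f q)" for g f
    by (cases g) (auto simp: fun_eq_iff gen_op.simps(2) mult.left_commute)
  show ?thesis
  proof (induction p arbitrary: f rule: gen_poly_induct)
    case (var_mult h p)
    then show ?case by (simp only: act_mult act_var g)
  qed (simp_all add: act_add_left fun_eq_iff fun_scale_def distrib_left mult.left_commute)
qed

text \<open>Every letter computes a value from at most one value of its argument, so an element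
  needs finitely many. This replaces the expansion in a basis of point functions, which arbitrary
  functions do not admit.\<close>

lemma act_local: "\<exists>D. finite D \<and> (\<forall>f f'. (\<forall>r \<in> D. f r = f' r) \<longrightarrow> act p f q = act p f' q)"
proof (induction p arbitrary: q rule: gen_poly_induct)
  case (const c)
  show ?case by (intro exI [of _ "{q}"]) (unfold act_const, simp add: fun_scale_def)
next
  case (var_mult g p)
  have "\<exists>r. \<forall>f f'. f r = f' r \<longrightarrow> gen_op g f q = gen_op g f' q"
    by (cases g) (auto simp: gen_op.simps(2))
  then obtain r where r: "\<And>f f'. f r = f' r \<Longrightarrow> gen_op g f q = gen_op g f' q" by blast
  obtain D where "finite D" "\<And>f f'. (\<forall>r \<in> D. f r = f' r) \<Longrightarrow> act p f r = act p f' r"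
    using var_mult [of r] by blast
  then show ?case
    by (intro exI [of _ D] conjI allI impI) (auto simp only: act_mult act_var intro!: r)
next
  case (add p p')
  obtain D where D: "finite D" "\<And>f f'. (\<forall>r \<in> D. f r = f' r) \<Longrightarrow> act p f q = act p f' q"
    using add(1) by blast
  obtain D' where D': "finite D'" "\<And>f f'. (\<forall>r \<in> D'. f r = f' r) \<Longrightarrow> act p' f q = act p' f' q"
    using add(2) by blast
  have "act (p + p') f q = act (p + p') f' q" if "\<forall>r \<in> D \<union> D'. f r = f' r" for f f'
    unfolding act_add_left plus_fun_apply using that by (intro arg_cong2 [OF D(2) D'(2)]) blast+
  then show ?case using D(1) D'(1) by (intro exI [of _ "D \<union> D'"]) blast
qed

lemma act_dirac_nonzero:
  assumes "act p f q \<noteq> 0"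
  obtains r where "act p (dirac r) q \<noteq> 0"
proof -
  obtain D where D: "finite D" "\<And>f f'. (\<forall>r \<in> D. f r = f' r) \<Longrightarrow> act p f q = act p f' q"
    using act_local [of p q] by blast
  let ?f = "\<Sum>r \<in> D. (\<lambda>q. f r * dirac r q)"
  have "?f q = f q" if "q \<in> D" for q
  proof -
    have "?f q = (\<Sum>r \<in> D. if r = q then f r else 0)"
      unfolding sum_fun_apply by (intro sum.cong) (auto simp: dirac_def)
    then show ?thesis using that D(1) by (simp add: sum.delta)
  qed
  then have "act p f q = act p ?f q" by (intro D(2)) simp
  also have "\<dots> = (\<Sum>r \<in> D. f r * act p (dirac r) q)"
    by (simp add: act_sum_right act_fps_linear sum_fun_apply)
  finally have "(\<Sum>r \<in> D. f r * act p (dirac r) q) \<noteq> 0" using assms by simp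
  then obtain r where "f r * act p (dirac r) q \<noteq> 0"
    by (rule sum.not_neutral_contains_not_neutral)
  then show ?thesis using that by auto
qed

lemma act_congruent: "x \<simeq>\<^bsub>null_ideal G\<^esub> y \<Longrightarrow> act x f = act y f"
  using null_ideal_subset [OF lid_annihilator]
  by (auto simp: eqv_def annihilator_def act_diff_left)

lemma foldr_cons:
  assumes "awalk u p (src q)" "q \<in> X"
  shows "foldr cons p q \<in> X" "src (foldr cons p q) = u"
proof -
  have "foldr cons p q \<in> X \<and> src (foldr cons p q) = u"
    using assms
  proof (induction p arbitrary: u)
    case (Cons e p)
    then have "foldr cons p q \<in> fibre e" by (auto simp: fibre_def awalk_Cons_iff)
    then show ?case using Cons.prems by (simp add: cons_fibre awalk_Cons_iff)
  qed (auto simp: awalk_Nil_iff)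
  then show "foldr cons p q \<in> X" "src (foldr cons p q) = u" by auto
qed

lemma foldr_cons_fibre: "awalk u (e # p) (src q) \<Longrightarrow> q \<in> X \<Longrightarrow> foldr cons p q \<in> fibre e"
  using foldr_cons [of "head G e" p q] by (simp add: fibre_def awalk_Cons_iff)

lemma act_gpath:
  "awalk u p (src q) \<Longrightarrow> q \<in> X \<Longrightarrow> act (gpath p) f q = wt' ^ length p * f (foldr cons p q)"
proof (induction p arbitrary: u f)
  case (Cons e p)
  then have "act (gpath p) (gen_op (Ghost e) f) q = wt' ^ length p * gen_op (Ghost e) f (foldr cons p q)"
    by (auto simp: awalk_Cons_iff)
  then show ?case using foldr_cons_fibre [OF Cons.prems] by (simp add: act_mult mult.assoc)
qed simp

lemma act_epath_dirac:
  "awalk u p (src q) \<Longrightarrow> q \<in> X \<Longrightarrow>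
    act (epath p) (dirac q) = (\<lambda>r. wt ^ length p * dirac (foldr cons p q) r)"
proof (induction p arbitrary: u)
  case (Cons e p)
  let ?r = "foldr cons p q"
  have "gen_op (Edge e) (dirac ?r) = (\<lambda>q. wt * dirac (cons e ?r) q)"
  proof
    fix s
    have r: "?r \<in> fibre e" by (rule foldr_cons_fibre [OF Cons.prems])
    show "gen_op (Edge e) (dirac ?r) s = wt * dirac (cons e ?r) s"
    proof (cases "s \<in> cons e ` fibre e")
      case True
      then obtain t where t: "s = cons e t" "t \<in> fibre e" by blast
      then show ?thesis using r inj_on_cons [of e] by (auto simp: edge_cons dirac_def inj_on_def)
    next
      case False
      then show ?thesis using r by (auto simp: edge_other dirac_def)
    qed
  qed
  moreover have "act (epath p) (dirac q) = (\<lambda>r. wt ^ length p * dirac ?r r)"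
    using Cons by (auto simp: awalk_Cons_iff)
  ultimately have "act (ed e) (act (epath p) (dirac q)) = (\<lambda>r. wt ^ length p * (wt * dirac (cons e ?r) r))"
    by (simp only: act_fps_linear act_var)
  then show ?case by (simp add: act_mult mult_ac)
qed simp

text \<open>Elements without constant term have local units made of vertices, and vertices act as
  zero off \<open>X\<close>; a constant term would act there as a scalar.\<close>

lemma act_off_X:
  assumes "p \<in> augmentation" "q \<notin> X"
  shows "act p f q = 0" and "act p (dirac q) = 0"
proof -
  obtain Y where "(\<Sum>v \<in> Y. vt v) * p \<simeq>\<^bsub>null_ideal G\<^esub> p"
    using local_unit_left [OF tideal_null_ideal null_ideal_relators assms(1)] .
  then have "act p f = act (\<Sum>v \<in> Y. vt v) (act p f)" by (simp add: act_congruent flip: act_mult)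
  then have "act p f q = act (\<Sum>v \<in> Y. vt v) (act p f) q" by (rule fun_cong)
  also have "\<dots> = 0" using assms(2) by (simp add: act_sum_left sum_fun_apply)
  finally show "act p f q = 0" .
  obtain Z where "p * (\<Sum>v \<in> Z. vt v) \<simeq>\<^bsub>null_ideal G\<^esub> p"
    using local_unit_right [OF tideal_null_ideal null_ideal_relators assms(1)] .
  then have "act p (dirac q) = act p (act (\<Sum>v \<in> Z. vt v) (dirac q))"
    by (simp add: act_congruent flip: act_mult)
  also have "act (\<Sum>v \<in> Z. vt v) (dirac q) = 0"
    using assms(2) by (auto simp: act_sum_left sum_fun_apply fun_eq_iff dirac_def intro!: sum.neutral)
  finally show "act p (dirac q) = 0" by (simp only: act_zero_right)
qed

text \<open>The annihilator of the module modulo its multiples by \<open>fps_X ^ n\<close>.\<close>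

definition adic_ideal where
  "adic_ideal n = {p \<in> augmentation. \<forall>f q. fps_X ^ n dvd act p f q}"

lemma lid_adic_ideal: "lid G (adic_ideal n)"
proof -
  have "fps_X ^ n dvd act (x * p) f q" if p: "\<And>f q. fps_X ^ n dvd act p f q" for x p f q
  proof -
    \<comment> \<open>The quotients at the single points are gathered into one function, so that
      \<open>fps_X ^ n\<close> can be pulled through the action of \<open>x\<close>.\<close>
    obtain h where "\<And>q. act p f q = fps_X ^ n * h q" using p [of f] unfolding dvd_def by metis
    then have "act p f = (\<lambda>q. fps_X ^ n * h q)" by blast
    then show ?thesis by (simp add: act_mult act_fps_linear)
  qed
  then show ?thesis
    using all_relators_subset_augmentation [of G] tideal_augmentation
    unfolding lid_def tideal_def
    by (auto simp: adic_ideal_def act_add_left act_mult act_relator intro!: dvd_add)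
qed

lemma Inter_adic_ideal: "(\<Inter>n \<in> {0<..}. adic_ideal n) = annihilator"
proof
  show "annihilator \<subseteq> (\<Inter>n \<in> {0<..}. adic_ideal n)"
    by (auto simp: annihilator_def adic_ideal_def)
  show "(\<Inter>n \<in> {0<..}. adic_ideal n) \<subseteq> annihilator"
  proof
    fix p assume p: "p \<in> (\<Inter>n \<in> {0<..}. adic_ideal n)"
    have "act p f q = 0" for f q
    proof (rule fps_ext)
      fix n
      have "fps_X ^ Suc n dvd act p f q" using p unfolding adic_ideal_def by blast
      then obtain d where "act p f q = fps_X ^ Suc n * d" by (auto simp: dvd_def)
      then show "fps_nth (act p f q) n = fps_nth 0 n" by (simp add: fps_X_power_mult_nth del: power_Suc)
    qed
    then show "p \<in> annihilator" using p by (auto simp: annihilator_def adic_ideal_def fun_eq_iff)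
  qed
qed

end

text \<open>
  Over a vertex outside \<^term>\<open>Y\<close> the fibre is a copy of \<^typ>\<open>'e list \<times> nat\<close>. At a regular vertex
  with \<open>m\<close> edges into the complement of \<^term>\<open>Y\<close> the second component is used to identify \<open>m\<close>
  copies of the fibre with one; elsewhere it suffices that infinitely many copies embed into it.
\<close>
lemma (in wf_digraph) ideal_with_vertex_set:
  assumes "hereditary G Y" "saturated G Y"
  obtains U :: "('a, 'b, 'k::field) lpa_poly set"
  where "lid G U" "\<And>v. v \<in> verts G \<Longrightarrow> vt v \<in> U \<longleftrightarrow> v \<in> Y"
proof -
  define Out where "Out v = {e \<in> out_arcs G v. head G e \<notin> Y}" for v
  have finite_Out: "finite (Out v)" if "regular G v" for v
    using that by (auto simp: regular_def Out_def intro: rev_finite_subset)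
  have "\<exists>i. regular G v \<longrightarrow> bij_betw i (Out v) {..<card (Out v)}" for v
  proof (cases "regular G v")
    case True
    then show ?thesis using finite_Out ex_bij_betw_finite_nat by (metis atLeast0LessThan)
  qed simp
  then obtain i where i: "\<And>v. regular G v \<Longrightarrow> bij_betw (i v) (Out v) {..<card (Out v)}" by metis
  define X :: "('a \<times> 'b list \<times> nat) set" where "X = (verts G - Y) \<times> UNIV"
  \<comment> \<open>With \<open>m = card (Out v)\<close> at a regular vertex, a number
    \<open>n\<close> and an edge index below \<open>m\<close> are encoded as \<open>n * m\<close>
    plus the index, which \<open>div\<close> and \<open>mod\<close> decode. At other vertices the
    edge is pushed onto the list, which is injective but not onto.\<close>
  define cons where "cons e q = (case q of (_, l, n) \<Rightarrow> (tail G e,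
      if regular G (tail G e) then (l, n * card (Out (tail G e)) + i (tail G e) e) else (e # l, n)))"
    for e :: 'b and q :: "'a \<times> 'b list \<times> nat"
  have tail_Y: "tail G e \<notin> Y" if "e \<in> arcs G" "head G e \<notin> Y" for e
    using assms(1) that arc_implies_awalk unfolding hereditary_def path_ge_def by blast
  have i_less: "i (tail G e) e < card (Out (tail G e))"
    if "e \<in> arcs G" "head G e \<notin> Y" "regular G (tail G e)" for e
    using i [OF that(3)] that by (auto simp: Out_def bij_betw_def)
  interpret branching_system G X fst cons "1 :: 'k fps" 1
  proof
    fix e q assume e: "e \<in> arcs G" "q \<in> X" "fst q = head G e"
    then have Y: "head G e \<notin> Y" by (auto simp: X_def)
    show "cons e q \<in> X" using e Y tail_Y [of e] by (auto simp: X_def cons_def split: prod.split)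
    show "fst (cons e q) = tail G e" by (simp add: cons_def split: prod.split)
    fix f r assume f: "f \<in> arcs G" "r \<in> X" "fst r = head G f" and eq: "cons e q = cons f r"
    then have Y': "head G f \<notin> Y" by (auto simp: X_def)
    obtain l n l' n' where q: "q = (head G e, l, n)" "r = (head G f, l', n')"
      using e f by (cases q; cases r) auto
    have t: "tail G e = tail G f" using eq by (simp add: cons_def q)
    show "e = f \<and> q = r"
    proof (cases "regular G (tail G e)")
      case True
      let ?m = "card (Out (tail G f))"
      from True eq t have eq': "l = l'" "n * ?m + i (tail G f) e = n' * ?m + i (tail G f) f"
        by (simp_all add: cons_def q)
      have less: "i (tail G f) e < ?m" "i (tail G f) f < ?m"
        using i_less [of e] i_less [of f] True t e f Y Y' by simp_all
      have "n = n'" using arg_cong [OF eq'(2), of "\<lambda>x. x div ?m"] less by simp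
      moreover from this eq'(2) have "i (tail G f) e = i (tail G f) f" by simp
      then have "e = f"
        using i [of "tail G f"] True t e f Y Y' by (auto simp: bij_betw_def inj_on_def Out_def)
      ultimately show ?thesis using eq' by (simp add: q)
    next
      case False
      then show ?thesis using eq t by (auto simp: cons_def q)
    qed
  next
    fix q assume q: "q \<in> X" "regular G (fst q)"
    obtain v l n where v: "q = (v, l, n)" by (cases q)
    let ?m = "card (Out v)"
    \<comment> \<open>Saturation enters here: a regular vertex outside \<open>Y\<close> has an edge
      that stays outside \<open>Y\<close>.\<close>
    have "Out v \<noteq> {}"
      using assms(2) q unfolding saturated_def by (auto simp: Out_def X_def v)
    moreover have "finite (Out v)" using q finite_Out by (simp add: v)
    ultimately have "?m > 0" by (simp add: card_gt_0_iff)
    then have "n mod ?m \<in> i v ` Out v" using i [of v] q by (simp add: bij_betw_def v)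
    then obtain e where e: "e \<in> Out v" "i v e = n mod ?m" by auto
    then have "q = cons e (head G e, l, n div ?m)" using q by (auto simp: v cons_def Out_def)
    moreover have "(head G e, l, n div ?m) \<in> X" using e by (auto simp: X_def Out_def)
    ultimately show "\<exists>e \<in> arcs G. \<exists>r \<in> X. fst r = head G e \<and> q = cons e r"
      using e by (intro bexI [of _ e] bexI [of _ "(head G e, l, n div ?m)"]) (auto simp: Out_def)
  qed (auto simp: X_def)
  show ?thesis
  proof (rule that [OF lid_annihilator])
    fix v assume "v \<in> verts G"
    then show "vt v \<in> annihilator \<longleftrightarrow> v \<in> Y"
      unfolding vt_in_annihilator_iff by (auto simp: X_def)
  qed
qed

text \<open>The empty set is hereditary, and saturated because a regular vertex emits an edge; its
  ideal contains no vertex.\<close>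

lemma (in wf_digraph) vt_notin_null_ideal:
  "v \<in> verts G \<Longrightarrow> (vt v :: ('a, 'b, 'k::field) lpa_poly) \<notin> null_ideal G"
proof -
  assume v: "v \<in> verts G"
  have "hereditary G {}" "saturated G {}" by (auto simp: hereditary_def saturated_def regular_def)
  then obtain U :: "('a, 'b, 'k) lpa_poly set"
    where "lid G U" "\<And>v. v \<in> verts G \<Longrightarrow> vt v \<in> U \<longleftrightarrow> v \<in> {}"
    using ideal_with_vertex_set by blast
  then show ?thesis using v null_ideal_subset by blast
qed

section \<open>Failure of condition (K)\<close>

text \<open>Compared as polynomials, by degree; the linear coefficient \<open>l\<close> may vanish
  in positive characteristic.\<close>

lemma one_plus_fps_X_power_neq_one:
  assumes "l > 0"
  shows "(1 + fps_X) ^ l \<noteq> (1 :: 'k::field fps)"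
proof
  assume "(1 + fps_X) ^ l = (1 :: 'k fps)"
  moreover have "fps_of_poly ([:1, 1:] :: 'k poly) = 1 + fps_X"
    by (simp add: fps_of_poly_pCons)
  ultimately have "fps_of_poly ([:1, 1:] ^ l :: 'k poly) = fps_of_poly 1"
    by (simp add: fps_of_poly_power)
  then have "[:1, 1:] ^ l = (1 :: 'k poly)" by (simp only: fps_of_poly_eq_iff)
  then have "degree ([:1, 1:] ^ l :: 'k poly) = 0" by simp
  then show False using assms by (simp add: degree_power_eq)
qed

definition lid_prime :: "('v, 'e) pre_digraph \<Rightarrow> ('v, 'e, 'k::field) lpa_poly set \<Rightarrow> bool" where
  "lid_prime G U \<longleftrightarrow> (\<forall>A B. lid G A \<longrightarrow> lid G B \<longrightarrow> (\<forall>a \<in> A. \<forall>b \<in> B. a * b \<in> U) \<longrightarrow> A \<subseteq> U \<or> B \<subseteq> U)"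

definition lid_ci :: "('v, 'e) pre_digraph \<Rightarrow> ('v, 'e, 'k::field) lpa_poly set \<Rightarrow> bool" where
  "lid_ci G U \<longleftrightarrow> lid G U \<and> U \<noteq> augmentation \<and>
    \<not> (\<exists>\<J>. \<J> \<noteq> {} \<and> (\<forall>J \<in> \<J>. lid G J \<and> U \<subset> J) \<and> U = \<Inter>\<J>)"

context wf_digraph
begin

text \<open>All closed paths at a vertex where (K) fails have the same edges. If one of them left a
  shortest one \<open>g\<close>, the edge by which it leaves would also occur in \<open>g\<close>,
  so \<open>g\<close> would pass twice through one vertex and could be shortened.\<close>

lemma unique_cycle:
  assumes "\<not> condition_K G"
  obtains v g where "closed_path G v g" "\<And>q. awalk v q v \<Longrightarrow> \<exists>j. q = concat (replicate j g)"
proof -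
  obtain u p v where p: "closed_path G u p" "v \<in> set (awalk_verts u p)"
    and same: "\<And>q. closed_path G v q \<Longrightarrow> set q = set p"
    using assms unfolding condition_K_def by blast
  obtain p1 p2 where "p = p1 @ p2" "awalk u p1 v" "awalk v p2 u"
    using awalk_decomp [of u p u v] p by (auto simp: closed_path_iff)
  moreover from this have "awalk v (p2 @ p1) v" unfolding awalk_append by blast
  ultimately have "closed_path G v (p2 @ p1)" using p(1) by (auto simp: closed_path_iff)
  then obtain g where g: "closed_path G v g"
    and min: "\<And>q. closed_path G v q \<Longrightarrow> length g \<le> length q"
    using shortest_closed_path by blast
  have no_r: "r = []" if r: "r = [] \<or> closed_path G v r \<and> \<not> prefix g r \<and> \<not> prefix r g" for r
  proof (rule ccontr)
    assume "r \<noteq> []"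
    with r have "closed_path G v r" "g \<parallel> r" by auto
    then obtain as b bs c cs where gr: "g = as @ b # bs" "r = as @ c # cs" "b \<noteq> c"
      using parallel_decomp by blast
    have "awalk v (as @ b # bs) v" "awalk v (as @ c # cs) v"
      using g \<open>closed_path G v r\<close> unfolding gr closed_path_iff by simp_all
    then obtain w w' where w: "awalk v as w" "awalk w (b # bs) v" "awalk v as w'" "awalk w' (c # cs) v"
      unfolding awalk_append by blast
    have "w = w'" using awlast_if_cas [of v as w] awlast_if_cas [of v as w'] w(1,3) by (simp add: awalk_def)
    then have tails: "tail G c = tail G b" using w by (simp add: awalk_Cons_iff)
    have "c \<in> set g" using same g \<open>closed_path G v r\<close> by (metis gr(2) in_set_conv_decomp)
    then have "c \<in> set as \<or> c \<in> set bs" using gr by auto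
    \<comment> \<open>\<open>b\<close> and \<open>c\<close> are distinct edges of \<open>g\<close>
      with the same tail; cutting out the part of \<open>g\<close> between them leaves a shorter
      closed path.\<close>
    then have "\<exists>h. closed_path G v h \<and> length h < length g"
    proof
      assume "c \<in> set bs"
      then obtain x y where bs: "bs = x @ c # y" by (auto simp: in_set_conv_decomp)
      then obtain z where "awalk z (c # y) v"
        using w(2) unfolding bs awalk_Cons_iff awalk_append by blast
      then have "awalk w (c # y) v" using tails w(2) by (simp add: awalk_Cons_iff)
      then have "awalk v (as @ c # y) v" using w(1) unfolding awalk_append by blast
      then show ?thesis by (intro exI [of _ "as @ c # y"]) (simp add: closed_path_iff gr bs)
    next
      assume "c \<in> set as"
      then obtain x y where as: "as = x @ c # y" by (auto simp: in_set_conv_decomp)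
      then obtain z where "awalk v x z" "awalk z (c # y) w" using w(1) unfolding as awalk_append by blast
      then have "awalk v x w" using tails w(2) by (simp add: awalk_Cons_iff)
      then have "awalk v (x @ b # bs) v" using w(2) unfolding awalk_append by blast
      then show ?thesis by (intro exI [of _ "x @ b # bs"]) (simp add: closed_path_iff gr as)
    qed
    then show False using min leD by blast
  qed
  then have "\<exists>j. q = concat (replicate j g)" if q: "awalk v q v" for q
  proof -
    obtain j r where "q = concat (replicate j g) @ r"
        "r = [] \<or> closed_path G v r \<and> \<not> prefix g r \<and> \<not> prefix r g"
      using closed_path_power [OF g min q] .
    moreover from this(2) have "r = []" by (rule no_r)
    ultimately show ?thesis by auto
  qed
  with g show ?thesis by (rule that)
qed

text \<open>
  The module of the paths that are eventually \<open>g\<close>-periodic, twisted by the unit \<open>1 + X\<close>: its basis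
  consists of the paths \<open>\<alpha>\<close> ending at \<open>v\<close> that do not end with \<open>g\<close>, where \<open>\<alpha>\<close> stands for \<open>\<alpha> g g g \<dots>\<close>.
  Its annihilator is prime, but it is the intersection of the ideals mapping the module into its
  multiples by powers of \<open>X\<close>.
\<close>
lemma prime_not_ci:
  assumes "\<not> condition_K G"
  obtains U :: "('a, 'b, 'k::field) lpa_poly set"
  where "lid G U" "U \<noteq> augmentation" "lid_prime G U" "\<not> lid_ci G U"
proof -
  obtain v g where g: "closed_path G v g" and pow: "\<And>q. awalk v q v \<Longrightarrow> \<exists>j. q = concat (replicate j g)"
    using unique_cycle [OF assms] by blast
  have g0: "g \<noteq> []" "awalk v g v" and v: "v \<in> verts G"
    using g by (auto simp: closed_path_iff dest: awalk_last_in_verts)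
  define X where "X = {\<alpha>. (\<exists>u. awalk u \<alpha> v) \<and> \<not> suffix g \<alpha>}"
  define src where "src \<alpha> = (if \<alpha> = [] then v else tail G (hd \<alpha>))" for \<alpha>
  \<comment> \<open>If \<open>e # \<alpha>\<close> is \<open>g\<close>, the infinite path is purely
    periodic and its normal form is \<open>[]\<close>. No other path acquires the suffix
    \<open>g\<close> in this step.\<close>
  define cons where "cons e \<alpha> = (if e # \<alpha> = g then [] else e # \<alpha>)" for e \<alpha>
  have src: "awalk u \<alpha> v \<Longrightarrow> src \<alpha> = u" for u \<alpha>
    by (cases \<alpha>) (auto simp: src_def awalk_Nil_iff awalk_Cons_iff)
  then have X_awalk: "\<alpha> \<in> X \<Longrightarrow> awalk (src \<alpha>) \<alpha> v" for \<alpha> by (auto simp: X_def)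
  have nil: "[] \<in> X" using v g0 by (auto simp: X_def awalk_Nil_iff)
  \<comment> \<open>The fibre over \<open>v\<close> is the single point \<open>[]\<close>; thus
    \<open>vt v\<close> acts as a projection of rank one, which is the source of primeness.\<close>
  have X_v: "\<alpha> = []" if \<alpha>: "\<alpha> \<in> X" "src \<alpha> = v" for \<alpha>
  proof (rule ccontr)
    assume "\<alpha> \<noteq> []"
    obtain j where j: "\<alpha> = concat (replicate j g)" using pow X_awalk [OF \<alpha>(1)] \<alpha>(2) by auto
    with \<open>\<alpha> \<noteq> []\<close> obtain i where "j = Suc i" by (cases j) auto
    then have "\<alpha> = concat (replicate i g) @ g"
      using concat_replicate_append [of i g 1] j by simp
    then show False using \<alpha> by (auto simp: X_def suffix_def)
  qed
  interpret branching_system G X src cons "1 + fps_X :: 'k fps" "inverse (1 + fps_X)"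
  proof
    show "(1 + fps_X) * inverse (1 + fps_X) = (1 :: 'k fps)"
      by (subst mult.commute) (rule inverse_mult_eq_1, simp)
  next
    fix q assume "q \<in> X"
    then show "src q \<in> verts G" using X_awalk awalk_hd_in_verts by blast
  next
    fix e q assume e: "e \<in> arcs G" "q \<in> X" "src q = head G e"
    then have w: "awalk (tail G e) (e # q) v" using X_awalk [of q] by (simp add: awalk_Cons_iff)
    then show "cons e q \<in> X" using e nil by (auto simp: cons_def X_def suffix_Cons)
    show "src (cons e q) = tail G e"
    proof (cases "e # q = g")
      case True
      then show ?thesis using w g0 by (auto simp: cons_def src_def awalk_Cons_iff)
    qed (simp add: cons_def src_def)
    fix f r assume "f \<in> arcs G" "r \<in> X" "src r = head G f" "cons e q = cons f r"
    then show "e = f \<and> q = r" by (auto simp: cons_def split: if_splits)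
  next
    fix q assume q: "q \<in> X"
    obtain e r where r: "q = cons e r" "awalk (head G e) r v" "e \<in> arcs G" "\<not> suffix g r"
    proof (cases q)
      case Nil
      obtain e r where er: "g = e # r" using g0 by (cases g) auto
      then have "\<not> suffix g r" by (auto dest: suffix_length_le)
      moreover have "e \<in> arcs G \<and> awalk (head G e) r v"
        using g0(2) unfolding er awalk_Cons_iff by blast
      moreover have "q = cons e r" using Nil er by (simp add: cons_def)
      ultimately show ?thesis using that by blast
    next
      case (Cons e r)
      then have "e \<in> arcs G \<and> awalk (head G e) r v"
        using X_awalk [OF q] unfolding Cons awalk_Cons_iff by blast
      moreover have "\<not> suffix g r" "q = cons e r"
        using q by (auto simp: X_def Cons cons_def suffix_Cons)
      ultimately show ?thesis using that by blast
    qed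
    then show "\<exists>e \<in> arcs G. \<exists>r \<in> X. src r = head G e \<and> q = cons e r"
      using src by (intro bexI [of _ e] bexI [of _ r]) (auto simp: X_def)
  qed
  let ?w = "1 + fps_X :: 'k fps" and ?w' = "inverse (1 + fps_X) :: 'k fps"
  have unit: "?w ^ n \<noteq> 0" "?w' ^ n \<noteq> 0" for n
    using weights by (auto simp: power_eq_0_iff)
  have suf: "foldr cons \<alpha> [] = \<alpha>" if "suffix \<alpha> g" "\<alpha> \<noteq> g" for \<alpha>
    using that
  proof (induction \<alpha>)
    case (Cons e \<alpha>)
    then have "suffix \<alpha> g" "\<alpha> \<noteq> g" by (auto dest: suffix_ConsD suffix_length_le)
    then show ?case using Cons by (simp add: cons_def)
  qed simp
  have fold_X: "foldr cons \<alpha> [] = \<alpha>" if "\<alpha> \<in> X" for \<alpha>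
    using that
  proof (induction \<alpha>)
    case (Cons e \<alpha>)
    then have "\<alpha> \<in> X" "e # \<alpha> \<noteq> g" by (auto simp: X_def awalk_Cons_iff suffix_Cons)
    then show ?case using Cons by (simp add: cons_def)
  qed simp
  have fold_g: "foldr cons g [] = []"
  proof -
    obtain e r where er: "g = e # r" using g0 by (cases g) auto
    then have "foldr cons r [] = r" by (intro suf) (auto simp: suffix_Cons)
    then show ?thesis by (simp add: er cons_def)
  qed
  have act_vt: "act (vt v) f = (\<lambda>q. f [] * dirac [] q)" for f
  proof
    fix q
    have "q \<in> X \<and> src q = v \<longleftrightarrow> q = []" using nil X_v [of q] by (auto simp: src_def)
    then show "act (vt v) f q = f [] * dirac [] q" by (simp add: dirac_def)
  qed
  \<comment> \<open>\<open>y\<close> stands for v - c. It acts on the point \<open>[]\<close> as 1 -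
    (1 + X)^l, a nonzero multiple of X, so for positive \<open>n\<close> its \<open>n\<close>-th
    power lies in the \<open>n\<close>-th adic ideal but not in the annihilator.\<close>
  define y :: "('a, 'b, 'k) lpa_poly" where "y = vt v - epath g * vt v"
  let ?l = "length g"
  have act_y: "act y f = (\<lambda>q. (1 - ?w ^ ?l) * (f [] * dirac [] q))" for f
  proof -
    have "act (epath g) (dirac []) = (\<lambda>q. ?w ^ ?l * dirac [] q)"
      using act_epath_dirac [of v g "[]"] g0 nil fold_g by (simp add: src_def)
    then have "act (epath g * vt v) f = (\<lambda>q. f [] * (?w ^ ?l * dirac [] q))"
      by (simp only: act_mult act_vt act_fps_linear)
    then show ?thesis
      unfolding y_def act_diff_left act_vt by (auto simp: fun_eq_iff algebra_simps)
  qed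
  have act_y_power: "act (y ^ Suc n) f = (\<lambda>q. (1 - ?w ^ ?l) ^ Suc n * (f [] * dirac [] q))" for n f
  proof (induction n arbitrary: f)
    case (Suc n)
    have "act (y ^ Suc (Suc n)) f = act y (act (y ^ Suc n) f)"
      by (simp only: power_Suc [of y "Suc n"] act_mult)
    also have "\<dots> = (\<lambda>q. (1 - ?w ^ ?l) ^ Suc (Suc n) * (f [] * dirac [] q))"
      unfolding Suc.IH act_y by (rule ext) (simp only: dirac_def power_Suc mult_ac mult_1_left simp_thms if_True)
    finally show ?case .
  qed (simp add: act_y)
  have y: "y \<in> augmentation"
    unfolding y_def by (intro tideal_diff tideal_mult_left tideal_augmentation) simp_all
  have y_aug: "y ^ Suc n \<in> augmentation" for n
    unfolding power_Suc by (rule tideal_mult_right [OF tideal_augmentation y])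
  have div: "fps_X dvd 1 - ?w ^ ?l"
  proof -
    have "1 - ?w ^ ?l = - (?w ^ ?l - 1)" by simp
    also have "\<dots> = fps_X * - (\<Sum>i < ?l. ?w ^ i)" by (simp add: power_diff_1_eq)
    finally show ?thesis by simp
  qed
  show ?thesis
  proof (rule that [OF lid_annihilator])
    have "vt v \<notin> annihilator" using nil by (auto simp: vt_in_annihilator_iff src_def)
    then show "annihilator \<noteq> augmentation" by auto
    show "\<not> lid_ci G annihilator"
    proof
      let ?\<J> = "adic_ideal ` {0<..}"
      assume "lid_ci G annihilator"
      moreover have "\<forall>J \<in> ?\<J>. lid G J \<and> annihilator \<subset> J"
      proof (intro ballI conjI psubsetI notI)
        fix J assume "J \<in> ?\<J>"
        then obtain n :: nat where n: "0 < n" and J: "J = adic_ideal n" by auto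
        show "lid G J" unfolding J by (rule lid_adic_ideal)
        show "annihilator \<subseteq> J" by (auto simp: J annihilator_def adic_ideal_def)
        obtain m where m: "n = Suc m" using n by (cases n) auto
        have "fps_X ^ n dvd (1 - ?w ^ ?l) ^ n" using div by (rule dvd_power_same)
        then have "y ^ n \<in> adic_ideal n"
          using y_aug act_y_power by (simp add: adic_ideal_def m del: power_Suc)
        moreover assume "annihilator = J"
        ultimately have "y ^ n \<in> annihilator" using J by blast
        then have "act (y ^ n) 1 [] = 0" unfolding annihilator_def by auto
        then have "(1 - ?w ^ ?l) ^ n = 0"
          using act_y_power [of m 1] by (simp add: m dirac_def del: power_Suc)
        then show False using one_plus_fps_X_power_neq_one [of ?l] g0 by auto
      qed
      moreover have "annihilator = \<Inter>?\<J>" using Inter_adic_ideal by simp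
      moreover have "?\<J> \<noteq> {}" by auto
      ultimately show False unfolding lid_ci_def by (metis (no_types, lifting))
    qed
    show "lid_prime G annihilator"
      unfolding lid_prime_def
    proof (intro allI impI)
      fix A B assume A: "lid G A" and B: "lid G B" and AB: "\<forall>a \<in> A. \<forall>b \<in> B. a * b \<in> annihilator"
      show "A \<subseteq> annihilator \<or> B \<subseteq> annihilator"
      proof (rule ccontr)
        assume "\<not> (A \<subseteq> annihilator \<or> B \<subseteq> annihilator)"
        then obtain a b where a: "a \<in> A" "a \<notin> annihilator" and b: "b \<in> B" "b \<notin> annihilator" by blast
        have aug: "a \<in> augmentation" "b \<in> augmentation" using A B a b by (auto simp: lid_def)
        obtain f q where "act a f q \<noteq> 0" using a aug by (auto simp: annihilator_def fun_eq_iff)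
        then obtain \<alpha> where \<alpha>: "act a (dirac \<alpha>) q \<noteq> 0" by (rule act_dirac_nonzero)
        then have \<alpha>X: "\<alpha> \<in> X" using act_off_X(2) [OF aug(1), of \<alpha>] by (metis zero_fun_apply)
        obtain h \<beta> where \<beta>: "act b h \<beta> \<noteq> 0" using b aug by (auto simp: annihilator_def fun_eq_iff)
        then have \<beta>X: "\<beta> \<in> X" using act_off_X(1) [OF aug(2)] by blast
        \<comment> \<open>Up to units, \<open>?z\<close> carries the value at \<open>\<beta>\<close>
          to the point \<open>\<alpha>\<close>, so in \<open>a * ?z * b\<close> a nonzero value of
          \<open>b\<close> meets a nonzero value of \<open>a\<close>, and power series have no zero
          divisors.\<close>
        let ?z = "epath \<alpha> * (vt v * gpath \<beta>)"
        have "act ?z k = (\<lambda>q. ?w' ^ length \<beta> * k \<beta> * (?w ^ length \<alpha> * dirac \<alpha> q))" for k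
        proof -
          have "act (gpath \<beta>) k [] = ?w' ^ length \<beta> * k \<beta>"
            using act_gpath [of "src \<beta>" \<beta> "[]" k] X_awalk [OF \<beta>X] nil fold_X [OF \<beta>X] by (simp add: src_def)
          moreover have "act (epath \<alpha>) (dirac []) = (\<lambda>q. ?w ^ length \<alpha> * dirac \<alpha> q)"
            using act_epath_dirac [of "src \<alpha>" \<alpha> "[]"] X_awalk [OF \<alpha>X] nil fold_X [OF \<alpha>X] by (simp add: src_def)
          ultimately show ?thesis by (simp only: act_mult act_vt act_fps_linear)
        qed
        then have "act (a * ?z * b) h q =
            ?w' ^ length \<beta> * act b h \<beta> * (?w ^ length \<alpha> * act a (dirac \<alpha>) q)"
          by (simp only: act_mult act_fps_linear)
        also have "\<dots> \<noteq> 0" using unit \<alpha> \<beta> by simp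
        finally have "act (a * ?z * b) h \<noteq> 0" by (metis zero_fun_apply)
        then have "a * ?z * b \<notin> annihilator" unfolding annihilator_def by blast
        moreover have "a * ?z \<in> A" using a lid_tideal [OF A] by (simp add: tideal_mult_right)
        ultimately show False using AB b by blast
      qed
    qed
  qed
qed

end

section \<open>Quotient graphs\<close>

text \<open>
  The homomorphism from the algebra of a graph onto the algebra of its quotient graph sends \<open>x\<close> to
  \<open>x + x'\<close>. No case distinctions are needed since symbols that are not generators vanish.
\<close>
fun split_gen :: "('v, 'e) gen \<Rightarrow> ('v copy, 'e copy, 'k::field) lpa_poly" where
  "split_gen (Vert v) = vt (Old v) + vt (Primed v)"
| "split_gen (Edge e) = ed (Old e) + ed (Primed e)"
| "split_gen (Ghost e) = gh (Old e) + gh (Primed e)"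

abbreviation split :: "('v, 'e, 'k::field) lpa_poly \<Rightarrow> ('v copy, 'e copy, 'k) lpa_poly" where
  "split \<equiv> subst split_gen"

definition live_arcs :: "('v, 'e) pre_digraph \<Rightarrow> 'v set \<Rightarrow> 'v \<Rightarrow> 'e set" where
  "live_arcs G H v = {e \<in> out_arcs G v. head G e \<notin> H}"

text \<open>For a breaking vertex, \<open>vt v - live_part G H v\<close> is the gap projection
  usually written v^H. The sum is 0 by convention when infinitely many edges are live, which
  explains the finiteness hypotheses in what follows.\<close>

definition live_part :: "('v, 'e) pre_digraph \<Rightarrow> 'v set \<Rightarrow> 'v \<Rightarrow> ('v, 'e, 'k::field) lpa_poly" where
  "live_part G H v = (\<Sum>e \<in> live_arcs G H v. ed e * gh e)"

locale admissible_quotient = wf_digraph G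
  for G :: "('v, 'e) pre_digraph" +
  fixes H S :: "'v set"
  assumes adm: "admissible_pair G H S"
begin

abbreviation "F \<equiv> quotient_graph G H S"
abbreviation "B \<equiv> breaking_vertices G H - S"

lemma hered: "hereditary G H" and satur: "saturated G H" and S_sub: "S \<subseteq> breaking_vertices G H"
  using adm by (auto simp: admissible_pair_def)

lemma breaking_iff: "v \<in> breaking_vertices G H \<longleftrightarrow> v \<in> verts G \<and> v \<notin> H \<and> infinite (out_arcs G v) \<and>
    finite (live_arcs G H v) \<and> live_arcs G H v \<noteq> {}"
  by (auto simp: breaking_vertices_def infinite_emitter_def live_arcs_def)

lemma head_H: "e \<in> arcs G \<Longrightarrow> tail G e \<in> H \<Longrightarrow> head G e \<in> H"
  using hered arc_implies_awalk unfolding hereditary_def path_ge_def by blast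

lemma quotient_simps [simp]:
  "verts F = Old ` (verts G - H) \<union> Primed ` B"
  "arcs F = Old ` {e \<in> arcs G. head G e \<notin> H} \<union> Primed ` {e \<in> arcs G. head G e \<in> B}"
  "tail F (Old e) = Old (tail G e)" "tail F (Primed e) = Old (tail G e)"
  "head F (Old e) = Old (head G e)" "head F (Primed e) = Primed (head G e)"
  by (simp_all add: quotient_graph_def)

lemma wf_quotient: "wf_digraph F"
proof
  fix f assume f: "f \<in> arcs F"
  then obtain e where e: "e \<in> arcs G" "f = Old e \<and> head G e \<notin> H \<or> f = Primed e \<and> head G e \<in> B"
    by auto
  moreover from this have "head G e \<notin> H" by (auto simp: breaking_iff)
  ultimately show "tail F f \<in> verts F" "head F f \<in> verts F"
    using head_H [of e] wellformed [of e] by auto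
qed

lemma out_arcs_quotient:
  "out_arcs F (Old v) = Old ` live_arcs G H v \<union> Primed ` {e \<in> out_arcs G v. head G e \<in> B}"
  "out_arcs F (Primed v) = {}"
  unfolding out_arcs_def live_arcs_def by auto

lemma B_arcs_subset: "{e \<in> out_arcs G v. head G e \<in> B} \<subseteq> live_arcs G H v"
  by (auto simp: live_arcs_def breaking_iff)

text \<open>Primed vertices are sinks, and primed edges duplicate live ones, so only the number of
  live edges counts; breaking vertices thus become regular in their unprimed copy.\<close>

lemma regular_quotient:
  "regular F (Old v) \<longleftrightarrow> v \<in> verts G \<and> v \<notin> H \<and> finite (live_arcs G H v) \<and> live_arcs G H v \<noteq> {}"
  "\<not> regular F (Primed v)"
proof -
  have "finite (out_arcs F (Old v)) \<longleftrightarrow> finite (live_arcs G H v)"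
    using B_arcs_subset [of v] finite_subset
    by (auto simp: out_arcs_quotient finite_image_iff inj_on_def)
  moreover have "out_arcs F (Old v) = {} \<longleftrightarrow> live_arcs G H v = {}"
    using B_arcs_subset [of v] by (auto simp: out_arcs_quotient)
  ultimately show "regular F (Old v) \<longleftrightarrow>
      v \<in> verts G \<and> v \<notin> H \<and> finite (live_arcs G H v) \<and> live_arcs G H v \<noteq> {}"
    by (auto simp: regular_def)
  show "\<not> regular F (Primed v)" by (simp add: regular_def out_arcs_quotient)
qed

lemma regular_live: "regular G v \<Longrightarrow> v \<notin> H \<Longrightarrow> finite (live_arcs G H v) \<and> live_arcs G H v \<noteq> {}"
proof -
  assume v: "regular G v" "v \<notin> H"
  have "live_arcs G H v \<subseteq> out_arcs G v" by (auto simp: live_arcs_def)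
  moreover have "live_arcs G H v \<noteq> {}"
    using v satur unfolding saturated_def by (auto simp: live_arcs_def)
  ultimately show ?thesis using v by (auto simp: regular_def intro: finite_subset)
qed

lemma lid_quotientD:
  assumes "lid F U"
  shows "tideal U" "all_relators F \<subseteq> U"
  using assms by (auto simp: lid_def)

text \<open>Mixed terms vanish because the two copies of an edge have different heads, and edges
  into \<open>H\<close> contribute nothing. The set \<open>Z\<close> is kept flexible: it will be
  all edges at a regular vertex of \<open>G\<close>, but only the live ones at a breaking
  vertex.\<close>

lemma split_sum:
  assumes U: "tideal U" "all_relators F \<subseteq> U" and v: "regular F (Old v)"
    and Z: "finite Z" "live_arcs G H v \<subseteq> Z" "Z \<subseteq> out_arcs G v"
  shows "(\<Sum>e \<in> Z. split (ed e * gh e)) \<simeq>\<^bsub>U\<^esub> vt (Old v)"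
proof -
  note tr [trans] = eqv_trans [OF U(1)]
  let ?Y = "{e \<in> out_arcs G v. head G e \<in> B}"
  have fin: "finite (live_arcs G H v)" "finite ?Y"
    using v B_arcs_subset [of v] by (auto simp: regular_quotient intro: finite_subset)
  have cross: "ed (Old e) * gh (Primed e) \<in> U" "ed (Primed e) * gh (Old e) \<in> U" for e
  proof -
    have "ed (Old e) * vt (Old (head G e)) * gh (Primed e) \<in> U"
      using vt_var_diff [OF U, of "Old (head G e)" "Ghost (Primed e)"]
      by (simp add: mult.assoc tideal_mult_left [OF U(1)])
    then show "ed (Old e) * gh (Primed e) \<in> U"
      using eqv_mem_iff [OF U(1) eqv_mult [OF U(1) ed_head [OF U, of "Old e"] eqv_refl [OF U(1)]]]
      by simp
    have "ed (Primed e) * vt (Primed (head G e)) * gh (Old e) \<in> U"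
      using vt_var_diff [OF U, of "Primed (head G e)" "Ghost (Old e)"]
      by (simp add: mult.assoc tideal_mult_left [OF U(1)])
    then show "ed (Primed e) * gh (Old e) \<in> U"
      using eqv_mem_iff [OF U(1) eqv_mult [OF U(1) ed_head [OF U, of "Primed e"] eqv_refl [OF U(1)]]]
      by simp
  qed
  have "(\<Sum>e \<in> Z. split (ed e * gh e)) \<simeq>\<^bsub>U\<^esub>
      (\<Sum>e \<in> Z. (if e \<in> live_arcs G H v then ed (Old e) * gh (Old e) else 0) +
        (if e \<in> ?Y then ed (Primed e) * gh (Primed e) else 0))"
  proof (rule eqv_sum [OF U(1)])
    fix e assume e: "e \<in> Z"
    have 1: "ed (Old e) * gh (Old e) \<simeq>\<^bsub>U\<^esub> (if e \<in> live_arcs G H v then ed (Old e) * gh (Old e) else 0)"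
    proof (cases "e \<in> live_arcs G H v")
      case False
      then have "Old e \<notin> arcs F" using e Z by (auto simp: live_arcs_def)
      then show ?thesis unfolding if_not_P [OF False] eqv_zero_iff
        by (intro tideal_mult_right [OF U(1)] nongenerator_mem [OF U]) simp
    qed (simp add: eqv_refl [OF U(1)])
    have 2: "ed (Primed e) * gh (Primed e) \<simeq>\<^bsub>U\<^esub> (if e \<in> ?Y then ed (Primed e) * gh (Primed e) else 0)"
    proof (cases "e \<in> ?Y")
      case False
      then have "Primed e \<notin> arcs F" using e Z by auto
      then show ?thesis unfolding if_not_P [OF False] eqv_zero_iff
        by (intro tideal_mult_right [OF U(1)] nongenerator_mem [OF U]) simp
    qed (simp add: eqv_refl [OF U(1)])
    have "split (ed e * gh e) = ed (Old e) * gh (Old e) + ed (Primed e) * gh (Primed e)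
        + (ed (Old e) * gh (Primed e) + ed (Primed e) * gh (Old e))"
      by (simp add: algebra_simps)
    also have "\<dots> \<simeq>\<^bsub>U\<^esub> (if e \<in> live_arcs G H v then ed (Old e) * gh (Old e) else 0) +
        (if e \<in> ?Y then ed (Primed e) * gh (Primed e) else 0) + (0 + 0)"
      using 1 2 cross by (intro eqv_add [OF U(1)]) (simp_all add: eqv_zero_iff)
    finally show "split (ed e * gh e) \<simeq>\<^bsub>U\<^esub> (if e \<in> live_arcs G H v then ed (Old e) * gh (Old e) else 0) +
        (if e \<in> ?Y then ed (Primed e) * gh (Primed e) else 0)" by simp
  qed
  also have "\<dots> = (\<Sum>e \<in> live_arcs G H v. ed (Old e) * gh (Old e)) + (\<Sum>e \<in> ?Y. ed (Primed e) * gh (Primed e))"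
  proof -
    have "?Y \<subseteq> Z" using Z B_arcs_subset by blast
    then have "Z \<inter> live_arcs G H v = live_arcs G H v" "Z \<inter> ?Y = ?Y" using Z by blast+
    then show ?thesis using Z(1) by (simp only: sum.distrib sum.inter_restrict [symmetric])
  qed
  also have "\<dots> = (\<Sum>f \<in> out_arcs F (Old v). ed f * gh f)"
  proof -
    have "Old ` live_arcs G H v \<inter> Primed ` ?Y = {}" by blast
    then show ?thesis
      unfolding out_arcs_quotient using fin
      by (simp only: sum.union_disjoint finite_imageI) (simp add: sum.reindex inj_on_def)
  qed
  also have "\<dots> \<simeq>\<^bsub>U\<^esub> vt (Old v)" by (rule eqv_sym [OF U(1) vt_eqv_sum [OF U v]])
  finally show ?thesis .
qed

text \<open>Checked on relators: a relation splits into an unprimed and a primed copy plus mixed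
  terms that vanish.\<close>

lemma split_lid:
  assumes U: "lid F (U :: ('v copy, 'e copy, 'k::field) lpa_poly set)"
  shows "lid G {p. split p \<in> U}"
  unfolding lid_def
proof (intro conjI)
  note U' = lid_quotientD [OF U]
  note t = U'(1)
  have nongen: "g \<notin> generators F \<Longrightarrow> var g \<in> U" for g by (rule nongenerator_mem [OF U'])
  show "tideal {p. split p \<in> U}"
    using t by (auto simp: tideal_def)
  show "{p. split p \<in> U} \<subseteq> augmentation"
  proof
    fix p :: "('v, 'e, 'k) lpa_poly" assume "p \<in> {p. split p \<in> U}"
    moreover have "Poly_Mapping.lookup (split_gen g) 0 = (0 :: 'k)" for g :: "('v, 'e) gen"
      by (cases g) (simp_all add: lookup_add)
    ultimately show "p \<in> augmentation" using U lookup_zero_subst [of split_gen p]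
      by (auto simp: lid_def augmentation_def)
  qed
  have "split p \<in> U" if "p \<in> lpa_relators G" for p :: "('v, 'e, 'k) lpa_poly"
    using that
  proof (induction rule: lpa_relators.induct)
    case (vertices v w)
    have "vt (Old v) * vt (Primed w) \<in> U" "vt (Primed v) * vt (Old w) \<in> U"
      by (simp_all add: vt_vt_diff [OF U'])
    moreover have "vt (Old v) * vt (Old w) \<simeq>\<^bsub>U\<^esub> (if v = w then vt (Old v) else 0)"
      "vt (Primed v) * vt (Primed w) \<simeq>\<^bsub>U\<^esub> (if v = w then vt (Primed v) else 0)"
      by (auto simp: vt_vt_diff [OF U'] vt_vt_same [OF U'] eqv_zero_iff)
    ultimately have "vt (Old v) * vt (Old w) + vt (Primed v) * vt (Primed w)
        + (vt (Old v) * vt (Primed w) + vt (Primed v) * vt (Old w))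
        \<simeq>\<^bsub>U\<^esub> (if v = w then vt (Old v) else 0) + (if v = w then vt (Primed v) else 0) + (0 + 0)"
      by (intro eqv_add [OF t]) (simp_all add: eqv_zero_iff)
    then show ?case by (auto simp: eqv_def algebra_simps split: if_splits)
  next
    case (source_edge e)
    have "vt (Old (tail G e)) * ed (Old e) + vt (Old (tail G e)) * ed (Primed e)
        + (vt (Primed (tail G e)) * ed (Old e) + vt (Primed (tail G e)) * ed (Primed e))
        \<simeq>\<^bsub>U\<^esub> ed (Old e) + ed (Primed e) + (0 + 0)"
      using tail_ed [OF U', of "Old e"] tail_ed [OF U', of "Primed e"]
      by (intro eqv_add [OF t]) (simp_all add: eqv_zero_iff vt_var_diff [OF U'])
    then show ?case by (simp add: eqv_def algebra_simps)
  next
    case (edge_range e)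
    have "ed (Old e) * vt (Old (head G e)) + ed (Primed e) * vt (Primed (head G e))
        + (ed (Old e) * vt (Primed (head G e)) + ed (Primed e) * vt (Old (head G e)))
        \<simeq>\<^bsub>U\<^esub> ed (Old e) + ed (Primed e) + (0 + 0)"
      using ed_head [OF U', of "Old e"] ed_head [OF U', of "Primed e"]
      by (intro eqv_add [OF t]) (simp_all add: eqv_zero_iff var_vt_diff [OF U'])
    then show ?case by (simp add: eqv_def algebra_simps)
  next
    case (range_ghost e)
    have "vt (Old (head G e)) * gh (Old e) + vt (Primed (head G e)) * gh (Primed e)
        + (vt (Primed (head G e)) * gh (Old e) + vt (Old (head G e)) * gh (Primed e))
        \<simeq>\<^bsub>U\<^esub> gh (Old e) + gh (Primed e) + (0 + 0)"
      using head_gh [OF U', of "Old e"] head_gh [OF U', of "Primed e"]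
      by (intro eqv_add [OF t]) (simp_all add: eqv_zero_iff vt_var_diff [OF U'])
    then show ?case by (simp add: eqv_def algebra_simps)
  next
    case (ghost_source e)
    have "gh (Old e) * vt (Old (tail G e)) + gh (Primed e) * vt (Old (tail G e))
        + (gh (Old e) * vt (Primed (tail G e)) + gh (Primed e) * vt (Primed (tail G e)))
        \<simeq>\<^bsub>U\<^esub> gh (Old e) + gh (Primed e) + (0 + 0)"
      using gh_tail [OF U', of "Old e"] gh_tail [OF U', of "Primed e"]
      by (intro eqv_add [OF t]) (simp_all add: eqv_zero_iff var_vt_diff [OF U'])
    then show ?case by (simp add: eqv_def algebra_simps)
  next
    case (CK1 e f)
    have "gh (Old e) * ed (Old f) \<simeq>\<^bsub>U\<^esub> (if e = f then vt (Old (head G e)) else 0)"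
    proof (cases "e = f \<and> head G e \<in> H")
      case True
      then have "gh (Old e) \<in> U" "vt (Old (head G e)) \<in> U" by (auto intro!: nongen)
      then have "gh (Old e) * ed (Old f) - vt (Old (head G e)) \<in> U"
        by (intro tideal_diff [OF t] tideal_mult_right [OF t])
      then show ?thesis using True by (simp add: eqv_def)
    next
      case False
      then show ?thesis using gh_ed_same [OF U', of "Old e"] gh_ed_diff [OF U', of "Old e" "Old f"] CK1
        by (auto simp: eqv_zero_iff)
    qed
    moreover have "gh (Primed e) * ed (Primed f) \<simeq>\<^bsub>U\<^esub> (if e = f then vt (Primed (head G e)) else 0)"
    proof (cases "e = f \<and> head G e \<notin> B")
      case True
      then have "gh (Primed e) \<in> U" "vt (Primed (head G e)) \<in> U" by (auto intro!: nongen)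
      then have "gh (Primed e) * ed (Primed f) - vt (Primed (head G e)) \<in> U"
        by (intro tideal_diff [OF t] tideal_mult_right [OF t])
      then show ?thesis using True by (simp add: eqv_def)
    next
      case False
      then show ?thesis using gh_ed_same [OF U', of "Primed e"] gh_ed_diff [OF U', of "Primed e" "Primed f"] CK1
        by (auto simp: eqv_zero_iff)
    qed
    ultimately have "gh (Old e) * ed (Old f) + gh (Primed e) * ed (Primed f)
        + (gh (Old e) * ed (Primed f) + gh (Primed e) * ed (Old f))
        \<simeq>\<^bsub>U\<^esub> (if e = f then vt (Old (head G e)) else 0) + (if e = f then vt (Primed (head G e)) else 0) + (0 + 0)"
      by (intro eqv_add [OF t]) (simp_all add: eqv_zero_iff gh_ed_diff [OF U'])
    then show ?case by (auto simp: eqv_def algebra_simps split: if_splits)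
  next
    case (CK2 v)
    \<comment> \<open>A regular vertex emits finitely many edges, so it is not breaking and has no
      primed copy.\<close>
    have p: "vt (Primed v) \<in> U" using CK2 by (intro nongen) (auto simp: breaking_iff regular_def)
    show ?case
    proof (cases "v \<in> H")
      case True
      then have "vt (Old v) \<in> U" by (intro nongen) auto
      moreover have "split (ed e * gh e) \<in> U" if "e \<in> out_arcs G v" for e
      proof -
        have "head G e \<in> H" using head_H that True by auto
        then have "Old e \<notin> arcs F" "Primed e \<notin> arcs F" by (auto simp: breaking_iff)
        then have "ed (Old e) \<in> U" "ed (Primed e) \<in> U"
          using nongen [of "Edge (Old e)"] nongen [of "Edge (Primed e)"] by simp_all
        then show ?thesis by (simp add: tideal_mult_right [OF t] tideal_add [OF t])
      qed
      ultimately have "split (vt v) - (\<Sum>e \<in> out_arcs G v. split (ed e * gh e)) \<in> U"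
        using p by (intro tideal_diff [OF t] tideal_sum [OF t]) (simp_all add: tideal_add [OF t])
      then show ?thesis by simp
    next
      case False
      then have "regular F (Old v)" using CK2 regular_live [of v] unfolding regular_quotient
        by (simp add: regular_def)
      then have "(\<Sum>e \<in> out_arcs G v. split (ed e * gh e)) \<simeq>\<^bsub>U\<^esub> vt (Old v)"
        using CK2 by (intro split_sum U') (auto simp: regular_def live_arcs_def)
      then have "vt (Old v) - (\<Sum>e \<in> out_arcs G v. split (ed e * gh e)) \<in> U"
        using eqv_sym [OF t] eqv_def by blast
      then have "vt (Primed v) + (vt (Old v) - (\<Sum>e \<in> out_arcs G v. split (ed e * gh e))) \<in> U"
        using p by (intro tideal_add [OF t])
      then show ?thesis by (simp add: algebra_simps)
    qed
  qed
  moreover have "split (var g) \<in> U" if "g \<notin> generators G" for g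
    using that
  proof (cases g)
    case (Vert v)
    then have "Vert (Old v) \<notin> generators F" "Vert (Primed v) \<notin> generators F"
      using that by (auto simp: breaking_iff)
    from this [THEN nongen] show ?thesis by (simp add: Vert tideal_add [OF t])
  next
    case (Edge e)
    then have "Edge (Old e) \<notin> generators F" "Edge (Primed e) \<notin> generators F"
      using that by (auto simp: breaking_iff)
    from this [THEN nongen] show ?thesis by (simp add: Edge tideal_add [OF t])
  next
    case (Ghost e)
    then have "Ghost (Old e) \<notin> generators F" "Ghost (Primed e) \<notin> generators F"
      using that by (auto simp: breaking_iff)
    from this [THEN nongen] show ?thesis by (simp add: Ghost tideal_add [OF t])
  qed
  ultimately show "all_relators G \<subseteq> {p. split p \<in> U}" by (auto simp: all_relators_def)
qed

end

section \<open>The inverse substitution, from the quotient graph back to the graph\<close>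

primrec un_copy :: "'a copy \<Rightarrow> 'a" where
  "un_copy (Old x) = x"
| "un_copy (Primed x) = x"

context admissible_quotient
begin

text \<open>The orthogonal idempotents \<open>v\<close> and \<open>v'\<close> of the quotient, lifted to the algebra of the graph.\<close>

primrec copy_el :: "'v copy \<Rightarrow> ('v, 'e, 'k::field) lpa_poly" where
  "copy_el (Old v) = (if v \<in> B then live_part G H v else vt v)"
| "copy_el (Primed v) = (if v \<in> B then vt v - live_part G H v else 0)"

text \<open>An edge of the quotient graph lifts to the original edge cut down by the idempotent that
  lifts its head; at the tail the edge already absorbs the right idempotent, by
  \<open>copy_el_tail_ed\<close>.\<close>

primrec merge_gen :: "('v copy, 'e copy) gen \<Rightarrow> ('v, 'e, 'k::field) lpa_poly" where
  "merge_gen (Vert x) = copy_el x"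
| "merge_gen (Edge f) = ed (un_copy f) * copy_el (head F f)"
| "merge_gen (Ghost f) = copy_el (head F f) * gh (un_copy f)"

abbreviation merge :: "('v copy, 'e copy, 'k::field) lpa_poly \<Rightarrow> ('v, 'e, 'k) lpa_poly" where
  "merge \<equiv> subst merge_gen"

lemma copy_el_add: "copy_el (Old v) + copy_el (Primed v) = vt v"
  by simp

lemma un_copy_head [simp]: "un_copy (head F f) = head G (un_copy f)"
  and tail_un_copy: "tail F f = Old (tail G (un_copy f))"
  by (cases f; simp)+

lemma copy_el_augmentation: "copy_el x \<in> augmentation"
  by (cases x) (auto simp: live_part_def
      intro!: tideal_sum [OF tideal_augmentation] tideal_mult_left [OF tideal_augmentation]
        tideal_diff [OF tideal_augmentation] tideal_zero [OF tideal_augmentation])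

lemma lookup_merge: "Poly_Mapping.lookup (merge p) 0 = Poly_Mapping.lookup p 0"
proof (rule lookup_zero_subst)
  show "Poly_Mapping.lookup (merge_gen g) 0 = 0" for g
    using copy_el_augmentation
    by (cases g) (auto simp: lookup_zero_mult augmentation_def simp del: copy_el.simps)
qed

context
  fixes U :: "('v, 'e, 'k::field) lpa_poly set"
  assumes U: "tideal U" "all_relators G \<subseteq> U"
begin

private abbreviation cong (infix "\<approx>" 50) where "a \<approx> b \<equiv> a \<simeq>\<^bsub>U\<^esub> b"

private lemmas rf = eqv_refl [OF U(1)] and sy = eqv_sym [OF U(1)] and tr [trans] = eqv_trans [OF U(1)]
  and cadd = eqv_add [OF U(1)] and cmul = eqv_mult [OF U(1)] and cdiff = eqv_diff [OF U(1)]
  and csum = eqv_sum [OF U(1)] and mem_iff = eqv_mem_iff [OF U(1)]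
  and mem_left = tideal_mult_left [OF U(1)] and mem_right = tideal_mult_right [OF U(1)]

private lemma cl: "a \<approx> b \<Longrightarrow> x * a \<approx> x * b" by (rule cmul [OF rf])
private lemma cr: "a \<approx> b \<Longrightarrow> a * x \<approx> b * x" by (rule cmul [OF _ rf])

lemma vt_live_part: "vt v * live_part G H v \<approx> live_part G H v"
  unfolding live_part_def sum_distrib_left
proof (rule csum)
  fix e assume "e \<in> live_arcs G H v"
  then have "v = tail G e" by (auto simp: live_arcs_def)
  then show "vt v * (ed e * gh e) \<approx> ed e * gh e"
    using cr [OF tail_ed [OF U, of e], of "gh e"] by (simp add: mult.assoc)
qed

lemma live_part_vt: "live_part G H v * vt v \<approx> live_part G H v"
  unfolding live_part_def sum_distrib_right
proof (rule csum)
  fix e assume "e \<in> live_arcs G H v"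
  then have "v = tail G e" by (auto simp: live_arcs_def)
  then show "ed e * gh e * vt v \<approx> ed e * gh e"
    using cl [OF gh_tail [OF U, of e], of "ed e"] by (simp add: mult.assoc)
qed

lemma live_part_ed:
  assumes "finite (live_arcs G H v)" "e \<in> live_arcs G H v"
  shows "live_part G H v * ed e \<approx> ed e"
proof -
  have "live_part G H v * ed e = (\<Sum>f \<in> live_arcs G H v. ed f * (gh f * ed e))"
    by (simp add: live_part_def sum_distrib_right mult.assoc)
  also have "\<dots> \<approx> (\<Sum>f \<in> live_arcs G H v. if f = e then ed e else 0)"
  proof (rule csum)
    fix f
    show "ed f * (gh f * ed e) \<approx> (if f = e then ed e else 0)"
    proof (cases "f = e")
      case True
      have "e \<in> arcs G" using assms by (auto simp: live_arcs_def)
      then show ?thesis using True tr [OF cl [OF gh_ed_same [OF U]] ed_head [OF U]] by simp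
    next
      case False
      then show ?thesis by (simp add: eqv_zero_iff mem_left gh_ed_diff [OF U])
    qed
  qed
  finally show ?thesis using assms by (simp add: sum.delta)
qed

lemma gh_live_part:
  assumes "finite (live_arcs G H v)" "e \<in> live_arcs G H v"
  shows "gh e * live_part G H v \<approx> gh e"
proof -
  have "gh e * live_part G H v = (\<Sum>f \<in> live_arcs G H v. gh e * ed f * gh f)"
    by (simp add: live_part_def sum_distrib_left mult.assoc)
  also have "\<dots> \<approx> (\<Sum>f \<in> live_arcs G H v. if f = e then gh e else 0)"
  proof (rule csum)
    fix f
    show "gh e * ed f * gh f \<approx> (if f = e then gh e else 0)"
    proof (cases "f = e")
      case True
      have "e \<in> arcs G" using assms by (auto simp: live_arcs_def)
      then show ?thesis using True tr [OF cr [OF gh_ed_same [OF U]] head_gh [OF U]] by simp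
    next
      case False
      then show ?thesis by (simp add: eqv_zero_iff mem_right gh_ed_diff [OF U])
    qed
  qed
  finally show ?thesis using assms by (simp add: sum.delta)
qed

lemma live_part_idem:
  assumes "finite (live_arcs G H v)"
  shows "live_part G H v * live_part G H v \<approx> live_part G H v"
proof -
  have "live_part G H v * live_part G H v = (\<Sum>e \<in> live_arcs G H v. live_part G H v * ed e * gh e)"
    by (subst (2) live_part_def) (simp add: sum_distrib_left mult.assoc)
  also have "\<dots> \<approx> (\<Sum>e \<in> live_arcs G H v. ed e * gh e)"
    using assms by (intro csum cr live_part_ed)
  finally show ?thesis by (simp add: live_part_def)
qed

lemma gap_idem:
  assumes "finite (live_arcs G H v)"
  shows "(vt v - live_part G H v) * (vt v - live_part G H v) \<approx> vt v - live_part G H v"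
proof -
  let ?q = "live_part G H v :: ('v, 'e, 'k) lpa_poly"
  have "vt v * vt v - ?q * vt v - (vt v * ?q - ?q * ?q) \<approx> vt v - ?q - (?q - ?q)"
    by (intro cdiff vt_vt_same [OF U] live_part_vt vt_live_part live_part_idem assms)
  then show ?thesis by (simp add: algebra_simps)
qed

lemma vt_copy_el: "vt (un_copy x) * copy_el x \<approx> copy_el x"
  using vt_live_part vt_vt_same [OF U] cdiff [OF vt_vt_same [OF U] vt_live_part]
  by (cases x) (auto simp: rf right_diff_distrib)

lemma copy_el_vt: "copy_el x * vt (un_copy x) \<approx> copy_el x"
  using live_part_vt vt_vt_same [OF U] cdiff [OF vt_vt_same [OF U] live_part_vt]
  by (cases x) (auto simp: rf left_diff_distrib)

lemma copy_el_idem: "copy_el x * copy_el x \<approx> copy_el x"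
  using vt_vt_same [OF U] live_part_idem gap_idem
  by (cases x) (auto simp: rf breaking_iff)

lemma copy_el_orth: "x \<noteq> y \<Longrightarrow> copy_el x * copy_el y \<in> U"
proof -
  assume xy: "x \<noteq> y"
  show ?thesis
  proof (cases "un_copy x = un_copy y")
    case True
    let ?q = "\<lambda>v. live_part G H v :: ('v, 'e, 'k) lpa_poly"
    have "?q v * (vt v - ?q v) \<in> U" "(vt v - ?q v) * ?q v \<in> U" if "v \<in> B" for v
    proof -
      have "finite (live_arcs G H v)" using that by (auto simp: breaking_iff)
      then have i: "?q v * ?q v \<approx> ?q v" by (rule live_part_idem)
      have "?q v * vt v - ?q v * ?q v \<approx> ?q v - ?q v" "vt v * ?q v - ?q v * ?q v \<approx> ?q v - ?q v"
        by (rule cdiff [OF live_part_vt i], rule cdiff [OF vt_live_part i])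
      then show "?q v * (vt v - ?q v) \<in> U" "(vt v - ?q v) * ?q v \<in> U"
        by (simp_all add: eqv_zero_iff right_diff_distrib left_diff_distrib)
    qed
    then show ?thesis using True xy by (cases x; cases y) (auto simp: tideal_zero [OF U(1)])
  next
    case False
    have "copy_el x * (vt (un_copy x) * vt (un_copy y)) * copy_el y \<in> U"
      using False by (intro mem_right mem_left vt_vt_diff [OF U])
    then have "copy_el x * vt (un_copy x) * (vt (un_copy y) * copy_el y) \<in> U"
      by (simp only: mult.assoc)
    then show ?thesis using mem_iff [OF cmul [OF copy_el_vt vt_copy_el]] by blast
  qed
qed

text \<open>A live edge is absorbed by \<open>live_part\<close>, the unprimed half of a breaking
  tail. This matches the convention that all edges of the quotient graph start at unprimed
  vertices.\<close>

lemma copy_el_tail_ed: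
  assumes "e \<in> arcs G" "head G e \<notin> H"
  shows "copy_el (Old (tail G e)) * ed e \<approx> ed e" and "gh e * copy_el (Old (tail G e)) \<approx> gh e"
  using assms live_part_ed gh_live_part tail_ed [OF U] gh_tail [OF U]
  by (auto simp: breaking_iff live_arcs_def)

end

text \<open>The vertices of \<open>H\<close> in \<open>I\<close> take care of symbols missing from
  the quotient graph and of edges into \<open>H\<close>; the gap projections in \<open>I\<close>
  give the second Cuntz-Krieger relation at the vertices of \<open>S\<close>.\<close>

lemma merge_lid:
  assumes I: "lid G (I :: ('v, 'e, 'k::field) lpa_poly set)"
    and H: "\<And>v. v \<in> H \<Longrightarrow> vt v \<in> I" and S: "\<And>v. v \<in> S \<Longrightarrow> vt v - live_part G H v \<in> I"
  shows "lid F {p. merge p \<in> I}"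
  unfolding lid_def
proof (intro conjI)
  have U: "tideal I" "all_relators G \<subseteq> I" using I by (auto simp: lid_def)
  note t = U(1)
  note rf = eqv_refl [OF t] and sy = eqv_sym [OF t] and tr [trans] = eqv_trans [OF t]
  note cl = eqv_mult [OF t rf] and cr = eqv_mult [OF t _ rf]
  show "tideal {p. merge p \<in> I}" using t by (auto simp: tideal_def)
  show "{p. merge p \<in> I} \<subseteq> augmentation"
    using I by (auto simp: lid_def augmentation_def lookup_merge)
  have nongen_vt: "copy_el x \<in> I" if "x \<notin> verts F" for x
  proof (cases x)
    case (Old v)
    then have "v \<in> H \<or> v \<notin> verts G" "v \<notin> B" using that by (auto simp: breaking_iff)
    then show ?thesis using H nongenerator_mem [OF U, of "Vert v"] by (auto simp: Old)
  next
    case (Primed v)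
    then show ?thesis using that by (auto simp: tideal_zero [OF t])
  qed
  have nongen_ed: "un_copy f \<notin> arcs G \<or> head F f \<notin> verts F" if "f \<notin> arcs F" for f
    using that by (cases f) auto
  have arcD: "un_copy f \<in> arcs G" "head G (un_copy f) \<notin> H" if "f \<in> arcs F" for f
    using that by (auto simp: breaking_iff)
  have "merge p \<in> I" if "p \<in> lpa_relators F" for p :: "('v copy, 'e copy, 'k) lpa_poly"
    using that
  proof (induction rule: lpa_relators.induct)
    case (vertices x y)
    then show ?case
      using copy_el_idem [OF U, of x] copy_el_orth [OF U, of x y]
      by (cases "x = y") (simp_all add: eqv_def del: copy_el.simps)
  next
    case (source_edge f)
    have "copy_el (Old (tail G (un_copy f))) * ed (un_copy f) * copy_el (head F f) \<simeq>\<^bsub>I\<^esub>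
        ed (un_copy f) * copy_el (head F f)"
      by (intro cr copy_el_tail_ed U arcD source_edge)
    then show ?case by (simp add: eqv_def tail_un_copy mult.assoc del: copy_el.simps)
  next
    case (edge_range f)
    have "ed (un_copy f) * (copy_el (head F f) * copy_el (head F f)) \<simeq>\<^bsub>I\<^esub>
        ed (un_copy f) * copy_el (head F f)"
      by (intro cl copy_el_idem U)
    then show ?case by (simp add: eqv_def mult.assoc del: copy_el.simps)
  next
    case (range_ghost f)
    have "copy_el (head F f) * copy_el (head F f) * gh (un_copy f) \<simeq>\<^bsub>I\<^esub>
        copy_el (head F f) * gh (un_copy f)"
      by (intro cr copy_el_idem U)
    then show ?case by (simp add: eqv_def mult.assoc del: copy_el.simps)
  next
    case (ghost_source f)
    have "copy_el (head F f) * (gh (un_copy f) * copy_el (Old (tail G (un_copy f)))) \<simeq>\<^bsub>I\<^esub>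
        copy_el (head F f) * gh (un_copy f)"
      by (intro cl copy_el_tail_ed U arcD ghost_source)
    then show ?case by (simp add: eqv_def tail_un_copy mult.assoc del: copy_el.simps)
  next
    case (CK1 f f')
    let ?x = "head F f" and ?y = "head F f'"
    have *: "copy_el ?x * (gh (un_copy f) * ed (un_copy f')) * copy_el ?y \<simeq>\<^bsub>I\<^esub>
        (if f = f' then copy_el ?x else 0)"
    proof (cases "un_copy f = un_copy f'")
      case True
      have "copy_el ?x * (gh (un_copy f) * ed (un_copy f')) * copy_el ?y \<simeq>\<^bsub>I\<^esub>
          copy_el ?x * vt (un_copy ?x) * copy_el ?y"
        unfolding un_copy_head True [symmetric] by (intro cr cl gh_ed_same U arcD CK1)
      also have "\<dots> \<simeq>\<^bsub>I\<^esub> copy_el ?x * copy_el ?y" by (intro cr copy_el_vt U)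
      also have "\<dots> \<simeq>\<^bsub>I\<^esub> (if f = f' then copy_el ?x else 0)"
      proof (cases "f = f'")
        case True
        then show ?thesis using copy_el_idem [OF U] by simp
      next
        case False
        then have "?x \<noteq> ?y" using \<open>un_copy f = un_copy f'\<close> by (cases f; cases f') auto
        then show ?thesis using False copy_el_orth [OF U] by (simp add: eqv_zero_iff del: copy_el.simps)
      qed
      finally show ?thesis .
    next
      case False
      then have "copy_el ?x * (gh (un_copy f) * ed (un_copy f')) * copy_el ?y \<in> I"
        by (intro tideal_mult_right [OF t] tideal_mult_left [OF t] gh_ed_diff [OF U])
      then show ?thesis using False by (auto simp: eqv_zero_iff)
    qed
    then show ?case by (auto simp: eqv_def mult.assoc simp del: copy_el.simps)
  next
    case (CK2 x)
    then obtain v where x: "x = Old v" using regular_quotient(2) by (cases x) auto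
    have v: "v \<in> verts G" "v \<notin> H" "finite (live_arcs G H v)" "live_arcs G H v \<noteq> {}"
      using CK2 by (auto simp: x regular_quotient)
    let ?Y = "{e \<in> out_arcs G v. head G e \<in> B}"
    have Y: "finite ?Y" "?Y \<subseteq> live_arcs G H v" using v B_arcs_subset [of v] by (auto intro: finite_subset)
    let ?t = "\<lambda>f. ed (un_copy f) * (copy_el (head F f) * copy_el (head F f)) * gh (un_copy f)"
    \<comment> \<open>For \<open>v\<close> in \<open>B\<close> this is the definition, for
      \<open>v\<close> in \<open>S\<close> the gap projection lies in \<open>I\<close>, and for a
      regular vertex of \<open>G\<close> the edges into \<open>H\<close> vanish modulo
      \<open>I\<close>.\<close>
    have live: "copy_el (Old v) \<simeq>\<^bsub>I\<^esub> live_part G H v"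
    proof (cases "v \<in> B")
      case False
      show ?thesis
      proof (cases "infinite (out_arcs G v)")
        case True
        then have "v \<in> S" using False v by (auto simp: breaking_iff)
        then show ?thesis using S False by (simp add: eqv_def)
      next
        case fin: False
        have sub: "live_arcs G H v \<subseteq> out_arcs G v" by (auto simp: live_arcs_def)
        then have "regular G v" using fin v by (auto simp: regular_def)
        then have "vt v \<simeq>\<^bsub>I\<^esub> (\<Sum>e \<in> out_arcs G v. ed e * gh e)" by (rule vt_eqv_sum [OF U])
        also have "\<dots> = (\<Sum>e \<in> out_arcs G v - live_arcs G H v. ed e * gh e) + live_part G H v"
          unfolding live_part_def using sub fin by (intro sum.subset_diff) auto
        also have "\<dots> \<simeq>\<^bsub>I\<^esub> 0 + live_part G H v"
        proof (intro eqv_add [OF t] rf, unfold eqv_zero_iff, rule tideal_sum [OF t])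
          fix e assume "e \<in> out_arcs G v - live_arcs G H v"
          then have "vt (head G e) \<in> I" by (intro H) (auto simp: live_arcs_def)
          then have "ed e * vt (head G e) * gh e \<in> I"
            by (intro tideal_mult_right [OF t] tideal_mult_left [OF t])
          then show "ed e * gh e \<in> I" using eqv_mem_iff [OF t cr [OF ed_head [OF U]]] by blast
        qed
        finally show ?thesis unfolding copy_el.simps if_not_P [OF False] by simp
      qed
    qed (simp add: rf)
    have "(\<Sum>f \<in> out_arcs F x. ?t f) \<simeq>\<^bsub>I\<^esub>
        (\<Sum>f \<in> out_arcs F x. ed (un_copy f) * copy_el (head F f) * gh (un_copy f))"
      by (intro eqv_sum [OF t] cr cl copy_el_idem U)
    also have "\<dots> = (\<Sum>e \<in> live_arcs G H v. ed e * copy_el (Old (head G e)) * gh e)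
        + (\<Sum>e \<in> ?Y. ed e * copy_el (Primed (head G e)) * gh e)"
    proof -
      have "Old ` live_arcs G H v \<inter> Primed ` ?Y = {}" by blast
      then show ?thesis
        unfolding x out_arcs_quotient using v Y
        by (simp only: sum.union_disjoint finite_imageI)
          (simp add: sum.reindex inj_on_def del: copy_el.simps)
    qed
    \<comment> \<open>\<open>copy_el\<close> is 0 on primed symbols outside \<open>B\<close>, so
      both sums can run over all live edges, and the two halves of each head add up to the
      vertex.\<close>
    also have "(\<Sum>e \<in> ?Y. ed e * copy_el (Primed (head G e)) * gh e) =
        (\<Sum>e \<in> live_arcs G H v. ed e * copy_el (Primed (head G e)) * gh e)"
      using v Y by (intro sum.mono_neutral_left) (auto simp: live_arcs_def)
    also have "(\<Sum>e \<in> live_arcs G H v. ed e * copy_el (Old (head G e)) * gh e) + \<dots> =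
        (\<Sum>e \<in> live_arcs G H v. ed e * vt (head G e) * gh e)"
      unfolding copy_el_add [symmetric] distrib_left distrib_right sum.distrib ..
    also have "\<dots> \<simeq>\<^bsub>I\<^esub> live_part G H v"
      unfolding live_part_def by (intro eqv_sum [OF t] cr ed_head U)
    also have "\<dots> \<simeq>\<^bsub>I\<^esub> copy_el x" unfolding x by (rule sy [OF live])
    finally have "copy_el x \<simeq>\<^bsub>I\<^esub> (\<Sum>f \<in> out_arcs F x. ?t f)" by (rule sy)
    then show ?case by (simp add: eqv_def mult.assoc del: copy_el.simps)
  qed
  moreover have "merge (var g) \<in> I" if "g \<notin> generators F" for g
    using that nongen_vt nongen_ed
  proof (cases g)
    case (Vert x)
    then show ?thesis using that nongen_vt [of x] by (simp del: copy_el.simps quotient_simps)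
  next
    case (Edge f)
    then have "un_copy f \<notin> arcs G \<or> head F f \<notin> verts F" using that nongen_ed by simp
    then show ?thesis
      using nongen_vt [of "head F f"] nongenerator_mem [OF U, of "Edge (un_copy f)"]
      by (auto simp: Edge tideal_mult_left [OF t] tideal_mult_right [OF t] simp del: copy_el.simps quotient_simps)
  next
    case (Ghost f)
    then have "un_copy f \<notin> arcs G \<or> head F f \<notin> verts F" using that nongen_ed by simp
    then show ?thesis
      using nongen_vt [of "head F f"] nongenerator_mem [OF U, of "Ghost (un_copy f)"]
      by (auto simp: Ghost tideal_mult_left [OF t] tideal_mult_right [OF t] simp del: copy_el.simps quotient_simps)
  qed
  ultimately show "all_relators F \<subseteq> {p. merge p \<in> I}" by (auto simp: all_relators_def)
qed

lemma merge_split: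
  assumes U: "tideal U" "all_relators G \<subseteq> U"
  shows "merge (split p) \<simeq>\<^bsub>U\<^esub> p"
proof -
  have gen: "merge (split_gen g) \<simeq>\<^bsub>U\<^esub> var g" for g
  proof (cases g)
    case (Edge e)
    have "ed e * (copy_el (Old (head G e)) + copy_el (Primed (head G e))) \<simeq>\<^bsub>U\<^esub> ed e"
      unfolding copy_el_add by (rule ed_head [OF U])
    then show ?thesis by (simp add: Edge distrib_left del: copy_el.simps)
  next
    case (Ghost e)
    have "(copy_el (Old (head G e)) + copy_el (Primed (head G e))) * gh e \<simeq>\<^bsub>U\<^esub> gh e"
      unfolding copy_el_add by (rule head_gh [OF U])
    then show ?thesis by (simp add: Ghost distrib_right del: copy_el.simps)
  qed (simp add: eqv_refl [OF U(1)])
  show ?thesis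
    by (induction p rule: gen_poly_induct)
      (simp_all add: eqv_refl [OF U(1)] eqv_add [OF U(1)] eqv_mult [OF U(1) gen])
qed

lemma split_copy_el:
  assumes U: "tideal U" "all_relators F \<subseteq> U"
  shows "split (copy_el x) \<simeq>\<^bsub>U\<^esub> vt x"
proof -
  have live: "split (live_part G H v) \<simeq>\<^bsub>U\<^esub> vt (Old v)" if "v \<in> B" for v
    unfolding live_part_def subst_sum using that
    by (intro split_sum U) (auto simp: regular_quotient breaking_iff live_arcs_def)
  have dead: "vt (Primed v) \<in> U" if "v \<notin> B" for v
    using that nongenerator_mem [OF U, of "Vert (Primed v)"] by auto
  show ?thesis
  proof (cases x)
    case (Old v)
    show ?thesis using live [of v] dead [of v] by (auto simp: Old eqv_def)
  next
    case (Primed v)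
    have "vt (Old v) + vt (Primed v) - split (live_part G H v) \<simeq>\<^bsub>U\<^esub> vt (Old v) + vt (Primed v) - vt (Old v)"
      if "v \<in> B"
      by (intro eqv_diff [OF U(1)] eqv_refl [OF U(1)] live that)
    then show ?thesis using dead [of v] tideal_uminus [OF U(1), of "vt (Primed v)"]
      by (auto simp: Primed eqv_def)
  qed
qed

lemma split_merge:
  assumes U: "tideal U" "all_relators F \<subseteq> U"
  shows "split (merge p) \<simeq>\<^bsub>U\<^esub> p"
proof -
  note t = U(1)
  note tr [trans] = eqv_trans [OF t]
  have gen: "split (merge_gen g) \<simeq>\<^bsub>U\<^esub> var g" for g
  proof (cases g)
    case (Vert x)
    then show ?thesis using split_copy_el [OF U] by simp
  next
    case (Edge f)
    have "split (ed (un_copy f)) * split (copy_el (head F f)) \<simeq>\<^bsub>U\<^esub> split (ed (un_copy f)) * vt (head F f)"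
      by (intro eqv_mult [OF t] eqv_refl [OF t] split_copy_el U)
    also have "\<dots> \<simeq>\<^bsub>U\<^esub> ed f"
    proof (cases f)
      case (Old e)
      have "ed (Old e) * vt (head F f) + ed (Primed e) * vt (head F f) \<simeq>\<^bsub>U\<^esub> ed f + 0"
        using ed_head [OF U, of f] var_vt_diff [OF U, of "head F f" "Edge (Primed e)"]
        by (intro eqv_add [OF t]) (simp_all add: Old eqv_zero_iff)
      then show ?thesis by (simp add: Old distrib_right)
    next
      case (Primed e)
      have "ed (Old e) * vt (head F f) + ed (Primed e) * vt (head F f) \<simeq>\<^bsub>U\<^esub> 0 + ed f"
        using ed_head [OF U, of f] var_vt_diff [OF U, of "head F f" "Edge (Old e)"]
        by (intro eqv_add [OF t]) (simp_all add: Primed eqv_zero_iff)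
      then show ?thesis by (simp add: Primed distrib_right)
    qed
    finally show ?thesis by (simp add: Edge del: copy_el.simps)
  next
    case (Ghost f)
    have "split (copy_el (head F f)) * split (gh (un_copy f)) \<simeq>\<^bsub>U\<^esub> vt (head F f) * split (gh (un_copy f))"
      by (intro eqv_mult [OF t] eqv_refl [OF t] split_copy_el U)
    also have "\<dots> \<simeq>\<^bsub>U\<^esub> gh f"
    proof (cases f)
      case (Old e)
      have "vt (head F f) * gh (Old e) + vt (head F f) * gh (Primed e) \<simeq>\<^bsub>U\<^esub> gh f + 0"
        using head_gh [OF U, of f] vt_var_diff [OF U, of "head F f" "Ghost (Primed e)"]
        by (intro eqv_add [OF t]) (simp_all add: Old eqv_zero_iff)
      then show ?thesis by (simp add: Old distrib_left)
    next
      case (Primed e)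
      have "vt (head F f) * gh (Old e) + vt (head F f) * gh (Primed e) \<simeq>\<^bsub>U\<^esub> 0 + gh f"
        using head_gh [OF U, of f] vt_var_diff [OF U, of "head F f" "Ghost (Old e)"]
        by (intro eqv_add [OF t]) (simp_all add: Primed eqv_zero_iff)
      then show ?thesis by (simp add: Primed distrib_left)
    qed
    finally show ?thesis by (simp add: Ghost del: copy_el.simps)
  qed
  show ?thesis
    by (induction p rule: gen_poly_induct)
      (simp_all add: eqv_refl [OF t] eqv_add [OF t] eqv_mult [OF t gen])
qed

end

section \<open>Ideals and admissible pairs\<close>

definition ci_meet :: "('v, 'e) pre_digraph \<Rightarrow> ('v, 'e, 'k::field) lpa_poly set \<Rightarrow> bool" where
  "ci_meet G I \<longleftrightarrow> (\<exists>\<J>. finite \<J> \<and> \<J> \<noteq> {} \<and> (\<forall>J \<in> \<J>. lid_ci G J) \<and> I = \<Inter>\<J>)"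

lemma lid_ciD:
  assumes "lid_ci G U" "\<J> \<noteq> {}" "\<And>J. J \<in> \<J> \<Longrightarrow> lid G J" "\<And>J. J \<in> \<J> \<Longrightarrow> U \<subset> J"
  shows "U \<noteq> \<Inter>\<J>"
proof
  assume "U = \<Inter>\<J>"
  then have "\<exists>\<J>. \<J> \<noteq> {} \<and> (\<forall>J \<in> \<J>. lid G J \<and> U \<subset> J) \<and> U = \<Inter>\<J>"
    using assms(2-4) by (intro exI [of _ \<J>]) simp
  then show False using assms(1) by (simp only: lid_ci_def simp_thms)
qed

section \<open>Correspondence of ideals over the quotient graph with ideals above the kernel\<close>

context admissible_quotient
begin

definition pull :: "('v copy, 'e copy, 'k::field) lpa_poly set \<Rightarrow> ('v, 'e, 'k) lpa_poly set" where
  "pull U = {p. split p \<in> U}"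

definition push :: "('v, 'e, 'k::field) lpa_poly set \<Rightarrow> ('v copy, 'e copy, 'k) lpa_poly set" where
  "push I = {p. merge p \<in> I}"

definition kernel :: "('v, 'e, 'k::field) lpa_poly set" where
  "kernel = pull (null_ideal F)"

lemma lid_pull: "lid F U \<Longrightarrow> lid G (pull U)"
  unfolding pull_def by (rule split_lid)

lemma lid_kernel: "lid G kernel"
  unfolding kernel_def by (rule lid_pull [OF lid_null_ideal])

lemma kernel_subset_pull: "lid F U \<Longrightarrow> kernel \<subseteq> pull U"
  using null_ideal_subset by (auto simp: kernel_def pull_def)

lemma vt_kernel:
  assumes "v \<in> H"
  shows "vt v \<in> (kernel :: ('v, 'e, 'k::field) lpa_poly set)"
proof -
  let ?N = "null_ideal F :: ('v copy, 'e copy, 'k) lpa_poly set"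
  have "vt (Old v) \<in> ?N" "vt (Primed v) \<in> ?N"
    using assms by (auto intro!: nongenerator_mem [OF tideal_null_ideal null_ideal_relators] simp: breaking_iff)
  then have "vt (Old v) + vt (Primed v) \<in> ?N" by (rule tideal_add [OF tideal_null_ideal])
  then show ?thesis by (simp add: kernel_def pull_def)
qed

lemma gap_kernel:
  assumes v: "v \<in> S"
  shows "vt v - live_part G H v \<in> (kernel :: ('v, 'e, 'k::field) lpa_poly set)"
proof -
  let ?N = "null_ideal F :: ('v copy, 'e copy, 'k) lpa_poly set"
  have reg: "regular F (Old v)" and fin: "finite (live_arcs G H v)"
    using v S_sub by (auto simp: breaking_iff regular_quotient subset_eq)
  have "vt (Primed v) \<simeq>\<^bsub>?N\<^esub> 0"
    unfolding eqv_zero_iff using v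
    by (intro nongenerator_mem [OF tideal_null_ideal null_ideal_relators]) auto
  moreover have "split (live_part G H v) \<simeq>\<^bsub>?N\<^esub> vt (Old v)"
    unfolding live_part_def subst_sum using fin
    by (intro split_sum tideal_null_ideal null_ideal_relators reg) (auto simp: live_arcs_def)
  ultimately have "vt (Old v) + vt (Primed v) - split (live_part G H v)
      \<simeq>\<^bsub>?N\<^esub> vt (Old v) + 0 - vt (Old v)"
    by (intro eqv_diff eqv_add eqv_refl tideal_null_ideal)
  then show ?thesis by (simp add: kernel_def pull_def eqv_zero_iff)
qed

lemma lid_push: "lid G I \<Longrightarrow> kernel \<subseteq> I \<Longrightarrow> lid F (push I)"
  unfolding push_def using vt_kernel gap_kernel by (intro merge_lid) auto

lemma push_pull: "lid F U \<Longrightarrow> push (pull U) = U"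
  using eqv_mem_iff [OF _ split_merge, of U] by (auto simp: push_def pull_def lid_def)

lemma pull_push: "lid G I \<Longrightarrow> pull (push I) = I"
  using eqv_mem_iff [OF _ merge_split, of I] by (auto simp: push_def pull_def lid_def)

lemma push_augmentation: "push augmentation = augmentation"
  by (auto simp: push_def augmentation_def lookup_merge)

lemma pull_augmentation: "pull augmentation = augmentation"
  using pull_push [OF lid_augmentation] by (simp add: push_augmentation)

lemma pull_Inter: "\<J> \<noteq> {} \<Longrightarrow> pull (\<Inter>\<J>) = \<Inter>(pull ` \<J>)"
  and push_Inter: "\<I> \<noteq> {} \<Longrightarrow> push (\<Inter>\<I>) = \<Inter>(push ` \<I>)"
  by (auto simp: pull_def push_def)

lemma pull_psubset: "lid F U \<Longrightarrow> lid F V \<Longrightarrow> U \<subset> V \<Longrightarrow> pull U \<subset> pull V"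
proof (rule psubsetI)
  assume "lid F U" "lid F V" "U \<subset> V"
  then show "pull U \<noteq> pull V" by (metis push_pull psubset_eq)
qed (auto simp: pull_def)

lemma push_psubset: "lid G I \<Longrightarrow> lid G J \<Longrightarrow> I \<subset> J \<Longrightarrow> push I \<subset> push J"
proof (rule psubsetI)
  assume "lid G I" "lid G J" "I \<subset> J"
  then show "push I \<noteq> push J" by (metis pull_push psubset_eq)
qed (auto simp: push_def)

text \<open>\<open>pull\<close> and \<open>push\<close> are mutually inverse, preserve strict
  inclusion and commute with nonempty intersections; every ideal above \<open>pull U\<close>
  contains the kernel and so comes from the quotient graph.\<close>

lemma lid_ci_pull:
  assumes U: "lid F U"
  shows "lid_ci G (pull U) \<longleftrightarrow> lid_ci F U"
proof
  assume ci: "lid_ci F U"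
  show "lid_ci G (pull U)"
    unfolding lid_ci_def
  proof (intro conjI notI)
    show "lid G (pull U)" by (rule lid_pull [OF U])
    show False if "pull U = augmentation"
      using that ci push_pull [OF U] by (simp add: push_augmentation lid_ci_def)
    assume "\<exists>\<J>. \<J> \<noteq> {} \<and> (\<forall>J \<in> \<J>. lid G J \<and> pull U \<subset> J) \<and> pull U = \<Inter>\<J>"
    then obtain \<J> where J': "\<J> \<noteq> {}" "\<forall>J \<in> \<J>. lid G J \<and> pull U \<subset> J" "pull U = \<Inter>\<J>"
      by (elim exE conjE) (rule that)
    note J = J'(1) bspec [OF J'(2)] J'(3)
    have *: "lid F J \<and> U \<subset> J" if "J \<in> push ` \<J>" for J
    proof -
      obtain I where I: "I \<in> \<J>" "J = push I" using \<open>J \<in> push ` \<J>\<close> by blast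
      then have "lid F J" using J(2) kernel_subset_pull [OF U] by (auto intro!: lid_push)
      moreover have "push (pull U) \<subset> push I" using J(2) [OF I(1)] lid_pull [OF U] by (intro push_psubset) auto
      ultimately show ?thesis by (simp add: push_pull [OF U] I(2))
    qed
    have "U = \<Inter>(push ` \<J>)" using push_pull [OF U] push_Inter [OF J(1)] J(3) by simp
    moreover have "U \<noteq> \<Inter>(push ` \<J>)" using J(1) * by (intro lid_ciD [OF ci]) blast+
    ultimately show False by contradiction
  qed
next
  assume ci: "lid_ci G (pull U)"
  show "lid_ci F U"
    unfolding lid_ci_def
  proof (intro conjI notI)
    show "lid F U" by (rule U)
    show False if "U = augmentation"
      using that ci by (simp add: pull_augmentation lid_ci_def)
    assume "\<exists>\<J>. \<J> \<noteq> {} \<and> (\<forall>J \<in> \<J>. lid F J \<and> U \<subset> J) \<and> U = \<Inter>\<J>"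
    then obtain \<J> where J': "\<J> \<noteq> {}" "\<forall>J \<in> \<J>. lid F J \<and> U \<subset> J" "U = \<Inter>\<J>"
      by (elim exE conjE) (rule that)
    note J = J'(1) bspec [OF J'(2)] J'(3)
    have *: "\<forall>J \<in> pull ` \<J>. lid G J \<and> pull U \<subset> J"
    proof (intro ballI)
      fix J assume "J \<in> pull ` \<J>"
      then obtain I where "I \<in> \<J>" "J = pull I" by blast
      moreover from this have "lid F I" "U \<subset> I" using J(2) by auto
      ultimately show "lid G J \<and> pull U \<subset> J" using lid_pull pull_psubset [OF U] by blast
    qed
    have "pull U = \<Inter>(pull ` \<J>)" using pull_Inter [OF J(1)] J(3) by simp
    moreover have "pull U \<noteq> \<Inter>(pull ` \<J>)" using J(1) * by (intro lid_ciD [OF ci]) blast+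
    ultimately show False by contradiction
  qed
qed

lemma ci_meet_pull:
  assumes U: "lid F U"
  shows "ci_meet G (pull U) \<longleftrightarrow> ci_meet F U"
proof
  assume "ci_meet F U"
  then obtain \<J> where J': "finite \<J>" "\<J> \<noteq> {}" "\<forall>J \<in> \<J>. lid_ci F J" "U = \<Inter>\<J>"
    unfolding ci_meet_def by (elim exE conjE) (rule that)
  note J = J'(1,2) bspec [OF J'(3)] J'(4)
  have "lid_ci G (pull I)" if "I \<in> \<J>" for I
    using J(3) [OF that] lid_ci_pull [of I] by (simp add: lid_ci_def [of F])
  then show "ci_meet G (pull U)"
    unfolding ci_meet_def using pull_Inter [OF J(2)] J
    by (intro exI [of _ "pull ` \<J>"]) auto
next
  assume "ci_meet G (pull U)"
  then obtain \<J> where J': "finite \<J>" "\<J> \<noteq> {}" "\<forall>J \<in> \<J>. lid_ci G J" "pull U = \<Inter>\<J>"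
    unfolding ci_meet_def by (elim exE conjE) (rule that)
  note J = J'(1,2) bspec [OF J'(3)] J'(4)
  have "lid_ci F (push I)" if "I \<in> \<J>" for I
  proof -
    have I: "lid G I" using J(3) [OF that] by (simp add: lid_ci_def)
    have "kernel \<subseteq> I" using kernel_subset_pull [OF U] J(4) that by blast
    then have "lid F (push I)" by (rule lid_push [OF I])
    then show ?thesis using lid_ci_pull [of "push I"] J(3) [OF that] by (simp add: pull_push [OF I])
  qed
  moreover have "U = \<Inter>(push ` \<J>)" using push_pull [OF U] push_Inter [OF J(2)] J(4) by simp
  ultimately show "ci_meet F U"
    unfolding ci_meet_def using J by (intro exI [of _ "push ` \<J>"]) auto
qed

lemma vt_kernel_iff: "v \<in> verts G \<Longrightarrow> vt v \<in> (kernel :: ('v, 'e, 'k::field) lpa_poly set) \<longleftrightarrow> v \<in> H"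
proof
  let ?N = "null_ideal F :: ('v copy, 'e copy, 'k) lpa_poly set"
  note N = tideal_null_ideal [of F] null_ideal_relators [of F]
  assume v: "v \<in> verts G" and "vt v \<in> (kernel :: ('v, 'e, 'k) lpa_poly set)"
  \<comment> \<open>Multiplication by the unprimed vertex isolates it from its primed copy.\<close>
  then have "vt (Old v) * (vt (Old v) + vt (Primed v)) \<in> ?N"
    by (intro tideal_mult_left [OF N(1)]) (simp add: kernel_def pull_def)
  moreover have *: "vt (Old v) * vt (Old v) + vt (Old v) * vt (Primed v) \<simeq>\<^bsub>?N\<^esub> vt (Old v) + 0"
    by (intro eqv_add N vt_vt_same [OF N]) (simp add: eqv_zero_iff vt_vt_diff [OF N])
  ultimately have "vt (Old v) \<in> ?N"
    using eqv_mem_iff [OF N(1) *] by (simp add: distrib_left)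
  then have "Old v \<notin> verts F" using wf_digraph.vt_notin_null_ideal [OF wf_quotient] by blast
  then show "v \<in> H" using v by auto
qed (rule vt_kernel)

text \<open>A path that ends outside the hereditary set \<open>H\<close> avoids \<open>H\<close>
  altogether, so all of its edges survive.\<close>

lemma awalk_map_Old:
  assumes "pre_digraph.awalk G u p v" "v \<notin> H"
  shows "pre_digraph.awalk F (Old u) (map Old p) (Old v)"
proof -
  interpret Q: wf_digraph F by (rule wf_quotient)
  have "Q.awalk (Old u) (map Old p) (Old v) \<and> u \<notin> H"
    using assms
  proof (induction p arbitrary: u)
    case (Cons e p)
    then show ?case using head_H [of e] by (auto simp: awalk_Cons_iff Q.awalk_Cons_iff)
  qed (auto simp: awalk_Nil_iff Q.awalk_Nil_iff)
  then show ?thesis ..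
qed

lemma awalk_project:
  assumes "pre_digraph.awalk F x p y"
  shows "pre_digraph.awalk G (un_copy x) (map un_copy p) (un_copy y)"
proof -
  interpret Q: wf_digraph F by (rule wf_quotient)
  show ?thesis using assms
  proof (induction p arbitrary: x)
    case (Cons f p)
    then have f: "f \<in> arcs F" "x = tail F f" "Q.awalk (head F f) p y" by (auto simp: Q.awalk_Cons_iff)
    from Cons.IH [OF f(3)] show ?case using f by (auto simp: awalk_Cons_iff)
  qed (auto simp: awalk_Nil_iff Q.awalk_Nil_iff breaking_iff)
qed

text \<open>A primed edge ends at a primed vertex, which is a sink, so it could only be the last
  edge of a path that ends at a primed vertex.\<close>

lemma awalk_to_Old:
  assumes "pre_digraph.awalk F x p (Old v)" "p \<noteq> []"
  shows "\<exists>q. p = map Old q"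
proof -
  interpret Q: wf_digraph F by (rule wf_quotient)
  have "\<exists>q. p = map Old q"
    using assms(1)
  proof (induction p arbitrary: x)
    case (Cons f p)
    then have f: "f \<in> arcs F" "x = tail F f" "Q.awalk (head F f) p (Old v)" by (auto simp: Q.awalk_Cons_iff)
    then obtain q where q: "p = map Old q" using Cons.IH by blast
    show ?case
    proof (cases f)
      case (Old e)
      then show ?thesis using q by (intro exI [of _ "e # q"]) simp
    next
      case (Primed e)
      then show ?thesis using f(3) by (cases p) (auto simp: Q.awalk_Nil_iff Q.awalk_Cons_iff tail_un_copy)
    qed
  qed simp
  then show ?thesis .
qed

text \<open>Closed paths of the quotient graph consist of unprimed edges and project to closed paths
  of \<open>G\<close>; a second one there returns to a vertex outside \<open>H\<close> and therefore
  lifts back.\<close>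

lemma alternating_quotient:
  assumes "alternating G"
  shows "alternating F"
  unfolding alternating_def
proof (intro allI impI)
  interpret Q: wf_digraph F by (rule wf_quotient)
  fix x p assume p: "closed_path F x p"
  then have w: "Q.awalk x p x" "p \<noteq> []" by (auto simp: Q.closed_path_iff)
  then obtain v where x: "x = Old v" by (cases p) (auto simp: Q.awalk_Cons_iff tail_un_copy)
  then have v: "v \<notin> H" using w(1) by (auto dest: Q.awalk_hd_in_verts)
  obtain q where q: "p = map Old q" using awalk_to_Old w x by blast
  have "awalk v q v" using awalk_project [OF w(1)] by (simp add: x q comp_def)
  then have "closed_path G v q" using w q by (simp add: closed_path_iff)
  then obtain r where r: "closed_path G v r" "set r \<noteq> set q" using assms unfolding alternating_def by blast
  then have "closed_path F x (map Old r)"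
    using awalk_map_Old [of v r v] v by (simp add: x closed_path_iff Q.closed_path_iff)
  moreover have "set (map Old r) \<noteq> set p" using r(2) by (simp add: q inj_image_eq_iff inj_def)
  ultimately show "\<exists>q. closed_path F x q \<and> set q \<noteq> set p" by blast
qed

end

section \<open>The admissible pair of an ideal\<close>

context wf_digraph
begin

definition vertices_in :: "('a, 'b, 'k::field) lpa_poly set \<Rightarrow> 'a set" where
  "vertices_in I = {v \<in> verts G. vt v \<in> I}"

definition gaps_in :: "('a, 'b, 'k::field) lpa_poly set \<Rightarrow> 'a set" where
  "gaps_in I = {v \<in> breaking_vertices G (vertices_in I). vt v - live_part G (vertices_in I) v \<in> I}"

lemma head_vertex_in:
  assumes U: "tideal U" "all_relators G \<subseteq> U" and e: "e \<in> arcs G" "vt (tail G e) \<in> U"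
  shows "vt (head G e) \<in> U"
proof -
  have "gh e * vt (tail G e) * ed e \<in> U"
    using e U by (simp add: tideal_mult_left tideal_mult_right)
  then have "gh e * ed e \<in> U"
    using eqv_mem_iff [OF U(1) eqv_mult [OF U(1) gh_tail [OF U] eqv_refl [OF U(1)]]] by blast
  then show ?thesis using eqv_mem_iff [OF U(1) gh_ed_same [OF U e(1)]] by blast
qed

lemma admissible_pair_in:
  assumes I: "lid G I"
  shows "admissible_pair G (vertices_in I) (gaps_in I)"
  unfolding admissible_pair_def
proof (intro conjI)
  have U: "tideal I" "all_relators G \<subseteq> I" using I by (auto simp: lid_def)
  show "hereditary G (vertices_in I)"
    unfolding hereditary_def
  proof (intro conjI allI impI)
    fix u v assume u: "u \<in> vertices_in I" "path_ge G u v"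
    then obtain p where "awalk u p v" by (auto simp: path_ge_def)
    then show "v \<in> vertices_in I" using u(1)
    proof (induction p arbitrary: u)
      case (Cons e p)
      then have e: "e \<in> arcs G" "u = tail G e" "awalk (head G e) p v" by (auto simp: awalk_Cons_iff)
      then have "head G e \<in> vertices_in I"
        using Cons.prems head_vertex_in [OF U e(1)] by (auto simp: vertices_in_def)
      then show ?case using Cons.IH e by blast
    qed (simp add: awalk_Nil_iff)
  qed (auto simp: vertices_in_def)
  show "saturated G (vertices_in I)"
    unfolding saturated_def
  proof (intro conjI allI impI)
    fix v assume v: "regular G v" "head G ` out_arcs G v \<subseteq> vertices_in I"
    have "ed e * gh e \<in> I" if "e \<in> out_arcs G v" for e
    proof -
      have "head G e \<in> vertices_in I" using v that by blast
      then have "vt (head G e) \<in> I" by (simp add: vertices_in_def)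
      then have "ed e * vt (head G e) * gh e \<in> I" using U by (simp add: tideal_mult_left tideal_mult_right)
      then show ?thesis
        using eqv_mem_iff [OF U(1) eqv_mult [OF U(1) ed_head [OF U] eqv_refl [OF U(1)]]] by blast
    qed
    then have "(\<Sum>e \<in> out_arcs G v. ed e * gh e) \<in> I" by (rule tideal_sum [OF U(1)])
    then show "v \<in> vertices_in I"
      using eqv_mem_iff [OF U(1) vt_eqv_sum [OF U v(1)]] v(1) by (simp add: vertices_in_def regular_def)
  qed (auto simp: vertices_in_def)
qed (auto simp: gaps_in_def)

text \<open>Over the quotient graph the image of \<open>I\<close> contains no vertex, since each
  lifted idempotent in \<open>I\<close> would put a further vertex or gap projection into
  \<open>I\<close>. By the reduction theorem the image is null.\<close>

lemma ideal_eq_kernel: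
  fixes I :: "('a, 'b, 'k::field) lpa_poly set"
  assumes K: "alternating G" and I: "lid G I"
  shows "I = admissible_quotient.kernel G (vertices_in I) (gaps_in I)"
proof -
  let ?H = "vertices_in I" and ?S = "gaps_in I"
  interpret admissible_quotient G ?H ?S
    using admissible_pair_in [OF I] wf_digraph_axioms
    by (simp add: admissible_quotient_def admissible_quotient_axioms_def)
  interpret Q: wf_digraph F by (rule wf_quotient)
  have U: "tideal I" "all_relators G \<subseteq> I" using I by (auto simp: lid_def)
  have push: "lid F (push I)"
    unfolding push_def by (intro merge_lid I) (auto simp: vertices_in_def gaps_in_def)
  have "push I = null_ideal F"
  proof (rule ccontr)
    assume "push I \<noteq> null_ideal F"
    then obtain x where x: "x \<in> verts F" "vt x \<in> push I"
      using Q.vertex_in_nonzero_ideal [OF alternating_quotient [OF K] push] by blast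
    then have el: "copy_el x \<in> I" by (simp add: push_def)
    show False
    proof (cases x)
      case (Old v)
      show ?thesis
      proof (cases "v \<in> B")
        case False
        have "vt v \<in> I" using el unfolding Old copy_el.simps if_not_P [OF False] .
        moreover have "v \<in> verts G" "v \<notin> ?H" using x(1) by (auto simp: Old)
        ultimately show ?thesis by (simp add: vertices_in_def)
      next
        case True
        then have fin: "finite (live_arcs G ?H v)" by (auto simp: breaking_iff)
        obtain e where e: "e \<in> live_arcs G ?H v" using True by (auto simp: breaking_iff)
        then have arc: "e \<in> arcs G" "head G e \<notin> ?H" by (auto simp: live_arcs_def)
        have "live_part G ?H v \<in> I" using el True by (simp add: Old)
        \<comment> \<open>Compressing \<open>live_part\<close> by one of its live edges gives the
          head of that edge, which \<open>I\<close> cannot contain.\<close>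
        then have "gh e * live_part G ?H v * ed e \<in> I" using U by (simp add: tideal_mult_left tideal_mult_right)
        then have "gh e * ed e \<in> I"
          using eqv_mem_iff [OF U(1) eqv_mult [OF U(1) gh_live_part [OF U fin e] eqv_refl [OF U(1)]]] by blast
        then have "vt (head G e) \<in> I" using eqv_mem_iff [OF U(1) gh_ed_same [OF U arc(1)]] by blast
        then show ?thesis using arc by (simp add: vertices_in_def)
      qed
    next
      case (Primed v)
      have v: "v \<in> breaking_vertices G ?H" "v \<notin> ?S" using x(1) by (auto simp: Primed)
      then have "vt v - live_part G ?H v \<in> I" using el by (simp add: Primed)
      then have "v \<in> ?S" using v(1) unfolding gaps_in_def by blast
      then show ?thesis using v(2) by contradiction
    qed
  qed
  then show ?thesis using pull_push [OF I] by (simp add: kernel_def)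
qed

text \<open>The null ideal is completely irreducible iff the nonzero ideals have nonzero
  intersection. Such an intersection contains a vertex, and the vertex sets of nonzero ideals are
  precisely the nonempty hereditary saturated sets.\<close>

lemma null_ideal_ci_iff:
  assumes K: "alternating G"
  shows "lid_ci G (null_ideal G :: ('a, 'b, 'k::field) lpa_poly set) \<longleftrightarrow>
    (\<exists>x \<in> verts G. \<forall>Y. Y \<noteq> {} \<longrightarrow> hereditary G Y \<longrightarrow> saturated G Y \<longrightarrow> x \<in> Y)"
proof
  let ?N = "null_ideal G :: ('a, 'b, 'k) lpa_poly set"
  assume ci: "lid_ci G ?N"
  let ?\<J> = "{J. lid G J \<and> J \<noteq> ?N}"
  have ne: "?\<J> \<noteq> {}" using ci lid_augmentation by (auto simp: lid_ci_def)
  have "?N \<noteq> \<Inter>?\<J>"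
    by (rule lid_ciD [OF ci ne]) (use null_ideal_subset in blast)+
  then have "\<Inter>?\<J> \<noteq> ?N" by (rule not_sym)
  moreover have "lid G (\<Inter>?\<J>)" using ne by (intro lid_Inter) auto
  ultimately obtain x where x: "x \<in> verts G" "vt x \<in> \<Inter>?\<J>"
    using vertex_in_nonzero_ideal [OF K] by blast
  have "x \<in> Y" if Y: "Y \<noteq> {}" "hereditary G Y" "saturated G Y" for Y
  proof -
    obtain U :: "('a, 'b, 'k) lpa_poly set" where U: "lid G U" "\<And>v. v \<in> verts G \<Longrightarrow> vt v \<in> U \<longleftrightarrow> v \<in> Y"
      using ideal_with_vertex_set [OF Y(2,3)] by blast
    obtain y where "y \<in> Y" "y \<in> verts G" using Y by (auto simp: hereditary_def)
    then have "U \<noteq> ?N" using U(2) vt_notin_null_ideal by blast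
    then have "vt x \<in> U" using x(2) U(1) by blast
    then show "x \<in> Y" using U(2) x(1) by blast
  qed
  then show "\<exists>x \<in> verts G. \<forall>Y. Y \<noteq> {} \<longrightarrow> hereditary G Y \<longrightarrow> saturated G Y \<longrightarrow> x \<in> Y"
    using x(1) by blast
next
  let ?N = "null_ideal G :: ('a, 'b, 'k) lpa_poly set"
  assume "\<exists>x \<in> verts G. \<forall>Y. Y \<noteq> {} \<longrightarrow> hereditary G Y \<longrightarrow> saturated G Y \<longrightarrow> x \<in> Y"
  then obtain x where x: "x \<in> verts G"
    "\<And>Y. Y \<noteq> {} \<Longrightarrow> hereditary G Y \<Longrightarrow> saturated G Y \<Longrightarrow> x \<in> Y" by blast
  have xN: "vt x \<notin> ?N" by (rule vt_notin_null_ideal [OF x(1)])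
  show "lid_ci G ?N"
    unfolding lid_ci_def
  proof (intro conjI notI)
    show "lid G ?N" by (rule lid_null_ideal)
    show False if "?N = augmentation" using xN that by simp
    assume "\<exists>\<J>. \<J> \<noteq> {} \<and> (\<forall>J \<in> \<J>. lid G J \<and> ?N \<subset> J) \<and> ?N = \<Inter>\<J>"
    then obtain \<J> where J': "\<forall>J \<in> \<J>. lid G J \<and> ?N \<subset> J" "?N = \<Inter>\<J>"
      by (elim exE conjE) (rule that)
    note J = bspec [OF J'(1)] J'(2)
    have "vt x \<in> J" if "J \<in> \<J>" for J
    proof -
      have "lid G J" "J \<noteq> ?N" using J(1) \<open>J \<in> \<J>\<close> by auto
      then obtain y where "y \<in> vertices_in J"
        using vertex_in_nonzero_ideal [OF K] unfolding vertices_in_def by blast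
      then have "x \<in> vertices_in J"
        using x(2) admissible_pair_in [OF \<open>lid G J\<close>] by (auto simp: admissible_pair_def)
      then show ?thesis by (simp add: vertices_in_def)
    qed
    then show False using J(2) xN by blast
  qed
qed

end

section \<open>Maximal tails with the strong countable separation property\<close>

definition minimal_vertex :: "('v, 'e) pre_digraph \<Rightarrow> 'v \<Rightarrow> bool" where
  "minimal_vertex G x \<longleftrightarrow> x \<in> verts G \<and>
    (\<forall>Y. Y \<noteq> {} \<longrightarrow> hereditary G Y \<longrightarrow> saturated G Y \<longrightarrow> x \<in> Y)"

inductive_set sat_closure :: "('v, 'e) pre_digraph \<Rightarrow> 'v set \<Rightarrow> 'v set" for G X where
  base: "v \<in> X \<Longrightarrow> v \<in> sat_closure G X"
| step: "regular G v \<Longrightarrow> (\<And>e. e \<in> out_arcs G v \<Longrightarrow> head G e \<in> sat_closure G X) \<Longrightarrow> v \<in> sat_closure G X"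

text \<open>Paths continue through regular vertices only and stop at sinks and infinite emitters;
  the tree is therefore finitely branching, and countable in any graph.\<close>

inductive_set regular_reach :: "('v, 'e) pre_digraph \<Rightarrow> 'v \<Rightarrow> 'v set" for G x where
  start: "x \<in> regular_reach G x"
| step: "v \<in> regular_reach G x \<Longrightarrow> regular G v \<Longrightarrow> e \<in> out_arcs G v \<Longrightarrow> head G e \<in> regular_reach G x"

lemma countable_regular_reach: "countable (regular_reach G x)"
proof -
  define next_level where
    "next_level A = A \<union> (\<Union>v \<in> {v \<in> A. regular G v}. head G ` out_arcs G v)" for A
  define R where "R n = (next_level ^^ n) {x}" for n
  have "countable (R n)" for n
    unfolding R_def
  proof (induction n)
    case (Suc n)
    have "finite (head G ` out_arcs G v)" if "regular G v" for v
      using that by (simp add: regular_def)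
    then show ?case using Suc unfolding funpow.simps comp_apply
      by (subst next_level_def) (auto intro!: countable_UN intro: countable_finite countable_subset)
  qed simp
  then have "countable (\<Union>n. R n)" by (intro countable_UN) auto
  moreover have "regular_reach G x \<subseteq> (\<Union>n. R n)"
  proof
    fix v assume "v \<in> regular_reach G x"
    then show "v \<in> (\<Union>n. R n)"
    proof induction
      case start
      then show ?case by (auto simp: R_def intro!: exI [of _ 0])
    next
      case (step v e)
      then obtain n where "v \<in> R n" by blast
      with step have "head G e \<in> next_level (R n)" by (auto simp: next_level_def)
      then have "head G e \<in> R (Suc n)" by (simp add: R_def)
      then show ?case by blast
    qed
  qed
  ultimately show ?thesis by (rule countable_subset [rotated])
qed

text \<open>A vertex outside \<open>X\<close> joins the saturation only as a regular vertex all of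
  whose edges lead to earlier members, so following edges from it must end in
  \<open>X\<close>.\<close>

lemma sat_closure_meets_regular_reach:
  "v \<in> sat_closure G X \<Longrightarrow> \<exists>w \<in> regular_reach G v. w \<in> X"
proof (induction rule: sat_closure.induct)
  case (base v)
  then show ?case using regular_reach.start by fast
next
  case (step v)
  obtain e where e: "e \<in> out_arcs G v" using step.hyps(1) unfolding regular_def by blast
  then obtain w where w: "w \<in> regular_reach G (head G e)" "w \<in> X" using step.IH by blast
  have "w \<in> regular_reach G v"
    using w(1)
  proof induction
    case start
    then show ?case using regular_reach.step [OF regular_reach.start step.hyps(1) e] .
  next
    case (step u f)
    then show ?case by (auto intro: regular_reach.step)
  qed
  with w show ?case by blast
qed

lemma sat_closure_least:
  assumes "X \<subseteq> Z" "saturated G Z"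
  shows "sat_closure G X \<subseteq> Z"
proof
  fix v assume "v \<in> sat_closure G X"
  then show "v \<in> Z" using assms by induction (auto simp: saturated_def)
qed

context wf_digraph
begin

lemma path_ge_refl: "v \<in> verts G \<Longrightarrow> path_ge G v v"
  unfolding path_ge_def using awalk_Nil_iff by blast

lemma path_ge_trans: "path_ge G u v \<Longrightarrow> path_ge G v w \<Longrightarrow> path_ge G u w"
  unfolding path_ge_def using awalk_append by blast

lemma path_ge_arc: "e \<in> arcs G \<Longrightarrow> path_ge G (tail G e) (head G e)"
  unfolding path_ge_def using arc_implies_awalk by blast

lemma path_ge_verts: "path_ge G u v \<Longrightarrow> u \<in> verts G" "path_ge G u v \<Longrightarrow> v \<in> verts G"
  by (auto simp: path_ge_def dest: awalk_hd_in_verts awalk_last_in_verts)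

lemma hereditaryI:
  assumes "X \<subseteq> verts G" "\<And>e. e \<in> arcs G \<Longrightarrow> tail G e \<in> X \<Longrightarrow> head G e \<in> X"
  shows "hereditary G X"
  unfolding hereditary_def
proof (intro conjI allI impI)
  fix u v assume u: "u \<in> X" "path_ge G u v"
  then obtain p where "awalk u p v" by (auto simp: path_ge_def)
  then show "v \<in> X" using u(1)
    by (induction p arbitrary: u) (auto simp: awalk_Nil_iff awalk_Cons_iff assms(2))
qed (rule assms(1))

lemma hereditaryD: "hereditary G X \<Longrightarrow> u \<in> X \<Longrightarrow> path_ge G u v \<Longrightarrow> v \<in> X"
  by (auto simp: hereditary_def)

lemma hereditary_tree: "hereditary G {v. path_ge G u v}"
  using path_ge_trans path_ge_verts(2) unfolding hereditary_def by blast

lemma sat_closure_hereditary: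
  assumes "hereditary G X"
  shows "hereditary G (sat_closure G X)"
proof (rule hereditaryI)
  show "sat_closure G X \<subseteq> verts G"
  proof
    fix v assume "v \<in> sat_closure G X"
    then show "v \<in> verts G" using assms by cases (auto simp: hereditary_def regular_def)
  qed
  fix e assume e: "e \<in> arcs G" "tail G e \<in> sat_closure G X"
  from e(2) show "head G e \<in> sat_closure G X"
  proof cases
    case base
    then show ?thesis using hereditaryD [OF assms] path_ge_arc [OF e(1)] sat_closure.base by metis
  next
    case step
    then show ?thesis using e(1) by simp
  qed
qed

lemma sat_closure_saturated:
  assumes "hereditary G X"
  shows "saturated G (sat_closure G X)"
  unfolding saturated_def
proof (intro conjI allI impI)
  show "sat_closure G X \<subseteq> verts G"
    using sat_closure_hereditary [OF assms] by (simp add: hereditary_def)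
  fix v assume v: "regular G v" "head G ` out_arcs G v \<subseteq> sat_closure G X"
  show "v \<in> sat_closure G X" by (rule sat_closure.step [OF v(1)]) (use v(2) in blast)
qed

lemma regular_reach_path_ge: "w \<in> regular_reach G x \<Longrightarrow> x \<in> verts G \<Longrightarrow> path_ge G x w"
proof (induction rule: regular_reach.induct)
  case (step v e)
  then show ?case using path_ge_trans path_ge_arc by auto
qed (rule path_ge_refl)

lemma minimal_vertex_in_sat_closure:
  assumes "minimal_vertex G x" "hereditary G X" "X \<noteq> {}"
  shows "x \<in> sat_closure G X"
proof -
  obtain v where "v \<in> X" using assms(3) by blast
  then have "v \<in> sat_closure G X" by (rule sat_closure.base)
  then have "sat_closure G X \<noteq> {}" by blast
  then show ?thesis
    using assms(1) sat_closure_hereditary [OF assms(2)] sat_closure_saturated [OF assms(2)]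
    unfolding minimal_vertex_def by blast
qed

text \<open>
  The regular vertices between \<open>x\<close> and the tree of \<open>u\<close> emit finitely many edges, so the countably
  many vertices that \<open>x\<close> reaches through regular vertices separate all other vertices.
\<close>
lemma minimal_vertex_reach:
  assumes "minimal_vertex G x" "u \<in> verts G"
  obtains w where "w \<in> regular_reach G x" "path_ge G u w"
proof -
  have "x \<in> sat_closure G {v. path_ge G u v}"
    using path_ge_refl [OF assms(2)] by (intro minimal_vertex_in_sat_closure assms hereditary_tree) auto
  then show ?thesis using sat_closure_meets_regular_reach that by fast
qed

lemma minimal_vertex_path_ge:
  assumes "minimal_vertex G x" "path_ge G x w"
  shows "minimal_vertex G w"
  unfolding minimal_vertex_def
proof (intro conjI allI impI)
  show "w \<in> verts G" by (rule path_ge_verts(2) [OF assms(2)])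
  fix Y assume "Y \<noteq> {}" "hereditary G Y" "saturated G Y"
  moreover from this have "x \<in> Y" using assms(1) by (simp add: minimal_vertex_def)
  ultimately show "w \<in> Y" using hereditaryD [OF _ _ assms(2)] by simp
qed

text \<open>Choose \<open>y\<close> below both \<open>u\<close> and \<open>x\<close>. Minimality
  passes down to \<open>y\<close>, so \<open>v\<close> in turn reaches a vertex below
  \<open>y\<close>.\<close>

lemma minimal_vertex_downward_directed:
  assumes x: "minimal_vertex G x"
  shows "downward_directed G (verts G)"
  unfolding downward_directed_def
proof (intro conjI ballI)
  show "verts G \<noteq> {}" using x by (auto simp: minimal_vertex_def)
  fix u v assume uv: "u \<in> verts G" "v \<in> verts G"
  obtain y where y: "y \<in> regular_reach G x" "path_ge G u y"
    using minimal_vertex_reach [OF x uv(1)] .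
  have "path_ge G x y" using regular_reach_path_ge y(1) x by (simp add: minimal_vertex_def)
  then have my: "minimal_vertex G y" by (rule minimal_vertex_path_ge [OF x])
  obtain z where z: "z \<in> regular_reach G y" "path_ge G v z"
    using minimal_vertex_reach [OF my uv(2)] .
  have "path_ge G y z" using regular_reach_path_ge z(1) my by (simp add: minimal_vertex_def)
  then have "path_ge G u z" by (rule path_ge_trans [OF y(2)])
  then show "\<exists>w \<in> verts G. path_ge G u w \<and> path_ge G v w"
    using z(2) path_ge_verts(2) by blast
qed

end

context admissible_quotient
begin

lemma path_ge_lift: "path_ge G u v \<Longrightarrow> v \<notin> H \<Longrightarrow> path_ge F (Old u) (Old v)"
  unfolding path_ge_def using awalk_map_Old by blast

lemma path_ge_project: "path_ge F x y \<Longrightarrow> path_ge G (un_copy x) (un_copy y)"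
  unfolding path_ge_def using awalk_project by blast

lemma un_copy_verts: "x \<in> verts F \<Longrightarrow> un_copy x \<in> verts G - H"
  by (auto simp: breaking_iff)

lemma breaking_arc:
  assumes "v \<in> breaking_vertices G H"
  obtains e where "e \<in> arcs G" "tail G e = v" "head G e \<in> H"
proof -
  have "infinite (out_arcs G v)" "finite (live_arcs G H v)" using assms by (auto simp: breaking_iff)
  then have "\<not> out_arcs G v \<subseteq> live_arcs G H v" using finite_subset by blast
  then show ?thesis using that unfolding live_arcs_def out_arcs_def by blast
qed

text \<open>A hereditary set that avoids \<^term>\<open>H\<close> contains no breaking vertices, as these have edges into \<^term>\<open>H\<close>.\<close>
lemma path_ge_from_hereditary:
  assumes Y: "hereditary G Y" "Y \<subseteq> verts G - H" and y: "y \<in> Y" "path_ge F (Old y) z"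
  shows "z \<in> Old ` Y"
proof -
  interpret Q: wf_digraph F by (rule wf_quotient)
  have closed: "head G e \<in> Y" if "e \<in> arcs G" "tail G e \<in> Y" for e
    using hereditaryD [OF Y(1) that(2)] path_ge_arc [OF that(1)] by blast
  have "hereditary F (Old ` Y)"
  proof (rule Q.hereditaryI)
    fix f assume f: "f \<in> arcs F" "tail F f \<in> Old ` Y"
    then have e: "un_copy f \<in> arcs G" "tail G (un_copy f) \<in> Y" by (auto simp: tail_un_copy)
    show "head F f \<in> Old ` Y"
    proof (cases f)
      case (Old e)
      then show ?thesis using closed e by simp
    next
      case (Primed e)
      then have b: "head G e \<in> breaking_vertices G H" using f by auto
      obtain e' where "e' \<in> arcs G" "tail G e' = head G e" "head G e' \<in> H"
        using breaking_arc [OF b] .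
      then show ?thesis using closed [of e'] closed [OF e] Y(2) Primed by auto
    qed
  qed (use Y(2) in auto)
  then show ?thesis using y Q.hereditaryD by blast
qed

lemma hereditary_Old:
  assumes Y: "hereditary G Y" "Y \<subseteq> verts G - H"
  shows "hereditary F (Old ` Y)"
  unfolding hereditary_def using path_ge_from_hereditary [OF Y] Y(2) by auto

text \<open>No edge leads from \<open>Y\<close> into \<open>H\<close>, so a vertex of
  \<open>Y\<close> keeps all its edges in the quotient graph and is regular there iff it is in
  \<open>G\<close>; saturating there adds no vertex of \<open>Y\<close> to a saturated set.\<close>

lemma sat_closure_Old:
  assumes Y: "hereditary G Y" "Y \<subseteq> verts G - H" and Z: "saturated G Z"
    and v: "Old v \<in> sat_closure F (Old ` Z)" "v \<in> Y"
  shows "v \<in> Z"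
proof -
  have "\<forall>v. w = Old v \<longrightarrow> v \<in> Y \<longrightarrow> v \<in> Z" if "w \<in> sat_closure F (Old ` Z)" for w
    using that
  proof (induction rule: sat_closure.induct)
    case (step w)
    show ?case
    proof (intro allI impI)
      fix v assume w: "w = Old v" and v: "v \<in> Y"
      have heads: "head G e \<in> Y" if "e \<in> out_arcs G v" for e
        using that hereditaryD [OF Y(1) v] path_ge_arc [of e] by auto
      have live: "live_arcs G H v = out_arcs G v" using heads Y(2) unfolding live_arcs_def by blast
      have "regular G v"
        using step.hyps(1) live unfolding w regular_quotient by (simp add: regular_def)
      moreover have "head G e \<in> Z" if e: "e \<in> out_arcs G v" for e
      proof -
        have "Old e \<in> out_arcs F w" using e live by (simp add: w out_arcs_quotient)
        then show ?thesis using step.IH [of "Old e"] heads [OF e] by simp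
      qed
      ultimately show "v \<in> Z" using Z by (auto simp: saturated_def)
    qed
  qed auto
  then show ?thesis using v by blast
qed

text \<open>The tail property and the countable separating set project from the quotient graph. The
  vertices reached from \<open>x\<close> need not lie in every hereditary saturated subset of the
  tail; if there is a nonempty one, the minimal vertex is first moved down into it.\<close>

lemma tail_of_minimal_vertex:
  assumes x: "minimal_vertex F x"
  shows "maximal_tail G (verts G - H)" and "strong_CSP G (verts G - H)"
proof -
  interpret Q: wf_digraph F by (rule wf_quotient)
  let ?M = "verts G - H"
  have dd: "downward_directed F (verts F)" by (rule Q.minimal_vertex_downward_directed [OF x])
  have ne: "?M \<noteq> {}" using x un_copy_verts [of x] unfolding minimal_vertex_def by blast
  show "maximal_tail G ?M"
    unfolding maximal_tail_def
  proof (intro conjI allI impI ballI)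
    show "?M \<noteq> {}" by (rule ne)
    fix u v assume "v \<in> ?M" "path_ge G u v"
    then show "u \<in> ?M" using hereditaryD [OF hered] path_ge_verts by blast
  next
    fix v assume "v \<in> ?M" "regular G v"
    then show "\<exists>e \<in> out_arcs G v. head G e \<in> ?M"
      using regular_live [of v] by (auto simp: live_arcs_def)
  next
    show "downward_directed G ?M"
      unfolding downward_directed_def
    proof (intro conjI ballI)
      fix u v assume "u \<in> ?M" "v \<in> ?M"
      then have "Old u \<in> verts F" "Old v \<in> verts F" by auto
      then obtain w where w: "w \<in> verts F" "path_ge F (Old u) w" "path_ge F (Old v) w"
        using dd unfolding downward_directed_def by blast
      then show "\<exists>w \<in> ?M. path_ge G u w \<and> path_ge G v w"
        using un_copy_verts path_ge_project [OF w(2)] path_ge_project [OF w(3)]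
        by (intro bexI [of _ "un_copy w"]) auto
    qed (rule ne)
  qed auto
  have csp: "CSP_wrt G ?M (un_copy ` regular_reach F x)" if x: "minimal_vertex F x" for x
    unfolding CSP_wrt_def
  proof (intro conjI ballI)
    show "countable (un_copy ` regular_reach F x)" by (rule countable_image [OF countable_regular_reach])
    have xv: "x \<in> verts F" using x by (simp add: minimal_vertex_def)
    show "un_copy ` regular_reach F x \<subseteq> ?M"
      using un_copy_verts Q.path_ge_verts(2) [OF Q.regular_reach_path_ge [OF _ xv]] by blast
    fix u assume "u \<in> ?M"
    then have "Old u \<in> verts F" by auto
    then obtain w where "w \<in> regular_reach F x" "path_ge F (Old u) w"
      using Q.minimal_vertex_reach [OF x] by blast
    then show "\<exists>v \<in> un_copy ` regular_reach F x. path_ge G u v"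
      using path_ge_project by (metis imageI un_copy.simps(1))
  qed
  show "strong_CSP G ?M"
  proof (cases "\<exists>Y. Y \<noteq> {} \<and> Y \<subseteq> ?M \<and> hereditary G Y \<and> saturated G Y")
    case False
    then show ?thesis using csp [OF x] unfolding strong_CSP_def by blast
  next
    case True
    then obtain Y y where Y: "Y \<subseteq> ?M" "hereditary G Y" "saturated G Y" and y: "y \<in> Y" by blast
    have "Old y \<in> verts F" using Y(1) y by auto
    then obtain z where z: "z \<in> regular_reach F x" "path_ge F (Old y) z"
      using Q.minimal_vertex_reach [OF x] by blast
    obtain v where v: "v \<in> Y" "z = Old v" using path_ge_from_hereditary [OF Y(2,1) y z(2)] by blast
    have "path_ge F x z" using Q.regular_reach_path_ge z(1) x by (simp add: minimal_vertex_def)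
    then have mz: "minimal_vertex F (Old v)" using Q.minimal_vertex_path_ge [OF x] v by blast
    have "un_copy ` regular_reach F (Old v) \<subseteq> Z"
      if Z: "Z \<noteq> {}" "Z \<subseteq> ?M" "hereditary G Z" "saturated G Z" for Z
    proof -
      \<comment> \<open>By minimality \<open>v\<close> lies in the saturation of \<open>Z\<close>
        over the quotient graph; since it also lies in \<open>Y\<close>, it lies in \<open>Z\<close>
        itself.\<close>
      have "Old v \<in> sat_closure F (Old ` Z)"
        using Z by (intro Q.minimal_vertex_in_sat_closure mz hereditary_Old) auto
      then have vZ: "v \<in> Z" by (rule sat_closure_Old [OF Y(2,1) Z(4) _ v(1)])
      have "Old v \<in> verts F" using mz by (simp add: minimal_vertex_def)
      then have "path_ge G v (un_copy w)" if "w \<in> regular_reach F (Old v)" for w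
        using path_ge_project [OF Q.regular_reach_path_ge [OF that]] by simp
      then show ?thesis using hereditaryD [OF Z(3) vZ] by blast
    qed
    then show ?thesis using csp [OF mz] unfolding strong_CSP_def by blast
  qed
qed

end

section \<open>From tails with the strong CSP back to minimal vertices\<close>

context wf_digraph
begin

lemma maximal_tail_complement:
  assumes M: "maximal_tail G M"
  shows "hereditary G (verts G - M)" "saturated G (verts G - M)"
proof -
  show "hereditary G (verts G - M)"
    unfolding hereditary_def
  proof (intro conjI allI impI)
    fix u v assume uv: "u \<in> verts G - M" "path_ge G u v"
    have "v \<notin> M"
    proof
      assume "v \<in> M"
      then have "u \<in> M" using M uv(2) by (simp add: maximal_tail_def)
      with uv(1) show False by simp
    qed
    then show "v \<in> verts G - M" using path_ge_verts(2) [OF uv(2)] by simp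
  qed simp
  show "saturated G (verts G - M)"
    unfolding saturated_def
  proof (intro conjI allI impI)
    fix v assume v: "regular G v" "head G ` out_arcs G v \<subseteq> verts G - M"
    have "v \<notin> M"
    proof
      assume "v \<in> M"
      then have "\<exists>e \<in> out_arcs G v. head G e \<in> M" using M v(1) by (simp add: maximal_tail_def)
      with v(2) show False by blast
    qed
    then show "v \<in> verts G - M" using v(1) by (simp add: regular_def)
  qed simp
qed

text \<open>
  A tail that is not covered by the others contains a nonempty hereditary saturated set, the one
  generated by a vertex of no other tail. Hence its separating set lies in that set, and then in every
  nonempty hereditary saturated set of the quotient graph.
\<close>
lemma minimal_vertex_of_tail:
  assumes cover: "verts G = \<Union>\<M>" and tails: "\<And>N. N \<in> \<M> \<Longrightarrow> maximal_tail G N"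
    and M: "M \<in> \<M>" "strong_CSP G M" and x: "x \<in> M" "\<And>N. N \<in> \<M> \<Longrightarrow> N \<noteq> M \<Longrightarrow> x \<notin> N"
  defines "H \<equiv> verts G - M"
  shows "admissible_pair G H (breaking_vertices G H)"
    and "\<exists>t. minimal_vertex (quotient_graph G H (breaking_vertices G H)) t"
proof -
  show adm: "admissible_pair G H (breaking_vertices G H)"
    using maximal_tail_complement [OF tails [OF M(1)]] by (simp add: admissible_pair_def H_def)
  then interpret admissible_quotient G H "breaking_vertices G H"
    using wf_digraph_axioms by (simp add: admissible_quotient_def admissible_quotient_axioms_def)
  interpret Q: wf_digraph F by (rule wf_quotient)
  have MV: "M \<subseteq> verts G" using cover M(1) by blast
  then have VM: "verts G - H = M" by (auto simp: H_def)
  let ?tree = "{v. path_ge G x v}"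
  let ?Y = "sat_closure G ?tree"
  have xv: "x \<in> verts G" using x(1) MV by blast
  have Y: "hereditary G ?Y" "saturated G ?Y" "?tree \<subseteq> ?Y"
    by (rule sat_closure_hereditary [OF hereditary_tree], rule sat_closure_saturated [OF hereditary_tree],
        rule subsetI, rule sat_closure.base)
  \<comment> \<open>The complement of another tail is hereditary and saturated and contains
    \<open>x\<close>, hence everything that \<open>x\<close> generates.\<close>
  have Y_other: "?Y \<inter> N = {}" if N: "N \<in> \<M>" "N \<noteq> M" for N
  proof -
    have "x \<in> verts G - N" using x(2) N xv by blast
    then have "?tree \<subseteq> verts G - N"
      using hereditaryD [OF maximal_tail_complement(1) [OF tails [OF N(1)]]] by blast
    then have "?Y \<subseteq> verts G - N"
      by (rule sat_closure_least [OF _ maximal_tail_complement(2) [OF tails [OF N(1)]]])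
    then show ?thesis by blast
  qed
  have YM: "?Y \<subseteq> M"
  proof
    fix y assume y: "y \<in> ?Y"
    then have "y \<in> \<Union>\<M>" using Y(1) cover by (auto simp: hereditary_def)
    then obtain N where "N \<in> \<M>" "y \<in> N" by blast
    then show "y \<in> M" using Y_other y by blast
  qed
  have tree_ne: "x \<in> ?tree" using path_ge_refl [OF xv] by simp
  obtain T where T: "CSP_wrt G M T"
      "\<And>Y. Y \<noteq> {} \<Longrightarrow> Y \<subseteq> M \<Longrightarrow> hereditary G Y \<Longrightarrow> saturated G Y \<Longrightarrow> T \<subseteq> Y"
    using M(2) unfolding strong_CSP_def by blast
  obtain t where t: "t \<in> T" using T(1) x(1) unfolding CSP_wrt_def by blast
  then have tM: "t \<in> M" using T(1) unfolding CSP_wrt_def by blast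
  have "Old t \<in> Z" if Z: "Z \<noteq> {}" "hereditary F Z" "saturated F Z" for Z
  proof -
    obtain z where z: "Old z \<in> Z" "z \<in> M"
    proof -
      obtain a where a: "a \<in> Z" "a \<in> verts F" using Z unfolding hereditary_def by blast
      \<comment> \<open>All breaking vertices are in the second component of the pair, so the
        quotient graph has no primed vertices.\<close>
      then obtain z where "a = Old z" "z \<in> verts G - H" by auto
      then show ?thesis using that a(1) VM by blast
    qed
    \<comment> \<open>Downward directedness leads from \<open>z\<close> to a vertex below
      \<open>x\<close>, that is, into \<open>?Y\<close>.\<close>
    obtain w where w: "w \<in> M" "path_ge G z w" "path_ge G x w"
      using tails [OF M(1)] z(2) x(1) unfolding maximal_tail_def downward_directed_def by blast
    have "Old w \<in> Z" using Q.hereditaryD [OF Z(2) z(1) path_ge_lift [OF w(2)]] w(1) VM by blast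
    \<comment> \<open>\<open>Z\<close> is closed only under paths of the quotient graph;
      intersecting with \<open>?Y\<close>, which is hereditary and avoids \<open>H\<close>, yields
      closure under all paths of \<open>G\<close>.\<close>
    let ?W = "{y \<in> ?Y. Old y \<in> Z}"
    have "w \<in> ?W" using \<open>Old w \<in> Z\<close> w(3) Y(3) by blast
    moreover have "?W \<subseteq> M" using YM by blast
    moreover have "hereditary G ?W"
      unfolding hereditary_def
    proof (intro conjI allI impI)
      show "?W \<subseteq> verts G" using YM MV by blast
      fix u v assume u: "u \<in> ?W" "path_ge G u v"
      then have v: "v \<in> ?Y" using hereditaryD [OF Y(1)] by blast
      then have "v \<notin> H" using YM VM by blast
      then have "Old v \<in> Z" using Q.hereditaryD [OF Z(2) _ path_ge_lift [OF u(2)]] u(1) by blast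
      with v show "v \<in> ?W" by blast
    qed
    moreover have "saturated G ?W"
      unfolding saturated_def
    proof (intro conjI allI impI)
      show "?W \<subseteq> verts G" using YM MV by blast
      fix v assume v: "regular G v" "head G ` out_arcs G v \<subseteq> ?W"
      then have vY: "v \<in> ?Y" using Y(2) unfolding saturated_def by blast
      then have "v \<in> verts G" "v \<notin> H" using YM VM by blast+
      then have "regular F (Old v)" using regular_live [OF v(1)] by (simp add: regular_quotient)
      moreover have "Old (head G e) \<in> Z" if "e \<in> out_arcs G v" for e
        using v(2) that by blast
      then have "head F ` out_arcs F (Old v) \<subseteq> Z"
        by (auto simp: out_arcs_quotient live_arcs_def)
      ultimately have "Old v \<in> Z" using Z(3) by (simp add: saturated_def)
      with vY show "v \<in> ?W" by blast
    qed
    ultimately have "T \<subseteq> ?W" by (intro T(2)) blast+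
    then show ?thesis using t by blast
  qed
  then show "\<exists>t. minimal_vertex F t"
    using tM VM unfolding minimal_vertex_def by (intro exI [of _ "Old t"]) auto
qed

definition tail_cover :: "'a set set \<Rightarrow> bool" where
  "tail_cover \<M> \<longleftrightarrow> finite \<M> \<and> (\<forall>M \<in> \<M>. maximal_tail G M \<and> strong_CSP G M) \<and> verts G = \<Union>\<M>"

text \<open>A cover with the fewest members is taken: a tail inside the union of the others could be
  dropped.\<close>

lemma irredundant_tail_cover:
  assumes "tail_cover \<M>"
  obtains \<N> where "tail_cover \<N>" "\<And>M. M \<in> \<N> \<Longrightarrow> \<exists>x \<in> M. \<forall>N \<in> \<N>. N \<noteq> M \<longrightarrow> x \<notin> N"
proof -
  obtain \<N> where N: "tail_cover \<N>" and least: "\<And>\<L>. tail_cover \<L> \<Longrightarrow> card \<N> \<le> card \<L>"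
    using ex_has_least_nat [of tail_cover \<M> card] assms by blast
  have "\<exists>x \<in> M. \<forall>N \<in> \<N>. N \<noteq> M \<longrightarrow> x \<notin> N" if M: "M \<in> \<N>" for M
  proof (rule ccontr)
    assume "\<not> ?thesis"
    then have "M \<subseteq> \<Union>(\<N> - {M})" by blast
    then have "\<Union>(\<N> - {M}) = \<Union>\<N>" by blast
    then have "tail_cover (\<N> - {M})" using N by (auto simp: tail_cover_def)
    then have "card \<N> \<le> card (\<N> - {M})" by (rule least)
    moreover have "card (\<N> - {M}) < card \<N>" using N M by (intro card_Diff1_less) (auto simp: tail_cover_def)
    ultimately show False by simp
  qed
  with N show ?thesis by (rule that)
qed

text \<open>Each completely irreducible member is the kernel onto a quotient graph with a minimal
  vertex, so the vertices outside it form a tail; these tails cover because the null ideal contains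
  no vertex. Conversely, the kernels belonging to an irredundant cover meet in an ideal without
  vertices, which is null by the reduction theorem.\<close>

theorem ci_meet_null_ideal_iff:
  assumes K: "alternating G" and ne: "verts G \<noteq> {}"
  shows "ci_meet G (null_ideal G :: ('a, 'b, 'k::field) lpa_poly set) \<longleftrightarrow> (\<exists>\<M>. tail_cover \<M>)"
proof
  let ?N = "null_ideal G :: ('a, 'b, 'k) lpa_poly set"
  assume "ci_meet G ?N"
  then obtain \<J> where J': "finite \<J>" "\<J> \<noteq> {}" "\<forall>J \<in> \<J>. lid_ci G J" "?N = \<Inter>\<J>"
    unfolding ci_meet_def by (elim exE conjE) (rule that)
  note J = J'(1,2) bspec [OF J'(3)] J'(4)
  have good: "maximal_tail G (verts G - vertices_in I) \<and> strong_CSP G (verts G - vertices_in I)"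
    if I: "I \<in> \<J>" for I
  proof -
    have ci: "lid_ci G I" by (rule J(3) [OF I])
    then have lid: "lid G I" by (simp add: lid_ci_def)
    interpret admissible_quotient G "vertices_in I" "gaps_in I"
      using admissible_pair_in [OF lid] wf_digraph_axioms
      by (simp add: admissible_quotient_def admissible_quotient_axioms_def)
    interpret Q: wf_digraph F by (rule wf_quotient)
    have "lid_ci G (pull (null_ideal F) :: ('a, 'b, 'k) lpa_poly set)"
      by (rule back_subst [of "lid_ci G", OF ci]) (rule ideal_eq_kernel [OF K lid, unfolded kernel_def])
    then have "lid_ci F (null_ideal F :: ('a copy, 'b copy, 'k) lpa_poly set)"
      using lid_ci_pull [OF lid_null_ideal] by blast
    then obtain x where "minimal_vertex F x"
      using Q.null_ideal_ci_iff [OF alternating_quotient [OF K]] unfolding minimal_vertex_def by blast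
    then show ?thesis using tail_of_minimal_vertex by blast
  qed
  have "v \<in> \<Union>((\<lambda>I. verts G - vertices_in I) ` \<J>)" if v: "v \<in> verts G" for v
  proof -
    have "vt v \<notin> \<Inter>\<J>" using vt_notin_null_ideal [OF v] J(4) by blast
    then show ?thesis using v by (auto simp: vertices_in_def)
  qed
  then have "tail_cover ((\<lambda>I. verts G - vertices_in I) ` \<J>)"
    using good J(1) unfolding tail_cover_def by blast
  then show "\<exists>\<M>. tail_cover \<M>" ..
next
  let ?N = "null_ideal G :: ('a, 'b, 'k) lpa_poly set"
  assume "\<exists>\<M>. tail_cover \<M>"
  then obtain \<M> where M: "tail_cover \<M>" "\<And>M. M \<in> \<M> \<Longrightarrow> \<exists>x \<in> M. \<forall>N \<in> \<M>. N \<noteq> M \<longrightarrow> x \<notin> N"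
    using irredundant_tail_cover by (elim exE) blast
  have cover: "finite \<M>" "verts G = \<Union>\<M>"
    "\<And>M. M \<in> \<M> \<Longrightarrow> maximal_tail G M" "\<And>M. M \<in> \<M> \<Longrightarrow> strong_CSP G M"
    using M(1) by (auto simp: tail_cover_def)
  have "\<exists>I :: ('a, 'b, 'k) lpa_poly set. lid_ci G I \<and> vertices_in I = verts G - A" if A: "A \<in> \<M>" for A
  proof -
    let ?H = "verts G - A"
    obtain x where x: "x \<in> A" "\<And>N. N \<in> \<M> \<Longrightarrow> N \<noteq> A \<Longrightarrow> x \<notin> N" using M(2) [OF A] by blast
    note min = minimal_vertex_of_tail [OF cover(2,3) A cover(4) [OF A] x]
    interpret admissible_quotient G ?H "breaking_vertices G ?H"
      using min(1) wf_digraph_axioms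
      by (simp add: admissible_quotient_def admissible_quotient_axioms_def)
    interpret Q: wf_digraph F by (rule wf_quotient)
    have "lid_ci F (null_ideal F :: ('a copy, 'b copy, 'k) lpa_poly set)"
      using Q.null_ideal_ci_iff [OF alternating_quotient [OF K]] min(2) unfolding minimal_vertex_def by blast
    then have "lid_ci G (kernel :: ('a, 'b, 'k) lpa_poly set)"
      by (simp only: kernel_def lid_ci_pull [OF lid_null_ideal])
    moreover have "vertices_in (kernel :: ('a, 'b, 'k) lpa_poly set) = ?H"
      using vt_kernel_iff by (auto simp: vertices_in_def)
    ultimately show ?thesis by blast
  qed
  then obtain I :: "'a set \<Rightarrow> ('a, 'b, 'k) lpa_poly set"
    where I: "\<And>A. A \<in> \<M> \<Longrightarrow> lid_ci G (I A)" "\<And>A. A \<in> \<M> \<Longrightarrow> vertices_in (I A) = verts G - A"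
    by metis
  have Mne: "\<M> \<noteq> {}" using cover(2) ne by auto
  have lid: "lid G (\<Inter>(I ` \<M>))" using I(1) Mne by (intro lid_Inter) (auto simp: lid_ci_def)
  have "\<Inter>(I ` \<M>) = ?N"
  proof (rule ccontr)
    assume "\<Inter>(I ` \<M>) \<noteq> ?N"
    then obtain v where v: "v \<in> verts G" "vt v \<in> \<Inter>(I ` \<M>)"
      using vertex_in_nonzero_ideal [OF K lid] by blast
    then obtain A where A: "A \<in> \<M>" "v \<in> A" using cover(2) by blast
    then have "v \<in> vertices_in (I A)" using v by (auto simp: vertices_in_def)
    then show False using I(2) A by blast
  qed
  then show "ci_meet G ?N"
    unfolding ci_meet_def using cover(1) Mne I(1)
    by (intro exI [of _ "I ` \<M>"]) auto
qed

end

section \<open>From cosets to ideals of the unital free algebra\<close>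

definition gen_polys :: "('v, 'e) pre_digraph \<Rightarrow> ('v, 'e, 'k::field) lpa_poly set" where
  "gen_polys G = {p. \<forall>w \<in> Poly_Mapping.keys p. set (letters w) \<subseteq> generators G}"

text \<open>A retraction: cosets in the algebra involve generators of the graph only, whereas
  \<open>null_ideal\<close> lives among polynomials in all letters.\<close>

definition restr :: "('v, 'e) pre_digraph \<Rightarrow> ('v, 'e, 'k::field) lpa_poly \<Rightarrow> ('v, 'e, 'k) lpa_poly" where
  "restr G = subst (\<lambda>g. if g \<in> generators G then var g else 0)"

lemma gen_polys_add: "p \<in> gen_polys G \<Longrightarrow> q \<in> gen_polys G \<Longrightarrow> p + q \<in> gen_polys G"
  using keys_add [of p q] by (auto simp: gen_polys_def)

lemma gen_polys_diff: "p \<in> gen_polys G \<Longrightarrow> q \<in> gen_polys G \<Longrightarrow> p - q \<in> gen_polys G"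
  using keys_diff [of p q] by (auto simp: gen_polys_def)

lemma gen_polys_mult: "p \<in> gen_polys G \<Longrightarrow> q \<in> gen_polys G \<Longrightarrow> p * q \<in> gen_polys G"
  using keys_mult [of p q] by (fastforce simp: gen_polys_def)

lemma gen_polys_basic:
  "0 \<in> gen_polys G" "kc c \<in> gen_polys G" "g \<in> generators G \<Longrightarrow> var g \<in> gen_polys G"
  by (auto simp: gen_polys_def)

lemmas gen_polys_closed = gen_polys_add gen_polys_diff gen_polys_mult gen_polys_basic

lemma gen_polys_sum: "(\<And>i. i \<in> A \<Longrightarrow> f i \<in> gen_polys G) \<Longrightarrow> (\<Sum>i \<in> A. f i) \<in> gen_polys G"
  by (induction A rule: infinite_finite_induct) (auto simp: gen_polys_closed)

lemma restr_simps [simp]: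
  "restr G 0 = 0" "restr G (p + q) = restr G p + restr G q" "restr G (p - q) = restr G p - restr G q"
  "restr G (- p) = - restr G p" "restr G (p * q) = restr G p * restr G q"
  by (simp_all add: restr_def)

lemma restr_in: "restr G p \<in> gen_polys G"
  unfolding restr_def by (induction p rule: gen_poly_induct) (auto simp: gen_polys_closed)

lemma restr_id:
  fixes p :: "('v, 'e, 'k::field) lpa_poly"
  assumes "p \<in> gen_polys G"
  shows "restr G p = p"
proof -
  have "restr G (Poly_Mapping.single (Word gs) c) = (Poly_Mapping.single (Word gs) c :: ('v, 'e, 'k) lpa_poly)"
    if "set gs \<subseteq> generators G" for gs c
    using that
  proof (induction gs)
    case Nil
    then show ?case by (simp add: Word_Nil restr_def)
  next
    case (Cons g gs)
    then show ?case by (subst (1 2) single_Word_Cons) (simp add: restr_def)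
  qed
  then have w: "restr G (Poly_Mapping.single w (Poly_Mapping.lookup p w)) =
      Poly_Mapping.single w (Poly_Mapping.lookup p w)" if "w \<in> Poly_Mapping.keys p" for w
    using assms that by (cases w) (auto simp: gen_polys_def)
  have "restr G p = (\<Sum>w \<in> Poly_Mapping.keys p. restr G (Poly_Mapping.single w (Poly_Mapping.lookup p w)))"
    unfolding restr_def subst_sum [symmetric] by (rule arg_cong [OF poly_mapping_sum_singles])
  also have "\<dots> = p" unfolding poly_mapping_sum_singles [of p, symmetric] using w
    by (simp only: cong: sum.cong) (simp only: poly_mapping_sum_singles [of p, symmetric])
  finally show ?thesis .
qed

lemma lookup_restr: "Poly_Mapping.lookup (restr G p) 0 = Poly_Mapping.lookup p 0"
  unfolding restr_def by (rule lookup_zero_subst) simp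

lemma restr_augmentation: "p \<in> augmentation \<Longrightarrow> restr G p \<in> augmentation"
  by (simp add: augmentation_def lookup_restr)

lemma carrier_free_algebra: "carrier (free_algebra G) = gen_polys G \<inter> augmentation"
proof -
  have "letters w \<noteq> [] \<longleftrightarrow> w \<noteq> 0" for w :: "('a, 'b) gen gen_word"
    by (cases w) (simp add: zero_gen_word_def)
  then show ?thesis
    by (auto simp: free_algebra_def gen_polys_def augmentation_def in_keys_iff)
qed

locale lpa = wf_digraph G for G :: "('v, 'e) pre_digraph" +
  fixes L :: "('v, 'e, 'k::field) lpa_poly set ring"
  assumes L_def: "L = leavitt_path_algebra TYPE('k) G"
begin

abbreviation "N \<equiv> null_ideal G :: ('v, 'e, 'k) lpa_poly set"
abbreviation "N0 \<equiv> lpa_ideal G :: ('v, 'e, 'k) lpa_poly set"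

lemmas tN = tideal_null_ideal [of G, where ?'c = 'k]

lemma relators_gen_polys: "p \<in> lpa_relators G \<Longrightarrow> p \<in> gen_polys G"
  by (induction rule: lpa_relators.induct)
    (auto intro!: gen_polys_closed gen_polys_sum simp: regular_def)

lemma lpa_ideal_subset: "N0 \<subseteq> N \<inter> gen_polys G"
proof
  fix p assume "p \<in> N0"
  then show "p \<in> N \<inter> gen_polys G"
  proof induction
    case (relator p)
    then show ?case using relators_gen_polys null_ideal_relators [of G] by (auto simp: all_relators_def)
  qed (auto simp: carrier_free_algebra tideal_zero [OF tN] tideal_add [OF tN] tideal_mult_left [OF tN]
      tideal_mult_right [OF tN] gen_polys_closed)
qed

lemma gen_polys_decompose:
  assumes "p \<in> gen_polys G"
  obtains c q where "p = kc c + q" "q \<in> carrier (free_algebra G)"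
proof -
  let ?c = "kc (Poly_Mapping.lookup p 0)"
  have "p - ?c \<in> carrier (free_algebra G)"
    using assms by (auto simp: carrier_free_algebra gen_polys_closed augmentation_def lookup_minus)
  then show ?thesis using that [of _ "p - ?c"] by simp
qed

lemma lpa_ideal_mult:
  assumes "p \<in> N0" "x \<in> gen_polys G"
  shows "x * p \<in> N0" "p * x \<in> N0"
proof -
  obtain c q where x: "x = kc c + q" "q \<in> carrier (free_algebra G)"
    using gen_polys_decompose [OF assms(2)] .
  have c: "kc c * p \<in> N0" by (rule lpa_ideal.scale [OF assms(1)])
  show "x * p \<in> N0" unfolding x(1) distrib_right
    by (intro lpa_ideal.add c lpa_ideal.mult_left assms x)
  show "p * x \<in> N0" unfolding x(1) distrib_left const_mult_commute [of c p, symmetric]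
    by (intro lpa_ideal.add c lpa_ideal.mult_right assms x)
qed

text \<open>The polynomials whose restriction lies in \<open>lpa_ideal\<close> form an ideal
  containing all relators. Together with \<open>lpa_ideal_subset\<close> this shows that
  \<open>lpa_ideal\<close> is the part of \<open>null_ideal\<close> written in generators.\<close>

lemma null_ideal_restr: "p \<in> N \<Longrightarrow> restr G p \<in> N0"
proof -
  have "tideal {p. restr G p \<in> N0}"
    unfolding tideal_def by (auto intro: lpa_ideal.intros lpa_ideal_mult restr_in)
  moreover have "all_relators G \<subseteq> {p. restr G p \<in> N0}"
  proof
    fix p :: "('v, 'e, 'k) lpa_poly" assume "p \<in> all_relators G"
    then consider "p \<in> lpa_relators G" | g where "p = var g" "g \<notin> generators G"
      by (auto simp: all_relators_def)
    then show "p \<in> {p. restr G p \<in> N0}"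
    proof cases
      case 1
      then show ?thesis using restr_id [OF relators_gen_polys [OF 1]] by (simp add: lpa_ideal.relator)
    next
      case 2
      then show ?thesis by (simp add: restr_def lpa_ideal.zero)
    qed
  qed
  ultimately have "N \<subseteq> {p. restr G p \<in> N0}" by (rule null_ideal_least)
  then show "p \<in> N \<Longrightarrow> restr G p \<in> N0" by blast
qed

lemma restr_eqv: "restr G p \<simeq>\<^bsub>N\<^esub> p"
proof (induction p rule: gen_poly_induct)
  case (const c)
  then show ?case by (simp add: restr_def eqv_refl [OF tN])
next
  case (var_mult g p)
  have "restr G (var g) \<simeq>\<^bsub>N\<^esub> var g"
    using nongenerator_mem [OF tN null_ideal_relators, of g] tideal_uminus [OF tN, of "var g"]
    by (auto simp: restr_def eqv_def tideal_zero [OF tN])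
  then show ?case unfolding restr_simps by (rule eqv_mult [OF tN _ var_mult])
next
  case (add p q)
  then show ?case unfolding restr_simps by (rule eqv_add [OF tN])
qed

text \<open>The coset map made total by restricting to generators first, so that congruent
  polynomials in any letters represent the same coset.\<close>

definition cls :: "('v, 'e, 'k) lpa_poly \<Rightarrow> ('v, 'e, 'k) lpa_poly set" where
  "cls p = (\<lambda>h. h + restr G p) ` N0"

lemma coset_eq: "N0 +>\<^bsub>free_algebra G\<^esub> a = (\<lambda>h. h + a) ` N0"
  by (auto simp: a_r_coset_def r_coset_def free_algebra_def)

lemma cls_coset: "a \<in> gen_polys G \<Longrightarrow> N0 +>\<^bsub>free_algebra G\<^esub> a = cls a"
  by (simp add: coset_eq cls_def restr_id)

lemma lpa_ideal_diff: "p \<in> N0 \<Longrightarrow> q \<in> N0 \<Longrightarrow> p - q \<in> N0"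
  using lpa_ideal.add [of p G "kc (- 1) * q"] lpa_ideal.scale [of q G "- 1"]
  by (simp add: single_uminus)

lemma cls_eq_iff: "cls p = cls q \<longleftrightarrow> p \<simeq>\<^bsub>N\<^esub> q"
proof
  assume "cls p = cls q"
  moreover have "restr G p \<in> cls p" using lpa_ideal.zero by (force simp: cls_def)
  ultimately obtain h where "h \<in> N0" "restr G p = h + restr G q" by (auto simp: cls_def)
  then have "restr G p \<simeq>\<^bsub>N\<^esub> restr G q" using lpa_ideal_subset by (auto simp: eqv_def)
  then show "p \<simeq>\<^bsub>N\<^esub> q"
    using eqv_trans [OF tN eqv_trans [OF tN eqv_sym [OF tN restr_eqv]] restr_eqv] by blast
next
  assume "p \<simeq>\<^bsub>N\<^esub> q"
  then have h: "restr G p - restr G q \<in> N0" using null_ideal_restr [of "p - q"] by (simp add: eqv_def)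
  have "h + restr G p \<in> cls q" if "h \<in> N0" for h
  proof -
    have "h + restr G p = (h + (restr G p - restr G q)) + restr G q" by simp
    then show ?thesis unfolding cls_def using lpa_ideal.add [OF that h] by blast
  qed
  moreover have "h' + restr G q \<in> cls p" if "h' \<in> N0" for h'
  proof -
    have "h' + restr G q = (h' - (restr G p - restr G q)) + restr G p" by simp
    then show ?thesis unfolding cls_def using lpa_ideal_diff [OF that h] by blast
  qed
  ultimately show "cls p = cls q" by (auto simp: cls_def)
qed

lemma carrier_L: "carrier L = cls ` augmentation"
proof -
  have "carrier L = (\<lambda>a. N0 +>\<^bsub>free_algebra G\<^esub> a) ` carrier (free_algebra G)"
    by (auto simp: L_def leavitt_path_algebra_def FactRing_def A_RCOSETS_def' a_r_coset_def)
  also have "\<dots> = cls ` (gen_polys G \<inter> augmentation)"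
    by (rule image_cong) (simp_all add: carrier_free_algebra cls_coset)
  also have "\<dots> = cls ` augmentation"
  proof -
    have "cls p \<in> cls ` (gen_polys G \<inter> augmentation)" if "p \<in> augmentation" for p
      using that restr_in restr_augmentation cls_eq_iff [of p "restr G p"] eqv_sym [OF tN restr_eqv] by blast
    then show ?thesis by blast
  qed
  finally show ?thesis .
qed

lemma zero_L: "\<zero>\<^bsub>L\<^esub> = cls 0"
  by (simp add: L_def leavitt_path_algebra_def FactRing_def cls_def)

lemma add_L: "cls p \<oplus>\<^bsub>L\<^esub> cls q = cls (p + q)"
proof -
  have "cls p \<oplus>\<^bsub>L\<^esub> cls q = {a + b | a b. a \<in> cls p \<and> b \<in> cls q}"
    by (auto simp: L_def leavitt_path_algebra_def FactRing_def set_add_def set_mult_def free_algebra_def)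
  also have "\<dots> = cls (p + q)"
  proof (intro equalityI subsetI)
    fix x assume "x \<in> {a + b | a b. a \<in> cls p \<and> b \<in> cls q}"
    then obtain h k where hk: "h \<in> N0" "k \<in> N0" "x = (h + k) + restr G (p + q)"
      by (auto simp: cls_def algebra_simps)
    then show "x \<in> cls (p + q)" unfolding cls_def by (blast intro: lpa_ideal.add)
  next
    fix x assume "x \<in> cls (p + q)"
    then obtain h where "h \<in> N0" "x = (h + restr G p) + (0 + restr G q)" by (auto simp: cls_def add.assoc)
    then show "x \<in> {a + b | a b. a \<in> cls p \<and> b \<in> cls q}"
      unfolding cls_def using lpa_ideal.zero by blast
  qed
  finally show ?thesis .
qed

lemma mult_L: "cls p \<otimes>\<^bsub>L\<^esub> cls q = cls (p * q)"
proof -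
  have "cls p \<otimes>\<^bsub>L\<^esub> cls q = (\<Union>a \<in> cls p. \<Union>b \<in> cls q. N0 +>\<^bsub>free_algebra G\<^esub> (a * b))"
    by (simp add: L_def leavitt_path_algebra_def FactRing_def rcoset_mult_def free_algebra_def)
  also have "\<dots> = (\<Union>a \<in> cls p. \<Union>b \<in> cls q. cls (p * q))"
  proof (intro SUP_cong refl)
    fix a b assume "a \<in> cls p" "b \<in> cls q"
    then obtain h k where h: "h \<in> N0" "a = h + restr G p" and k: "k \<in> N0" "b = k + restr G q"
      by (auto simp: cls_def)
    have ab: "a \<in> gen_polys G" "b \<in> gen_polys G"
      using h k lpa_ideal_subset restr_in by (auto intro!: gen_polys_closed)
    have e: "a \<simeq>\<^bsub>N\<^esub> restr G p" "b \<simeq>\<^bsub>N\<^esub> restr G q"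
      using h k lpa_ideal_subset by (auto simp: eqv_def)
    have "a * b \<simeq>\<^bsub>N\<^esub> p * q"
      by (rule eqv_mult [OF tN eqv_trans [OF tN e(1) restr_eqv] eqv_trans [OF tN e(2) restr_eqv]])
    then show "N0 +>\<^bsub>free_algebra G\<^esub> (a * b) = cls (p * q)"
      using ab by (simp add: cls_coset gen_polys_closed cls_eq_iff)
  qed
  also have "\<dots> = cls (p * q)" using lpa_ideal.zero [of G] by (auto simp: cls_def)
  finally show ?thesis .
qed

section \<open>Translation between ideals of the algebra and ideals of the free algebra\<close>

definition lift_ideal :: "('v, 'e, 'k) lpa_poly set set \<Rightarrow> ('v, 'e, 'k) lpa_poly set" where
  "lift_ideal I = {p \<in> augmentation. cls p \<in> I}"

lemma two_sided_ideal_carrier: "two_sided_ideal L I \<Longrightarrow> I \<subseteq> carrier L"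
  unfolding two_sided_ideal_def using additive_subgroup.a_subset by blast

text \<open>A set of cosets closed under addition and multiplication by elements is closed under scalars,
  since the algebra has local units.\<close>
lemma lid_lift_ideal:
  assumes zero: "cls 0 \<in> I" and add: "\<And>p q. p \<in> augmentation \<Longrightarrow> q \<in> augmentation \<Longrightarrow> cls p \<in> I \<Longrightarrow> cls q \<in> I \<Longrightarrow> cls (p + q) \<in> I"
    and mult: "\<And>p x. p \<in> augmentation \<Longrightarrow> x \<in> augmentation \<Longrightarrow> cls p \<in> I \<Longrightarrow> cls (x * p) \<in> I \<and> cls (p * x) \<in> I"
  shows "lid G (lift_ideal I)"
proof -
  note ta = tideal_augmentation
  have scale: "cls (kc c * p) \<in> I" if p: "p \<in> augmentation" "cls p \<in> I" for c p
  proof -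
    obtain Y where Y: "(\<Sum>v \<in> Y. vt v) * p \<simeq>\<^bsub>N\<^esub> p"
      using local_unit_left [OF tN null_ideal_relators p(1)] .
    have "kc c * (\<Sum>v \<in> Y. vt v) \<in> augmentation"
      by (intro tideal_mult_left [OF ta] tideal_sum [OF ta]) simp
    then have "cls (kc c * (\<Sum>v \<in> Y. vt v) * p) \<in> I" using mult [OF p(1) _ p(2)] by blast
    moreover have "kc c * ((\<Sum>v \<in> Y. vt v) * p) \<simeq>\<^bsub>N\<^esub> kc c * p"
      by (intro eqv_mult [OF tN] eqv_refl [OF tN] Y)
    then have "cls (kc c * ((\<Sum>v \<in> Y. vt v) * p)) = cls (kc c * p)" unfolding cls_eq_iff .
    ultimately show ?thesis by (simp only: mult.assoc)
  qed
  have "cls (x * p) \<in> I \<and> cls (p * x) \<in> I" if p: "p \<in> augmentation" "cls p \<in> I" for x p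
  proof -
    let ?c = "kc (Poly_Mapping.lookup x 0)"
    have x: "x - ?c \<in> augmentation" by (simp add: augmentation_def lookup_minus)
    have m: "(x - ?c) * p \<in> augmentation" "p * (x - ?c) \<in> augmentation" "?c * p \<in> augmentation"
      using p(1) by (auto intro: tideal_mult_left [OF ta] tideal_mult_right [OF ta])
    have "cls ((x - ?c) * p + ?c * p) \<in> I" "cls (p * (x - ?c) + ?c * p) \<in> I"
      using mult [OF p(1) x p(2)] scale [OF p] m by (auto intro!: add)
    then show ?thesis using const_mult_commute [of _ p] by (simp add: algebra_simps)
  qed
  then have "tideal (lift_ideal I)"
    unfolding tideal_def lift_ideal_def using zero add ta by (auto simp: tideal_def)
  moreover have "all_relators G \<subseteq> lift_ideal I"
  proof
    fix p :: "('v, 'e, 'k) lpa_poly" assume p: "p \<in> all_relators G"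
    then have "p \<simeq>\<^bsub>N\<^esub> 0" using null_ideal_relators by (auto simp: eqv_zero_iff)
    then have "cls p = cls 0" unfolding cls_eq_iff .
    then show "p \<in> lift_ideal I"
      using p all_relators_subset_augmentation [of G] zero by (auto simp: lift_ideal_def)
  qed
  ultimately show ?thesis by (auto simp: lid_def lift_ideal_def)
qed

lemma lid_lift:
  assumes "two_sided_ideal L I"
  shows "lid G (lift_ideal I)"
proof (rule lid_lift_ideal)
  have sub: "additive_subgroup I L" and
    mult: "\<And>a x. a \<in> I \<Longrightarrow> x \<in> carrier L \<Longrightarrow> x \<otimes>\<^bsub>L\<^esub> a \<in> I \<and> a \<otimes>\<^bsub>L\<^esub> x \<in> I"
    using assms by (auto simp: two_sided_ideal_def)
  show "cls 0 \<in> I" using additive_subgroup.zero_closed [OF sub] by (simp add: zero_L)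
  show "cls (p + q) \<in> I" if "cls p \<in> I" "cls q \<in> I" for p q
    using additive_subgroup.a_closed [OF sub that] by (simp add: add_L)
  show "cls (x * p) \<in> I \<and> cls (p * x) \<in> I" if "x \<in> augmentation" "cls p \<in> I" for p x
    using mult [OF that(2), of "cls x"] that(1) by (simp add: carrier_L mult_L)
qed

lemma two_sided_ideal_cls:
  assumes U: "lid G U"
  shows "two_sided_ideal L (cls ` U)"
  unfolding two_sided_ideal_def
proof (intro conjI ballI)
  have t: "tideal U" and aug: "U \<subseteq> augmentation" using U by (auto simp: lid_def)
  \<comment> \<open>The additive inverse is given by a definite description, so the class of
    \<open>- p\<close> has to be shown to be the only candidate.\<close>
  have inv: "inv\<^bsub>add_monoid L\<^esub> cls p = cls (- p)" if p: "p \<in> U" for p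
    unfolding m_inv_def
  proof (rule the_equality)
    have "- p \<in> augmentation" using p aug tideal_uminus [OF t] by blast
    then show "cls (- p) \<in> carrier (add_monoid L) \<and> cls p \<otimes>\<^bsub>add_monoid L\<^esub> cls (- p) = \<one>\<^bsub>add_monoid L\<^esub> \<and>
        cls (- p) \<otimes>\<^bsub>add_monoid L\<^esub> cls p = \<one>\<^bsub>add_monoid L\<^esub>"
      by (simp add: carrier_L add_L zero_L)
  next
    fix y assume y: "y \<in> carrier (add_monoid L) \<and> cls p \<otimes>\<^bsub>add_monoid L\<^esub> y = \<one>\<^bsub>add_monoid L\<^esub> \<and>
        y \<otimes>\<^bsub>add_monoid L\<^esub> cls p = \<one>\<^bsub>add_monoid L\<^esub>"
    then obtain q where q: "y = cls q" by (auto simp: carrier_L)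
    have "p + q \<simeq>\<^bsub>N\<^esub> 0" using y by (simp add: q add_L zero_L cls_eq_iff)
    then have "q \<simeq>\<^bsub>N\<^esub> - p" by (simp add: eqv_def add.commute)
    then show "y = cls (- p)" by (simp add: q cls_eq_iff)
  qed
  show "additive_subgroup (cls ` U) L"
  proof (intro additive_subgroup.intro subgroup.intro)
    show "cls ` U \<subseteq> carrier (add_monoid L)" using aug by (auto simp: carrier_L)
    show "x \<otimes>\<^bsub>add_monoid L\<^esub> y \<in> cls ` U" if "x \<in> cls ` U" "y \<in> cls ` U" for x y
      using that tideal_add [OF t] by (auto simp: add_L)
    show "\<one>\<^bsub>add_monoid L\<^esub> \<in> cls ` U" using tideal_zero [OF t] by (simp add: zero_L)
    show "inv\<^bsub>add_monoid L\<^esub> x \<in> cls ` U" if "x \<in> cls ` U" for x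
      using that inv tideal_uminus [OF t] by auto
  qed
  fix a x assume "a \<in> cls ` U" "x \<in> carrier L"
  then show "x \<otimes>\<^bsub>L\<^esub> a \<in> cls ` U" "a \<otimes>\<^bsub>L\<^esub> x \<in> cls ` U"
    using tideal_mult_left [OF t] tideal_mult_right [OF t] by (auto simp: carrier_L mult_L)
qed

lemma lift_cls:
  assumes U: "lid G U"
  shows "lift_ideal (cls ` U) = U"
proof -
  have "p \<in> U" if "cls p = cls q" "q \<in> U" for p q
    using that eqv_mem_iff [OF lid_tideal [OF U] eqv_mono [OF null_ideal_subset [OF U]]] by (simp add: cls_eq_iff)
  then show ?thesis using U by (auto simp: lift_ideal_def lid_def)
qed

lemma cls_lift: "I \<subseteq> carrier L \<Longrightarrow> cls ` lift_ideal I = I"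
  by (auto simp: lift_ideal_def carrier_L)

lemma lift_mono_iff: "I \<subseteq> carrier L \<Longrightarrow> J \<subseteq> carrier L \<Longrightarrow> lift_ideal I \<subseteq> lift_ideal J \<longleftrightarrow> I \<subseteq> J"
  using image_mono [of "lift_ideal I" "lift_ideal J" cls] cls_lift [of I] cls_lift [of J]
  by (auto simp: lift_ideal_def)

lemma lift_inject: "I \<subseteq> carrier L \<Longrightarrow> J \<subseteq> carrier L \<Longrightarrow> lift_ideal I = lift_ideal J \<longleftrightarrow> I = J"
  by (metis cls_lift)

lemma lift_carrier: "lift_ideal (carrier L) = augmentation"
  by (auto simp: lift_ideal_def carrier_L)

lemma lift_Inter: "\<J> \<noteq> {} \<Longrightarrow> lift_ideal (\<Inter>\<J>) = \<Inter>(lift_ideal ` \<J>)"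
  by (auto simp: lift_ideal_def)

lemma two_sided_idealI:
  assumes "I \<subseteq> carrier L" "lid G (lift_ideal I)"
  shows "two_sided_ideal L I"
  using two_sided_ideal_cls [OF assms(2)] cls_lift [OF assms(1)] by simp

lemma proper_ideal_iff:
  "proper_ideal L I \<longleftrightarrow> two_sided_ideal L I \<and> lift_ideal I \<noteq> augmentation"
  using lift_inject [OF two_sided_ideal_carrier subset_refl]
  by (auto simp: proper_ideal_def lift_carrier)

lemma completely_irreducible_iff:
  "completely_irreducible L I \<longleftrightarrow> two_sided_ideal L I \<and> lid_ci G (lift_ideal I)"
proof (cases "proper_ideal L I")
  case False
  then show ?thesis by (auto simp: completely_irreducible_def lid_ci_def proper_ideal_iff)
next
  case True
  then have I: "two_sided_ideal L I" "lift_ideal I \<noteq> augmentation" by (auto simp: proper_ideal_iff)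
  note IC = two_sided_ideal_carrier [OF I(1)]
  have "(\<exists>\<J>. \<J> \<noteq> {} \<and> (\<forall>J \<in> \<J>. two_sided_ideal L J \<and> I \<subset> J) \<and> I = \<Inter>\<J>) \<longleftrightarrow>
      (\<exists>\<J>. \<J> \<noteq> {} \<and> (\<forall>J \<in> \<J>. lid G J \<and> lift_ideal I \<subset> J) \<and> lift_ideal I = \<Inter>\<J>)"
  proof
    assume "\<exists>\<J>. \<J> \<noteq> {} \<and> (\<forall>J \<in> \<J>. two_sided_ideal L J \<and> I \<subset> J) \<and> I = \<Inter>\<J>"
    then obtain \<J> where J: "\<J> \<noteq> {}" "\<forall>J \<in> \<J>. two_sided_ideal L J \<and> I \<subset> J" "I = \<Inter>\<J>"
      by (elim exE conjE) (rule that)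
    show "\<exists>\<J>. \<J> \<noteq> {} \<and> (\<forall>J \<in> \<J>. lid G J \<and> lift_ideal I \<subset> J) \<and> lift_ideal I = \<Inter>\<J>"
    proof (intro exI conjI ballI)
      show "lift_ideal ` \<J> \<noteq> {}" using J(1) by simp
      show "lift_ideal I = \<Inter>(lift_ideal ` \<J>)" using lift_Inter [OF J(1)] J(3) by simp
      fix K assume "K \<in> lift_ideal ` \<J>"
      then obtain J' where J': "J' \<in> \<J>" "K = lift_ideal J'" by blast
      then have i: "two_sided_ideal L J'" "I \<subset> J'" using J(2) by auto
      then show "lid G K" by (simp add: J'(2) lid_lift)
      show "lift_ideal I \<subset> K"
        using i(2) lift_mono_iff [OF IC two_sided_ideal_carrier [OF i(1)]]
          lift_inject [OF IC two_sided_ideal_carrier [OF i(1)]] by (auto simp: J'(2))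
    qed
  next
    assume "\<exists>\<J>. \<J> \<noteq> {} \<and> (\<forall>J \<in> \<J>. lid G J \<and> lift_ideal I \<subset> J) \<and> lift_ideal I = \<Inter>\<J>"
    then obtain \<J> where J: "\<J> \<noteq> {}" "\<forall>J \<in> \<J>. lid G J \<and> lift_ideal I \<subset> J" "lift_ideal I = \<Inter>\<J>"
      by (elim exE conjE) (rule that)
    let ?\<K> = "(`) cls ` \<J>"
    have lifts: "lift_ideal ` ?\<K> = \<J>"
      using J(2) by (auto simp: image_image lift_cls intro!: image_eqI)
    obtain V where V: "V \<in> \<J>" using J(1) by blast
    then have "cls ` V \<subseteq> carrier L" using J(2) by (auto simp: carrier_L lid_def)
    then have sub: "\<Inter>?\<K> \<subseteq> carrier L" using V by blast
    show "\<exists>\<J>. \<J> \<noteq> {} \<and> (\<forall>J \<in> \<J>. two_sided_ideal L J \<and> I \<subset> J) \<and> I = \<Inter>\<J>"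
    proof (intro exI conjI ballI)
      show ne: "?\<K> \<noteq> {}" using J(1) by simp
      have "lift_ideal (\<Inter>?\<K>) = lift_ideal I" using lift_Inter [OF ne] lifts J(3) by simp
      then show "I = \<Inter>?\<K>" using lift_inject [OF sub IC] by simp
      fix K assume "K \<in> ?\<K>"
      then obtain U where U: "U \<in> \<J>" "K = cls ` U" by blast
      then have i: "lid G U" "lift_ideal I \<subset> U" using J(2) by auto
      show K: "two_sided_ideal L K" unfolding U(2) by (rule two_sided_ideal_cls [OF i(1)])
      have "lift_ideal K = U" unfolding U(2) by (rule lift_cls [OF i(1)])
      then show "I \<subset> K"
        using i(2) lift_mono_iff [OF IC two_sided_ideal_carrier [OF K]] by (auto simp: psubset_eq)
    qed
  qed
  then show ?thesis
    using True I lid_lift [OF I(1)] by (simp add: completely_irreducible_def lid_ci_def)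
qed

end

section \<open>Products of ideals\<close>

context lpa
begin

lemma obtain_lift:
  assumes "two_sided_ideal L I" "i \<in> I"
  obtains a where "a \<in> lift_ideal I" "i = cls a"
  using cls_lift [OF two_sided_ideal_carrier [OF assms(1)]] assms(2) by blast

text \<open>The multipliers \<open>x\<close> range over all polynomials, constants included: one of
  the two factors absorbs \<open>x\<close>, because lifted ideals are closed under constants
  too.\<close>

lemma ideal_prod_closed:
  assumes I: "two_sided_ideal L I" and J: "two_sided_ideal L J" and c: "c \<in> ideal_prod L I J"
  shows "\<exists>p \<in> augmentation. c = cls p \<and> (\<forall>x. cls (x * p) \<in> ideal_prod L I J \<and> cls (p * x) \<in> ideal_prod L I J)"
  using c
proof induction
  case (prod i j)
  obtain a where a: "a \<in> lift_ideal I" "i = cls a" using obtain_lift [OF I prod(1)] .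
  obtain b where b: "b \<in> lift_ideal J" "j = cls b" using obtain_lift [OF J prod(2)] .
  have tI: "tideal (lift_ideal I)" "tideal (lift_ideal J)"
    using lid_tideal lid_lift I J by blast+
  have "a \<in> augmentation" using a(1) by (simp add: lift_ideal_def)
  then have "a * b \<in> augmentation" by (rule tideal_mult_right [OF tideal_augmentation])
  moreover have "cls (x * (a * b)) \<in> ideal_prod L I J" for x
  proof -
    have "cls (x * a) \<in> I" using tideal_mult_left [OF tI(1) a(1), of x] by (simp add: lift_ideal_def)
    then have "cls (x * a) \<otimes>\<^bsub>L\<^esub> cls b \<in> ideal_prod L I J" using prod(2) b by (intro ideal_prod.prod) simp_all
    then show ?thesis by (simp add: mult_L mult.assoc)
  qed
  moreover have "cls (a * b * x) \<in> ideal_prod L I J" for x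
  proof -
    have "cls (b * x) \<in> J" using tideal_mult_right [OF tI(2) b(1), of x] by (simp add: lift_ideal_def)
    then have "cls a \<otimes>\<^bsub>L\<^esub> cls (b * x) \<in> ideal_prod L I J" using prod(1) a by (intro ideal_prod.prod) simp_all
    then show ?thesis by (simp add: mult_L mult.assoc)
  qed
  ultimately show ?case by (intro bexI [of _ "a * b"]) (simp_all add: a b mult_L)
next
  case (sum c d)
  obtain p where p: "p \<in> augmentation" "c = cls p"
      "\<And>x. cls (x * p) \<in> ideal_prod L I J" "\<And>x. cls (p * x) \<in> ideal_prod L I J"
    using sum.IH(1) by blast
  obtain q where q: "q \<in> augmentation" "d = cls q"
      "\<And>x. cls (x * q) \<in> ideal_prod L I J" "\<And>x. cls (q * x) \<in> ideal_prod L I J"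
    using sum.IH(2) by blast
  have "p + q \<in> augmentation" by (rule tideal_add [OF tideal_augmentation p(1) q(1)])
  moreover have "cls (x * (p + q)) \<in> ideal_prod L I J" for x
    using ideal_prod.sum [OF p(3) [of x] q(3) [of x]] by (simp add: add_L distrib_left)
  moreover have "cls ((p + q) * x) \<in> ideal_prod L I J" for x
    using ideal_prod.sum [OF p(4) [of x] q(4) [of x]] by (simp add: add_L distrib_right)
  ultimately show ?case by (intro bexI [of _ "p + q"]) (simp_all add: p(2) q(2) add_L)
qed

lemma two_sided_ideal_prod:
  assumes I: "two_sided_ideal L I" and J: "two_sided_ideal L J"
  shows "two_sided_ideal L (ideal_prod L I J)"
proof (rule two_sided_idealI)
  show "ideal_prod L I J \<subseteq> carrier L"
    using ideal_prod_closed [OF I J] by (auto simp: carrier_L)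
  show "lid G (lift_ideal (ideal_prod L I J))"
  proof (rule lid_lift_ideal)
    have "cls 0 \<in> I" "cls 0 \<in> J"
      using tideal_zero [OF lid_tideal [OF lid_lift [OF I]]] tideal_zero [OF lid_tideal [OF lid_lift [OF J]]]
      by (simp_all add: lift_ideal_def)
    then have "cls 0 \<otimes>\<^bsub>L\<^esub> cls 0 \<in> ideal_prod L I J" by (rule ideal_prod.prod)
    then show "cls 0 \<in> ideal_prod L I J" by (simp add: mult_L)
    show "cls (p + q) \<in> ideal_prod L I J" if "cls p \<in> ideal_prod L I J" "cls q \<in> ideal_prod L I J" for p q
      using ideal_prod.sum [OF that] by (simp add: add_L)
    fix p x assume "cls p \<in> ideal_prod L I J"
    then obtain q where q: "cls p = cls q" "cls (x * q) \<in> ideal_prod L I J" "cls (q * x) \<in> ideal_prod L I J"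
      using ideal_prod_closed [OF I J] by blast
    have "cls (x * p) = cls (x * q)" "cls (p * x) = cls (q * x)"
      unfolding mult_L [symmetric] q(1) by (rule refl)+
    then show "cls (x * p) \<in> ideal_prod L I J \<and> cls (p * x) \<in> ideal_prod L I J" using q by simp
  qed
qed

lemma mult_in_lift_prod:
  assumes "a \<in> lift_ideal I" "b \<in> lift_ideal J"
  shows "a * b \<in> lift_ideal (ideal_prod L I J)"
proof -
  have "cls a \<otimes>\<^bsub>L\<^esub> cls b \<in> ideal_prod L I J" using assms by (intro ideal_prod.prod) (simp_all add: lift_ideal_def)
  moreover have "a * b \<in> augmentation"
    using assms by (intro tideal_mult_right [OF tideal_augmentation]) (simp add: lift_ideal_def)
  ultimately show ?thesis by (simp add: lift_ideal_def mult_L)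
qed

lemma ideal_prod_subset:
  assumes I: "two_sided_ideal L I" and J: "two_sided_ideal L J"
  shows "ideal_prod L I J \<subseteq> I" "ideal_prod L I J \<subseteq> J"
proof -
  have t: "c \<oplus>\<^bsub>L\<^esub> d \<in> A" if A: "two_sided_ideal L A" "c \<in> A" "d \<in> A" for A c d
    using A unfolding two_sided_ideal_def by (auto intro: additive_subgroup.a_closed)
  have "c \<in> I \<inter> J" if "c \<in> ideal_prod L I J" for c
    using that
  proof induction
    case (prod i j)
    then have "i \<in> carrier L" "j \<in> carrier L" using two_sided_ideal_carrier I J by blast+
    then show ?case using prod I J by (simp add: two_sided_ideal_def)
  next
    case (sum c d)
    then show ?case using t [OF I] t [OF J] by simp
  qed
  then show "ideal_prod L I J \<subseteq> I" "ideal_prod L I J \<subseteq> J" by blast+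
qed

lemma ideal_prod_mono:
  assumes "I \<subseteq> I'" "J \<subseteq> J'"
  shows "ideal_prod L I J \<subseteq> ideal_prod L I' J'"
proof
  fix c assume "c \<in> ideal_prod L I J"
  then show "c \<in> ideal_prod L I' J'"
    by induction (use assms in \<open>auto intro: ideal_prod.intros\<close>)
qed

lemma two_sided_ideal_list_prod:
  assumes "Js \<noteq> []" "\<And>J. J \<in> set Js \<Longrightarrow> two_sided_ideal L J"
  shows "two_sided_ideal L (ideal_list_prod L Js) \<and> ideal_list_prod L Js \<subseteq> \<Inter>(set Js)"
  using assms
proof (induction Js rule: induct_list012)
  case (3 I J Js)
  then have IH: "two_sided_ideal L (ideal_list_prod L (J # Js))"
    "ideal_list_prod L (J # Js) \<subseteq> \<Inter>(set (J # Js))" and I: "two_sided_ideal L I" by simp_all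
  have "ideal_list_prod L (I # J # Js) \<subseteq> I \<inter> \<Inter>(set (J # Js))"
    using ideal_prod_subset [OF I IH(1)] IH(2) by auto
  then show ?case using two_sided_ideal_prod [OF I IH(1)] by simp
qed simp_all

lemma prime_list_prod:
  assumes prime: "lid_prime G (lift_ideal I)" and I: "two_sided_ideal L I"
    and Js: "Js \<noteq> []" "\<And>J. J \<in> set Js \<Longrightarrow> two_sided_ideal L J" "ideal_list_prod L Js \<subseteq> I"
  shows "\<exists>J \<in> set Js. J \<subseteq> I"
  using Js
proof (induction Js rule: induct_list012)
  case (3 J K Js)
  let ?P = "ideal_list_prod L (K # Js)"
  have J: "two_sided_ideal L J" and P: "two_sided_ideal L ?P"
    using 3(4) two_sided_ideal_list_prod [of "K # Js"] by simp_all
  have "a * b \<in> lift_ideal I" if "a \<in> lift_ideal J" "b \<in> lift_ideal ?P" for a b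
    using mult_in_lift_prod [OF that] 3(5) by (auto simp: lift_ideal_def)
  then have "lift_ideal J \<subseteq> lift_ideal I \<or> lift_ideal ?P \<subseteq> lift_ideal I"
    using prime lid_lift [OF J] lid_lift [OF P] unfolding lid_prime_def by blast
  then have "J \<subseteq> I \<or> ?P \<subseteq> I"
    using lift_mono_iff two_sided_ideal_carrier I J P by blast
  then show ?case using 3 by auto
qed simp_all

text \<open>A product is contained in the intersection of its factors, so primeness with respect to
  products applies.\<close>

lemma prime_finite_Inter:
  assumes "lid_prime G (lift_ideal I)" "two_sided_ideal L I" "finite \<J>" "\<J> \<noteq> {}"
    "\<And>J. J \<in> \<J> \<Longrightarrow> two_sided_ideal L J" "\<Inter>\<J> \<subseteq> I"
  shows "\<exists>J \<in> \<J>. J \<subseteq> I"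
proof -
  obtain Js where Js: "set Js = \<J>" using finite_list [OF assms(3)] by blast
  then have ne: "Js \<noteq> []" using assms(4) by auto
  then have "ideal_list_prod L Js \<subseteq> I"
    using two_sided_ideal_list_prod [of Js] assms(5,6) Js by blast
  then show ?thesis using prime_list_prod [OF assms(1,2) ne] assms(5) Js by blast
qed

section \<open>Ideals under condition (K)\<close>

text \<open>An ideal is determined by the vertices and gap projections it contains, which are idempotents.\<close>
lemma ideal_idempotent:
  assumes K: "alternating G" and I: "two_sided_ideal L I"
  shows "ideal_prod L I I = I"
proof -
  let ?P = "ideal_prod L I I"
  have P: "two_sided_ideal L ?P" by (rule two_sided_ideal_prod [OF I I])
  have lI: "lid G (lift_ideal I)" and lP: "lid G (lift_ideal ?P)" by (rule lid_lift [OF I], rule lid_lift [OF P])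
  have sub: "lift_ideal ?P \<subseteq> lift_ideal I" using ideal_prod_subset(1) [OF I I] by (auto simp: lift_ideal_def)
  have idem: "a \<in> lift_ideal ?P" if "a \<in> lift_ideal I" "a * a \<simeq>\<^bsub>N\<^esub> a" for a
    using mult_in_lift_prod [OF that(1,1)] eqv_mem_iff [OF lid_tideal [OF lP] eqv_mono [OF null_ideal_subset [OF lP] that(2)]]
    by simp
  have H: "vertices_in (lift_ideal ?P) = vertices_in (lift_ideal I)"
    using sub idem vt_vt_same [OF tN null_ideal_relators] by (auto simp: vertices_in_def)
  interpret admissible_quotient G "vertices_in (lift_ideal I)" "gaps_in (lift_ideal I)"
    using admissible_pair_in [OF lI] wf_digraph_axioms
    by (simp add: admissible_quotient_def admissible_quotient_axioms_def)
  have gap: "vt v - live_part G (vertices_in (lift_ideal I)) v \<in> lift_ideal ?P"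
    if "v \<in> breaking_vertices G (vertices_in (lift_ideal I))"
      "vt v - live_part G (vertices_in (lift_ideal I)) v \<in> lift_ideal I" for v
  proof (rule idem [OF that(2) gap_idem [OF tN null_ideal_relators]])
    show "finite (live_arcs G (vertices_in (lift_ideal I)) v)"
      using that(1) by (auto simp: breaking_vertices_def live_arcs_def)
  qed
  have "gaps_in (lift_ideal ?P) = gaps_in (lift_ideal I)"
    unfolding gaps_in_def H using sub gap by blast
  then have "lift_ideal ?P = lift_ideal I"
    using ideal_eq_kernel [OF K lI] ideal_eq_kernel [OF K lP] H by metis
  then show ?thesis using lift_inject two_sided_ideal_carrier I P by blast
qed

text \<open>By idempotence the intersection of two ideals equals its own square, which lies in their
  product; the other inclusion holds for all ideals.\<close>

lemma list_prod_eq_Inter: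
  assumes K: "alternating G" and "Js \<noteq> []" "\<And>J. J \<in> set Js \<Longrightarrow> two_sided_ideal L J"
  shows "ideal_list_prod L Js = \<Inter>(set Js)"
  using assms(2,3)
proof (induction Js rule: induct_list012)
  case (3 I J Js)
  let ?P = "ideal_list_prod L (J # Js)"
  have I: "two_sided_ideal L I" and P: "two_sided_ideal L ?P"
    using 3(4) two_sided_ideal_list_prod [of "J # Js"] by simp_all
  have eq: "lift_ideal (I \<inter> ?P) = lift_ideal I \<inter> lift_ideal ?P" by (auto simp: lift_ideal_def)
  have "lid G (\<Inter>{lift_ideal I, lift_ideal ?P})"
    by (rule lid_Inter) (use lid_lift [OF I] lid_lift [OF P] in auto)
  then have "lid G (lift_ideal (I \<inter> ?P))" by (simp add: eq)
  then have "two_sided_ideal L (I \<inter> ?P)"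
    using two_sided_ideal_carrier [OF I] by (intro two_sided_idealI) auto
  then have "I \<inter> ?P = ideal_prod L (I \<inter> ?P) (I \<inter> ?P)" by (rule ideal_idempotent [OF K, symmetric])
  also have "\<dots> \<subseteq> ideal_prod L I ?P" by (intro ideal_prod_mono) auto
  finally have "ideal_prod L I ?P = I \<inter> ?P" using ideal_prod_subset [OF I P] by blast
  then show ?case using 3 by simp
qed simp_all

lemma ci_meet_lift_iff:
  assumes I: "two_sided_ideal L I"
  shows "ci_meet G (lift_ideal I) \<longleftrightarrow>
    (\<exists>\<J>. finite \<J> \<and> \<J> \<noteq> {} \<and> (\<forall>J \<in> \<J>. completely_irreducible L J) \<and> I = \<Inter>\<J>)"
proof
  note IC = two_sided_ideal_carrier [OF I]
  assume "ci_meet G (lift_ideal I)"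
  then obtain \<J> where J: "finite \<J>" "\<J> \<noteq> {}" "\<forall>J \<in> \<J>. lid_ci G J" "lift_ideal I = \<Inter>\<J>"
    unfolding ci_meet_def by (elim exE conjE) (rule that)
  let ?\<K> = "(`) cls ` \<J>"
  have lid: "lid G U" if "U \<in> \<J>" for U using bspec [OF J(3) that] by (simp add: lid_ci_def)
  have ci: "completely_irreducible L (cls ` U)" if "U \<in> \<J>" for U
    using lid [OF that] bspec [OF J(3) that] by (simp add: completely_irreducible_iff two_sided_ideal_cls lift_cls)
  have ne: "?\<K> \<noteq> {}" using J(2) by simp
  have lifts: "lift_ideal ` ?\<K> = \<J>"
    using lid by (auto simp: image_image lift_cls intro!: image_eqI)
  obtain V where V: "V \<in> \<J>" using J(2) by blast
  then have "cls ` V \<subseteq> carrier L" using lid [OF V] by (auto simp: carrier_L lid_def)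
  then have sub: "\<Inter>?\<K> \<subseteq> carrier L" using V by blast
  have "lift_ideal (\<Inter>?\<K>) = lift_ideal I" using lift_Inter [OF ne] lifts J(4) by simp
  then have "I = \<Inter>?\<K>" using lift_inject [OF sub IC] by simp
  then show "\<exists>\<J>. finite \<J> \<and> \<J> \<noteq> {} \<and> (\<forall>J \<in> \<J>. completely_irreducible L J) \<and> I = \<Inter>\<J>"
    using J(1) ne ci by (intro exI [of _ ?\<K>]) auto
next
  assume "\<exists>\<J>. finite \<J> \<and> \<J> \<noteq> {} \<and> (\<forall>J \<in> \<J>. completely_irreducible L J) \<and> I = \<Inter>\<J>"
  then obtain \<J> where J: "finite \<J>" "\<J> \<noteq> {}" "\<forall>J \<in> \<J>. completely_irreducible L J" "I = \<Inter>\<J>"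
    by (elim exE conjE) (rule that)
  then show "ci_meet G (lift_ideal I)"
    unfolding ci_meet_def
    by (intro exI [of _ "lift_ideal ` \<J>"]) (auto simp: lift_Inter completely_irreducible_iff)
qed

lemma finite_meets_imp_K:
  assumes "\<And>I. proper_ideal L I \<Longrightarrow>
    \<exists>\<J>. finite \<J> \<and> \<J> \<noteq> {} \<and> (\<forall>J \<in> \<J>. completely_irreducible L J) \<and> I = \<Inter>\<J>"
  shows "condition_K G"
proof (rule ccontr)
  assume "\<not> condition_K G"
  then obtain U :: "('v, 'e, 'k) lpa_poly set"
    where U: "lid G U" "U \<noteq> augmentation" "lid_prime G U" "\<not> lid_ci G U"
    using prime_not_ci by blast
  let ?I = "cls ` U"
  have I: "two_sided_ideal L ?I" "lift_ideal ?I = U" by (rule two_sided_ideal_cls [OF U(1)], rule lift_cls [OF U(1)])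
  then have "proper_ideal L ?I" using U(2) by (simp add: proper_ideal_iff)
  then obtain \<J> where J: "finite \<J>" "\<J> \<noteq> {}" "\<forall>J \<in> \<J>. completely_irreducible L J" "?I = \<Inter>\<J>"
    using assms by meson
  \<comment> \<open>The reverse inclusion is automatic for a member of the intersection, so this
    member equals the prime ideal, which was not completely irreducible.\<close>
  have "\<exists>J \<in> \<J>. J \<subseteq> ?I"
    using J I U(3) by (intro prime_finite_Inter) (auto simp: completely_irreducible_iff)
  then obtain J where "J \<in> \<J>" "J = ?I" using J(4) by blast
  then show False using J(3) U(4) I(2) by (auto simp: completely_irreducible_iff)
qed

lemma finite_prods_imp_K:
  assumes "\<And>I. proper_ideal L I \<Longrightarrow>
    \<exists>Js. Js \<noteq> [] \<and> (\<forall>J \<in> set Js. completely_irreducible L J) \<and> I = ideal_list_prod L Js"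
  shows "condition_K G"
proof (rule ccontr)
  assume "\<not> condition_K G"
  then obtain U :: "('v, 'e, 'k) lpa_poly set"
    where U: "lid G U" "U \<noteq> augmentation" "lid_prime G U" "\<not> lid_ci G U"
    using prime_not_ci by blast
  let ?I = "cls ` U"
  have I: "two_sided_ideal L ?I" "lift_ideal ?I = U" by (rule two_sided_ideal_cls [OF U(1)], rule lift_cls [OF U(1)])
  then have "proper_ideal L ?I" using U(2) by (simp add: proper_ideal_iff)
  then obtain Js where Js: "Js \<noteq> []" "\<forall>J \<in> set Js. completely_irreducible L J" "?I = ideal_list_prod L Js"
    using assms by meson
  have ideals: "two_sided_ideal L J" if "J \<in> set Js" for J
    using Js(2) that by (simp add: completely_irreducible_iff)
  obtain J where J: "J \<in> set Js" "J \<subseteq> ?I"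
    using prime_list_prod [of ?I Js] I U(3) Js ideals by auto
  \<comment> \<open>A product lies in each of its factors, so this factor equals the prime
    ideal.\<close>
  moreover have "?I \<subseteq> J" using two_sided_ideal_list_prod [OF Js(1) ideals] Js(3) J(1) by blast
  ultimately have "completely_irreducible L ?I" using Js(2) by (metis subset_antisym)
  then show False using U(4) I(2) by (simp add: completely_irreducible_iff)
qed

lemma products_iff_meets:
  assumes K: "alternating G"
  shows "(\<exists>Js. Js \<noteq> [] \<and> (\<forall>J \<in> set Js. completely_irreducible L J) \<and> I = ideal_list_prod L Js) \<longleftrightarrow>
    (\<exists>\<J>. finite \<J> \<and> \<J> \<noteq> {} \<and> (\<forall>J \<in> \<J>. completely_irreducible L J) \<and> I = \<Inter>\<J>)"
proof
  assume "\<exists>Js. Js \<noteq> [] \<and> (\<forall>J \<in> set Js. completely_irreducible L J) \<and> I = ideal_list_prod L Js"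
  then obtain Js where Js: "Js \<noteq> []" "\<forall>J \<in> set Js. completely_irreducible L J" "I = ideal_list_prod L Js"
    by blast
  then have "I = \<Inter>(set Js)" using list_prod_eq_Inter [OF K Js(1)] by (simp add: completely_irreducible_iff)
  then show "\<exists>\<J>. finite \<J> \<and> \<J> \<noteq> {} \<and> (\<forall>J \<in> \<J>. completely_irreducible L J) \<and> I = \<Inter>\<J>"
    using Js by (intro exI [of _ "set Js"]) simp
next
  assume "\<exists>\<J>. finite \<J> \<and> \<J> \<noteq> {} \<and> (\<forall>J \<in> \<J>. completely_irreducible L J) \<and> I = \<Inter>\<J>"
  then obtain \<J> where J: "finite \<J>" "\<J> \<noteq> {}" "\<forall>J \<in> \<J>. completely_irreducible L J" "I = \<Inter>\<J>"
    by (elim exE conjE) (rule that)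
  obtain Js where Js: "set Js = \<J>" using finite_list [OF J(1)] by blast
  then have "Js \<noteq> []" using J(2) by auto
  moreover from this have "ideal_list_prod L Js = I"
    using list_prod_eq_Inter [OF K, of Js] J Js by (simp add: completely_irreducible_iff)
  ultimately show "\<exists>Js. Js \<noteq> [] \<and> (\<forall>J \<in> set Js. completely_irreducible L J) \<and> I = ideal_list_prod L Js"
    using J(3) Js by (intro exI [of _ Js]) simp
qed

text \<open>Under (K) the proper ideals are the kernels of the pairs with
  \<open>H \<noteq> verts G\<close>, and a kernel is a finite meet iff the null ideal of the
  quotient graph is.\<close>

lemma meets_iff_tail_covers:
  assumes K: "alternating G"
  shows "(\<forall>I. proper_ideal L I \<longrightarrow>
      (\<exists>\<J>. finite \<J> \<and> \<J> \<noteq> {} \<and> (\<forall>J \<in> \<J>. completely_irreducible L J) \<and> I = \<Inter>\<J>)) \<longleftrightarrow>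
    (\<forall>H S. admissible_pair G H S \<longrightarrow> H \<noteq> verts G \<longrightarrow>
      (\<exists>\<M>. wf_digraph.tail_cover (quotient_graph G H S) \<M>))"
    (is "?meets \<longleftrightarrow> ?covers")
proof -
  have kernel_meet: "ci_meet G (admissible_quotient.kernel G H S :: ('v, 'e, 'k) lpa_poly set) \<longleftrightarrow>
      (\<exists>\<M>. wf_digraph.tail_cover (quotient_graph G H S) \<M>)"
    if "admissible_pair G H S" "H \<noteq> verts G" for H S
  proof -
    interpret admissible_quotient G H S
      using that wf_digraph_axioms by (simp add: admissible_quotient_def admissible_quotient_axioms_def)
    interpret Q: wf_digraph F by (rule wf_quotient)
    have "verts F \<noteq> {}" using hered that(2) by (auto simp: hereditary_def)
    then show ?thesis
      unfolding kernel_def ci_meet_pull [OF lid_null_ideal]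
      by (rule Q.ci_meet_null_ideal_iff [OF alternating_quotient [OF K]])
  qed
  show ?thesis
  proof
    assume meets: ?meets
    show ?covers
    proof (intro allI impI)
      fix H S assume HS: "admissible_pair G H S" "H \<noteq> verts G"
      interpret admissible_quotient G H S
        using HS wf_digraph_axioms by (simp add: admissible_quotient_def admissible_quotient_axioms_def)
      let ?K = "kernel :: ('v, 'e, 'k) lpa_poly set"
      obtain v where "v \<in> verts G" "v \<notin> H" using HS(2) hered by (auto simp: hereditary_def)
      then have "vt v \<notin> ?K" by (simp add: vt_kernel_iff)
      then have ne: "?K \<noteq> augmentation" by auto
      have I: "two_sided_ideal L (cls ` ?K)" "lift_ideal (cls ` ?K) = ?K"
        by (rule two_sided_ideal_cls [OF lid_kernel], rule lift_cls [OF lid_kernel])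
      then have "proper_ideal L (cls ` ?K)" using ne by (simp add: proper_ideal_iff)
      then have "ci_meet G ?K" using meets ci_meet_lift_iff [OF I(1)] I(2) by simp
      then show "\<exists>\<M>. wf_digraph.tail_cover F \<M>" using kernel_meet [OF HS] by blast
    qed
  next
    assume covers: ?covers
    show ?meets
    proof (intro allI impI)
      fix I assume "proper_ideal L I"
      then have I: "two_sided_ideal L I" "lift_ideal I \<noteq> augmentation" by (auto simp: proper_ideal_iff)
      let ?U = "lift_ideal I"
      have U: "lid G ?U" by (rule lid_lift [OF I(1)])
      have "vertices_in ?U \<noteq> verts G"
      proof
        assume "vertices_in ?U = verts G"
        then have "?U = augmentation" by (intro lid_proper_vertex [OF U]) (auto simp: vertices_in_def)
        with I(2) show False by contradiction
      qed
      then have "ci_meet G ?U"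
        using kernel_meet [OF admissible_pair_in [OF U]] covers admissible_pair_in [OF U]
          ideal_eq_kernel [OF K U] by metis
      then show "\<exists>\<J>. finite \<J> \<and> \<J> \<noteq> {} \<and> (\<forall>J \<in> \<J>. completely_irreducible L J) \<and> I = \<Inter>\<J>"
        using ci_meet_lift_iff [OF I(1)] by simp
    qed
  qed
qed

end

theorem theorem6p4:
  fixes E :: "('v, 'e) pre_digraph"
    and L :: "('v, 'e, 'k::field) lpa_poly set ring"
  assumes "wf_digraph E" and "verts E \<noteq> {}"
  defines "L \<equiv> leavitt_path_algebra TYPE('k) E"
  shows
    "((\<forall>I. proper_ideal L I \<longrightarrow>
         (\<exists>Js. Js \<noteq> [] \<and> (\<forall>J \<in> set Js. completely_irreducible L J) \<and> I = ideal_list_prod L Js))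
      \<longleftrightarrow>
      (\<forall>I. proper_ideal L I \<longrightarrow>
         (\<exists>\<J>. finite \<J> \<and> \<J> \<noteq> {} \<and> (\<forall>J \<in> \<J>. completely_irreducible L J) \<and> I = \<Inter>\<J>)))
     \<and>
     ((\<forall>I. proper_ideal L I \<longrightarrow>
         (\<exists>\<J>. finite \<J> \<and> \<J> \<noteq> {} \<and> (\<forall>J \<in> \<J>. completely_irreducible L J) \<and> I = \<Inter>\<J>))
      \<longleftrightarrow>
      (condition_K E \<and>
       (\<forall>H S. admissible_pair E H S \<longrightarrow> H \<noteq> verts E \<longrightarrow>
          (\<exists>\<M>. finite \<M> \<and>
             (\<forall>M \<in> \<M>. maximal_tail (quotient_graph E H S) M \<and> strong_CSP (quotient_graph E H S) M) \<and>
             verts (quotient_graph E H S) = \<Union>\<M>))))"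
    (is "(?products \<longleftrightarrow> ?meets) \<and> (?meets \<longleftrightarrow> condition_K E \<and> ?covers)")
proof -
  interpret lpa E L
    using assms(1) by (simp add: lpa_def lpa_axioms_def L_def)
  have K: "alternating E" if "condition_K E"
    using condition_K_alternating [OF assms(1) that] .
  have covers: "?covers \<longleftrightarrow> (\<forall>H S. admissible_pair E H S \<longrightarrow> H \<noteq> verts E \<longrightarrow>
      (\<exists>\<M>. wf_digraph.tail_cover (quotient_graph E H S) \<M>))"
  proof (intro all_cong1 imp_cong refl)
    fix H S assume "admissible_pair E H S"
    then interpret admissible_quotient E H S
      using assms(1) by (simp add: admissible_quotient_def admissible_quotient_axioms_def)
    show "(\<exists>\<M>. finite \<M> \<and> (\<forall>M \<in> \<M>. maximal_tail F M \<and> strong_CSP F M) \<and> verts F = \<Union>\<M>) \<longleftrightarrow>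
        (\<exists>\<M>. wf_digraph.tail_cover F \<M>)"
      by (simp only: wf_digraph.tail_cover_def [OF wf_quotient])
  qed
  \<comment> \<open>Each of the first two statements yields (K) on its own, so both equivalences can
    be proved under (K).\<close>
  have combine: "(P \<longleftrightarrow> M) \<and> (M \<longleftrightarrow> C \<and> T)"
    if "P \<Longrightarrow> C" "M \<Longrightarrow> C" "C \<Longrightarrow> P \<longleftrightarrow> M" "C \<Longrightarrow> M \<longleftrightarrow> T" for P M C T
    using that by blast
  show ?thesis
  proof (rule combine)
    show "?products \<Longrightarrow> condition_K E" by (rule finite_prods_imp_K) simp
    show "?meets \<Longrightarrow> condition_K E" by (rule finite_meets_imp_K) simp
    show "?products \<longleftrightarrow> ?meets" if "condition_K E"
      using products_iff_meets [OF K [OF that]] by simp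
    show "?meets \<longleftrightarrow> ?covers" if "condition_K E"
      unfolding covers by (rule meets_iff_tail_covers [OF K [OF that]])
  qed
qed

end
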